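(* Let $A\subset C$ and $B\subset D$ be unital inclusions of unital $C^*$-algebras which are strongly Morita equivalent with respect to a $C-D$-equivalence bimodule $Y$ and its closed subspace $X$. Let $E^A:C\to A$ and $E^B:D\to B$ be conditional expectations of Watatani index-finite type with $\mathrm{Ind}_W(E^A)\in A$, and let $E^X$ be a conditional expectation from $Y$ onto $X$ with respect to $E^A$ and $E^B$. Let $C_1,D_1,Y_1$ be the $C^*$-basic constructions for $E^A$, $E^B$ and the upward basic construction for $E^X$, and let $E^C,E^D,E^Y$ be the dual conditional expectations from $C_1,D_1,Y_1$ onto $C,D,Y$. Let $C_2,D_2,Y_2$ be the $C^*$-basic constructions for $E^C,E^D$ and the upward basic construction for $E^Y$, and let $E^{C_1},E^{D_1},E^{Y_1}$ be the dual conditional expectations from $C_2,D_2,Y_2$ onto $C_1,D_1,Y_1$. Then there are a positive integer $k$ and full projections $p\in M_k(A)$ and $q\in M_k(B)$ with $$pM_k(A)p\cong C_1,\quad qM_k(B)q\cong D_1,\quad pM_k(C)p\cong C_2,\quad qM_k(D)q\cong D_2$$ such that there are a $C_1-D_1$-equivalence bimodule isomorphism $\overline{\Phi}$ of $Y_1$ onto $p\cdot M_k(X)\cdot q$ and a $C_2-D_2$-equivalence bimodule isomorphism $\overline{\Phi_1}$ of $Y_2$ onto $p\cdot M_k(Y)\cdot q$ (where $C_1,D_1,C_2,D_2$ are identified with $pM_k(A)p$, $qM_k(B)q$, $pM_k(C)p$, $qM_k(D)q$ by the isomorphisms $pM_k(A)p\cong C_1$, $qM_k(B)q\cong D_1$,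 $pM_k(C)p\cong C_2$, $qM_k(D)q\cong D_2$, respectively) satisfying $$E^{p\cdot M_k(X)\cdot q}\circ\overline{\Phi_1}=\overline{\Phi}\circ E^{Y_1},$$ where $E^{p\cdot M_k(X)\cdot q}$ is the conditional expectation from $p\cdot M_k(Y)\cdot q$ onto $p\cdot M_k(X)\cdot q$ defined by $E^{p\cdot M_k(X)\cdot q}=(E^X\otimes\mathrm{id}_{M_k(\mathbf{C})})|_{p\cdot M_k(Y)\cdot q}$.
   Context: Equivalence bimodules are imprimitivity bimodules; actions are written $c\cdot y$, $y\cdot d$; ${}_C\langle\ ,\ \rangle$ (linear in the first variable) and $\langle\ ,\ \rangle_D$ (linear in the second variable) are the inner products. An equivalence bimodule isomorphism is a bijective bimodule map preserving both inner products. For sets, $\langle U,V\rangle$ means the linear span of the inner products. A projection $p\in M_k(A)$ is full if $M_k(A)pM_k(A)=M_k(A)$ (linear span). Strong Morita equivalence of inclusions: unital inclusions $A\subset C$, $B\subset D$ are strongly Morita equivalent with respect to a $C-D$-equivalence bimodule $Y$ and its closed subspace $X$ if (1) $a\cdot x\in X$ and ${}_C\langle x,y\rangle\in A$ for $a\in A$, $x,y\in X$, and $\overline{{}_C\langle X,X\rangle}=A$, $\overline{{}_C\langle Y,X\rangle}=C$; (2) $x\cdot b\in X$ and $\langle x,y\rangle_D\in B$ for $b\in B$, $x,y\in X$, and $\overline{\langle X,X\rangle_D}=B$, $\overline{\langle Y,X\rangle_D}=D$. Then $X$ is an $A-B$-equivalence bimodule. $M_k(X)$ is an $M_k(A)-M_k(B)$-equivalence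 bimodule and $p\cdot M_k(X)\cdot q$ a $pM_k(A)p-qM_k(B)q$-equivalence bimodule in the usual way; similarly for $Y,C,D$. A linear map $E^X$ from $Y$ onto $X$ is a conditional expectation with respect to $E^A$ and $E^B$ if, for all $a\in A,b\in B,c\in C,d\in D,x\in X,y\in Y$: $E^X(c\cdot x)=E^A(c)\cdot x$; $E^X(a\cdot y)=a\cdot E^X(y)$; $E^A({}_C\langle y,x\rangle)={}_C\langle E^X(y),x\rangle$; $E^X(x\cdot d)=x\cdot E^B(d)$; $E^X(y\cdot b)=E^X(y)\cdot b$; $E^B(\langle y,x\rangle_D)=\langle E^X(y),x\rangle_D$. $E^A$ is of Watatani index-finite type if it has a quasi-basis: a finite family $\{(u_i,u_i^* )\}$ with $u_i\in C$ and $\sum_i u_iE^A(u_i^*c)=c=\sum_i E^A(cu_i)u_i^*$ for all $c\in C$; then $\mathrm{Ind}_W(E^A)=\sum_i u_iu_i^*\in C\cap C'$. The $C^*$-basic construction $C_1$ for $E^A$, with Jones projection $e_A$, is the linear span of $\{c_1e_Ac_2: c_1,c_2\in C\}$, where $e_Ace_A=E^A(c)e_A$; the dual conditional expectation is $E^C(c_1e_Ac_2)=\mathrm{Ind}_W(E^A)^{-1}c_1c_2$, again of Watatani index-finite type. $C$ is a $C_1-A$-equivalence bimodule via ${}_{C_1}\langle x,y\rangle=xe_Ay^*$, $\langle x,y\rangle_A=E^A(x^*y)$, $(xe_Ay)\cdot z=xE^A(yz)$, $x\cdot a=xa$. Likewise for $D_1,e_B,E^D$ and for $C_2,D_2$ (built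 from $E^C,E^D$). Upward basic construction. $Y_1=C\otimes_A X\otimes_B\widetilde D$, where $\widetilde D=\{\widetilde d:d\in D\}$ is the $B-D_1$-equivalence bimodule dual to the $D_1-B$-equivalence bimodule $D$. $Y$ is regarded as a closed subspace of $Y_1$ via $\phi(y)=\sum_{i,j}u_i\otimes E^X(u_i^*\cdot y\cdot v_j)\otimes\widetilde{v_j}$ ($\{(u_i,u_i^* )\}$, $\{(v_j,v_j^* )\}$ quasi-bases for $E^A$, $E^B$), and $C\subset C_1$, $D\subset D_1$ are strongly Morita equivalent with respect to $Y_1$ and $Y$. The dual conditional expectation of $E^X$ is $E^Y:Y_1\to Y$, $E^Y(c\otimes x\otimes\widetilde d)=\mathrm{Ind}_W(E^A)^{-1}c\cdot x\cdot d^*$; it is a conditional expectation with respect to $E^C$ and $E^D$. $Y_2=C_1\otimes_C Y\otimes_D\widetilde{D_1}$ and $E^{Y_1}$ are obtained by applying this construction to $E^Y$. *)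

theory Defs
  imports "HOL-Analysis.Analysis" "HOL-Library.Function_Algebras"
begin

section \<open>Complex vector spaces and unital \<open>C\<^sup>*\<close>-algebras\<close>

class complex_vec = ab_group_add +
  fixes scaleC :: "complex \<Rightarrow> 'a \<Rightarrow> 'a" (infixr "*\<^sub>C" 75)
  assumes scaleC_add_right: "r *\<^sub>C (x + y) = r *\<^sub>C x + r *\<^sub>C y"
    and scaleC_add_left: "(r + s) *\<^sub>C x = r *\<^sub>C x + s *\<^sub>C x"
    and scaleC_scaleC: "r *\<^sub>C (s *\<^sub>C x) = (r * s) *\<^sub>C x"
    and scaleC_one: "1 *\<^sub>C x = x"

global_interpretation complex_vec: vector_space "scaleC :: complex \<Rightarrow> 'a \<Rightarrow> 'a::complex_vec"
  by unfold_locales (simp_all add: scaleC_add_right scaleC_add_left scaleC_scaleC scaleC_one)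

abbreviation cspan :: "'a::complex_vec set \<Rightarrow> 'a set"
  where "cspan \<equiv> complex_vec.span"

abbreviation csubspace :: "'a::complex_vec set \<Rightarrow> bool"
  where "csubspace \<equiv> complex_vec.subspace"

abbreviation clinear :: "('a::complex_vec \<Rightarrow> 'b::complex_vec) \<Rightarrow> bool"
  where "clinear \<equiv> Vector_Spaces.linear scaleC scaleC"

definition conj_linear :: "('a::complex_vec \<Rightarrow> 'b::complex_vec) \<Rightarrow> bool"
  where "conj_linear f \<longleftrightarrow>
    (\<forall>x y. f (x + y) = f x + f y) \<and> (\<forall>r x. f (r *\<^sub>C x) = cnj r *\<^sub>C f x)"

instantiation complex :: complex_vec
begin
definition scaleC_complex :: "complex \<Rightarrow> complex \<Rightarrow> complex"
  where "scaleC_complex r x = r * x"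
instance by standard (simp_all add: scaleC_complex_def algebra_simps)
end

text \<open>Pointwise, like the additive structure on functions in \<^theory>\<open>HOL-Library.Function_Algebras\<close>.\<close>

instantiation "fun" :: (type, complex_vec) complex_vec
begin
definition scaleC_fun :: "complex \<Rightarrow> ('a \<Rightarrow> 'b) \<Rightarrow> 'a \<Rightarrow> 'b"
  where "scaleC_fun r f = (\<lambda>x. r *\<^sub>C f x)"
instance by standard
  (simp_all add: scaleC_fun_def plus_fun_def scaleC_add_right scaleC_add_left scaleC_scaleC scaleC_one)
end

class complex_banach = complex_vec + banach +
  assumes scaleR_scaleC: "scaleR t x = complex_of_real t *\<^sub>C x"
    and norm_scaleC: "norm (r *\<^sub>C x) = cmod r * norm x"

text \<open>Built on \<^class>\<open>monoid_mult\<close> rather than \<^class>\<open>ring_1\<close>, so that the zero algebra is allowed.\<close>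

class cstar_algebra = complex_banach + real_normed_algebra + monoid_mult +
  fixes star :: "'a \<Rightarrow> 'a"
  assumes mult_scaleC_left: "(r *\<^sub>C x) * y = r *\<^sub>C (x * y)"
    and mult_scaleC_right: "x * (r *\<^sub>C y) = r *\<^sub>C (x * y)"
    and star_add: "star (x + y) = star x + star y"
    and star_scaleC: "star (r *\<^sub>C x) = cnj r *\<^sub>C star x"
    and star_mult: "star (x * y) = star y * star x"
    and star_star: "star (star x) = x"
    and cstar_identity: "norm (star x * x) = (norm x)\<^sup>2"

definition cstar_positive :: "'a::cstar_algebra \<Rightarrow> bool"
  where "cstar_positive x \<longleftrightarrow> (\<exists>z. x = star z * z)"

definition unital_cstar_subalgebra :: "'a::cstar_algebra set \<Rightarrow> bool"
  where "unital_cstar_subalgebra A \<longleftrightarrow> csubspace A \<and> closed A \<and> 1 \<in> A \<and>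
    (\<forall>x\<in>A. \<forall>y\<in>A. x * y \<in> A) \<and> (\<forall>x\<in>A. star x \<in> A)"

definition conditional_expectation :: "'a::cstar_algebra set \<Rightarrow> ('a \<Rightarrow> 'a) \<Rightarrow> bool"
  where "conditional_expectation A E \<longleftrightarrow> clinear E \<and>
    (\<forall>c. E c \<in> A) \<and> (\<forall>a\<in>A. E a = a) \<and>
    (\<forall>a\<in>A. \<forall>b\<in>A. \<forall>c. E (a * c * b) = a * E c * b) \<and>
    (\<forall>c. cstar_positive (E (star c * c)))"


section \<open>Algebras and bimodules on carrier sets\<close>

text \<open>
  The algebras and bimodules obtained from given ones (matrix algebras, corners, basic
  constructions, tensor products) live on subsets of types of class \<^class>\<open>complex_vec\<close>, which
  supplies their linear structure. No norm is recorded: a \<open>C\<^sup>*\<close>-norm is determined by the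
  \<open>*\<close>-algebra structure, and the norm of an equivalence bimodule by either inner product.
\<close>

record 'c star_alg =
  acarrier :: "'c set"
  amul :: "'c \<Rightarrow> 'c \<Rightarrow> 'c"
  astar :: "'c \<Rightarrow> 'c"
  aone :: "'c"

text \<open>\<open>lip\<close> is linear in the first variable, \<open>rip\<close> in the second.\<close>

record ('c, 'd, 'y) bimod =
  bcarrier :: "'y set"
  lact :: "'c \<Rightarrow> 'y \<Rightarrow> 'y"
  ract :: "'y \<Rightarrow> 'd \<Rightarrow> 'y"
  lip :: "'y \<Rightarrow> 'y \<Rightarrow> 'c"
  rip :: "'y \<Rightarrow> 'y \<Rightarrow> 'd"

definition type_alg :: "'c::cstar_algebra star_alg"
  where "type_alg = \<lparr>acarrier = UNIV, amul = (*), astar = star, aone = 1\<rparr>"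

definition alg_inv :: "'c star_alg \<Rightarrow> 'c \<Rightarrow> 'c"
  where "alg_inv C h =
    (THE g. g \<in> acarrier C \<and> amul C g h = aone C \<and> amul C h g = aone C)"

definition star_alg_iso ::
    "('c::complex_vec \<Rightarrow> 'e::complex_vec) \<Rightarrow> 'c star_alg \<Rightarrow> 'e star_alg \<Rightarrow> bool"
  where "star_alg_iso f C D \<longleftrightarrow> bij_betw f (acarrier C) (acarrier D) \<and>
    (\<forall>x\<in>acarrier C. \<forall>y\<in>acarrier C. f (x + y) = f x + f y \<and> f (amul C x y) = amul D (f x) (f y)) \<and>
    (\<forall>x\<in>acarrier C. f (astar C x) = astar D (f x) \<and> (\<forall>r. f (r *\<^sub>C x) = r *\<^sub>C f x))"

text \<open>Isomorphism of a \<open>C\<close>-\<open>D\<close>-bimodule \<open>Y\<close> with a bimodule \<open>Z\<close> over the targets of isomorphisms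
  \<open>\<theta>\<close> and \<open>\<psi>\<close> defined on \<open>C\<close> and \<open>D\<close>, along which the algebras are identified.\<close>

definition equivalence_bimodule_iso ::
    "'c star_alg \<Rightarrow> 'd star_alg \<Rightarrow> ('c \<Rightarrow> 'e) \<Rightarrow> ('d \<Rightarrow> 'f) \<Rightarrow> ('y::complex_vec \<Rightarrow> 'z::complex_vec) \<Rightarrow>
     ('c, 'd, 'y) bimod \<Rightarrow> ('e, 'f, 'z) bimod \<Rightarrow> bool"
  where "equivalence_bimodule_iso C D \<theta> \<psi> \<Phi> Y Z \<longleftrightarrow> bij_betw \<Phi> (bcarrier Y) (bcarrier Z) \<and>
    (\<forall>y\<in>bcarrier Y. \<forall>y'\<in>bcarrier Y. \<Phi> (y + y') = \<Phi> y + \<Phi> y' \<and>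
       lip Z (\<Phi> y) (\<Phi> y') = \<theta> (lip Y y y') \<and> rip Z (\<Phi> y) (\<Phi> y') = \<psi> (rip Y y y')) \<and>
    (\<forall>y\<in>bcarrier Y. (\<forall>r. \<Phi> (r *\<^sub>C y) = r *\<^sub>C \<Phi> y) \<and>
       (\<forall>c\<in>acarrier C. \<Phi> (lact Y c y) = lact Z (\<theta> c) (\<Phi> y)) \<and>
       (\<forall>d\<in>acarrier D. \<Phi> (ract Y y d) = ract Z (\<Phi> y) (\<psi> d)))"


section \<open>Equivalence bimodules and strong Morita equivalence of inclusions\<close>

text \<open>Completeness in the norms given by the inner products is the assumption that these norms are
  the norm of a type of class \<^class>\<open>banach\<close>.\<close>

definition equivalence_bimodule ::
    "('c::cstar_algebra, 'd::cstar_algebra, 'y::complex_banach) bimod \<Rightarrow> bool"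
  where "equivalence_bimodule Y \<longleftrightarrow> bcarrier Y = UNIV \<and>
    (\<forall>y. clinear (\<lambda>c. lact Y c y)) \<and> (\<forall>c. clinear (lact Y c)) \<and>
    (\<forall>y. clinear (ract Y y)) \<and> (\<forall>d. clinear (\<lambda>y. ract Y y d)) \<and>
    (\<forall>y. lact Y 1 y = y) \<and> (\<forall>c c' y. lact Y (c * c') y = lact Y c (lact Y c' y)) \<and>
    (\<forall>y. ract Y y 1 = y) \<and> (\<forall>y d d'. ract Y y (d * d') = ract Y (ract Y y d) d') \<and>
    (\<forall>c y d. ract Y (lact Y c y) d = lact Y c (ract Y y d)) \<and>
    (\<forall>z. clinear (\<lambda>y. lip Y y z)) \<and> (\<forall>y z. lip Y y z = star (lip Y z y)) \<and>
    (\<forall>c y z. lip Y (lact Y c y) z = c * lip Y y z) \<and> (\<forall>y. cstar_positive (lip Y y y)) \<and>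
    (\<forall>y. clinear (rip Y y)) \<and> (\<forall>y z. rip Y y z = star (rip Y z y)) \<and>
    (\<forall>y z d. rip Y y (ract Y z d) = rip Y y z * d) \<and> (\<forall>y. cstar_positive (rip Y y y)) \<and>
    (\<forall>y z d. lip Y (ract Y y d) z = lip Y y (ract Y z (star d))) \<and>
    (\<forall>c y z. rip Y (lact Y c y) z = rip Y y (lact Y (star c) z)) \<and>
    (\<forall>x y z. lact Y (lip Y x y) z = ract Y x (rip Y y z)) \<and>
    closure (cspan {lip Y y z | y z. True}) = UNIV \<and>
    closure (cspan {rip Y y z | y z. True}) = UNIV \<and>
    (\<forall>y. (norm y)\<^sup>2 = norm (lip Y y y) \<and> (norm y)\<^sup>2 = norm (rip Y y y))"

definition strongly_Morita_equivalent_inclusions ::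
    "'c::cstar_algebra set \<Rightarrow> 'd::cstar_algebra set \<Rightarrow>
     ('c, 'd, 'y::complex_banach) bimod \<Rightarrow> 'y set \<Rightarrow> bool"
  where "strongly_Morita_equivalent_inclusions A B Y X \<longleftrightarrow>
    equivalence_bimodule Y \<and> csubspace X \<and> closed X \<and>
    (\<forall>a\<in>A. \<forall>x\<in>X. lact Y a x \<in> X) \<and> (\<forall>x\<in>X. \<forall>y\<in>X. lip Y x y \<in> A) \<and>
    closure (cspan {lip Y x y | x y. x \<in> X \<and> y \<in> X}) = A \<and>
    closure (cspan {lip Y y x | y x. x \<in> X}) = UNIV \<and>
    (\<forall>x\<in>X. \<forall>b\<in>B. ract Y x b \<in> X) \<and> (\<forall>x\<in>X. \<forall>y\<in>X. rip Y x y \<in> B) \<and>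
    closure (cspan {rip Y x y | x y. x \<in> X \<and> y \<in> X}) = B \<and>
    closure (cspan {rip Y y x | y x. x \<in> X}) = UNIV"

definition bimodule_expectation ::
    "'c::cstar_algebra set \<Rightarrow> 'd::cstar_algebra set \<Rightarrow> ('c, 'd, 'y::complex_banach) bimod \<Rightarrow> 'y set \<Rightarrow>
     ('c \<Rightarrow> 'c) \<Rightarrow> ('d \<Rightarrow> 'd) \<Rightarrow> ('y \<Rightarrow> 'y) \<Rightarrow> bool"
  where "bimodule_expectation A B Y X E_A E_B E_X \<longleftrightarrow> clinear E_X \<and> range E_X = X \<and>
    (\<forall>c. \<forall>x\<in>X. E_X (lact Y c x) = lact Y (E_A c) x) \<and>
    (\<forall>a\<in>A. \<forall>y. E_X (lact Y a y) = lact Y a (E_X y)) \<and>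
    (\<forall>y. \<forall>x\<in>X. E_A (lip Y y x) = lip Y (E_X y) x) \<and>
    (\<forall>x\<in>X. \<forall>d. E_X (ract Y x d) = ract Y x (E_B d)) \<and>
    (\<forall>y. \<forall>b\<in>B. E_X (ract Y y b) = ract Y (E_X y) b) \<and>
    (\<forall>y. \<forall>x\<in>X. E_B (rip Y y x) = rip Y (E_X y) x)"


section \<open>The \<open>C\<^sup>*\<close>-basic construction\<close>

text \<open>In this and the next section a subalgebra enters only through the expectation \<open>E\<close> onto it,
  as the image of \<open>E\<close>; \<open>E\<close> takes its values in the big algebra.\<close>

definition quasi_basis ::
    "'c::complex_vec star_alg \<Rightarrow> ('c \<Rightarrow> 'c) \<Rightarrow> nat \<Rightarrow> (nat \<Rightarrow> 'c) \<Rightarrow> bool"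
  where "quasi_basis C E n u \<longleftrightarrow> (\<forall>i<n. u i \<in> acarrier C) \<and>
    (\<forall>c\<in>acarrier C. (\<Sum>i<n. amul C (u i) (E (amul C (astar C (u i)) c))) = c \<and>
       (\<Sum>i<n. amul C (E (amul C c (u i))) (astar C (u i))) = c)"

definition index_finite :: "'c::complex_vec star_alg \<Rightarrow> ('c \<Rightarrow> 'c) \<Rightarrow> bool"
  where "index_finite C E \<longleftrightarrow> (\<exists>n u. quasi_basis C E n u)"

text \<open>The Watatani index does not depend on the quasi-basis.\<close>

definition index_W :: "'c::complex_vec star_alg \<Rightarrow> ('c \<Rightarrow> 'c) \<Rightarrow> 'c"
  where "index_W C E =
    (THE h. \<exists>n u. quasi_basis C E n u \<and> h = (\<Sum>i<n. amul C (u i) (astar C (u i))))"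

text \<open>
  \<open>C\<^sub>1\<close> consists of operators on the Hilbert module \<open>C\<close> with inner product \<open>E (x\<^sup>* y)\<close>: the elements
  of \<open>C\<close> act by left multiplication and the Jones projection is \<open>E\<close>. An operator on a
  carrier set is a function that vanishes outside of it.
\<close>

definition on_carrier :: "'c star_alg \<Rightarrow> ('c \<Rightarrow> 'c) \<Rightarrow> 'c \<Rightarrow> 'c::zero"
  where "on_carrier C f = (\<lambda>z. if z \<in> acarrier C then f z else 0)"

definition left_mult :: "'c::complex_vec star_alg \<Rightarrow> 'c \<Rightarrow> 'c \<Rightarrow> 'c"
  where "left_mult C x = on_carrier C (amul C x)"

definition jones_projection :: "'c::complex_vec star_alg \<Rightarrow> ('c \<Rightarrow> 'c) \<Rightarrow> 'c \<Rightarrow> 'c"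
  where "jones_projection C E = on_carrier C E"

definition jones_elem :: "'c::complex_vec star_alg \<Rightarrow> ('c \<Rightarrow> 'c) \<Rightarrow> 'c \<Rightarrow> 'c \<Rightarrow> 'c \<Rightarrow> 'c"
  where "jones_elem C E x y = left_mult C x \<circ> jones_projection C E \<circ> left_mult C y"

definition basic_carrier :: "'c::complex_vec star_alg \<Rightarrow> ('c \<Rightarrow> 'c) \<Rightarrow> ('c \<Rightarrow> 'c) set"
  where "basic_carrier C E =
    cspan {jones_elem C E x y | x y. x \<in> acarrier C \<and> y \<in> acarrier C}"

definition basic_construction ::
    "'c::complex_vec star_alg \<Rightarrow> ('c \<Rightarrow> 'c) \<Rightarrow> ('c \<Rightarrow> 'c) star_alg"
  where "basic_construction C E =
    \<lparr>acarrier = basic_carrier C E,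
     amul = (\<circ>),
     astar = (\<lambda>T. THE S. S \<in> basic_carrier C E \<and>
       (\<forall>x\<in>acarrier C. \<forall>y\<in>acarrier C.
          E (amul C (astar C (S x)) y) = E (amul C (astar C x) (T y)))),
     aone = on_carrier C id\<rparr>"

text \<open>The dual conditional expectation, as a map from \<open>C\<^sub>1\<close> to \<open>C\<close>. It is determined on \<open>C\<^sub>1\<close>;
  its values elsewhere are irrelevant.\<close>

definition dual_expectation :: "'c::complex_vec star_alg \<Rightarrow> ('c \<Rightarrow> 'c) \<Rightarrow> ('c \<Rightarrow> 'c) \<Rightarrow> 'c"
  where "dual_expectation C E = (SOME L. clinear L \<and>
    (\<forall>x\<in>acarrier C. \<forall>y\<in>acarrier C.
       L (jones_elem C E x y) = amul C (alg_inv C (index_W C E)) (amul C x y)))"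


section \<open>The upward basic construction\<close>

record ('c, 'd, 'y) expectation_data =
  lalg :: "'c star_alg"
  lexp :: "'c \<Rightarrow> 'c"
  ralg :: "'d star_alg"
  rexp :: "'d \<Rightarrow> 'd"
  bim :: "('c, 'd, 'y) bimod"
  bexp :: "'y \<Rightarrow> 'y"

text \<open>The forms on \<open>C \<times> X \<times> D\<close> that induce linear forms on \<open>C \<otimes>\<^sub>A X \<otimes>\<^sub>B D~\<close>. The dual
  \<open>D~\<close> is the conjugate vector space of \<open>D\<close>, with \<open>b \<cdot> d~ = (d b\<^sup>*)~\<close> and
  \<open>d~ \<cdot> T = (T\<^sup>* d)~\<close>.\<close>

definition balanced_forms ::
    "('c::complex_vec, 'd::complex_vec, 'y::complex_vec) expectation_data \<Rightarrow>
     ('c \<Rightarrow> 'y \<Rightarrow> 'd \<Rightarrow> complex) set"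
  where "balanced_forms S =
    (let C = lalg S; D = ralg S; Y = bim S;
         A = lexp S ` acarrier C; B = rexp S ` acarrier D; X = bexp S ` bcarrier Y
     in {f. \<forall>c\<in>acarrier C. \<forall>x\<in>X. \<forall>d\<in>acarrier D.
          (\<forall>c'\<in>acarrier C. f (c + c') x d = f c x d + f c' x d) \<and>
          (\<forall>x'\<in>X. f c (x + x') d = f c x d + f c x' d) \<and>
          (\<forall>d'\<in>acarrier D. f c x (d + d') = f c x d + f c x d') \<and>
          (\<forall>r. f (r *\<^sub>C c) x d = r * f c x d \<and> f c (r *\<^sub>C x) d = r * f c x d \<and>
               f c x (r *\<^sub>C d) = cnj r * f c x d) \<and>
          (\<forall>a\<in>A. f (amul C c a) x d = f c (lact Y a x) d) \<and>
          (\<forall>b\<in>B. f c (ract Y x b) d = f c x (amul D d (astar D b)))})"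

type_synonym ('c, 'd, 'y) tensor = "('c \<Rightarrow> 'y \<Rightarrow> 'd \<Rightarrow> complex) \<Rightarrow> complex"

text \<open>
  The balanced tensor product is realised inside the algebraic dual of the space of balanced
  forms, \<open>c \<otimes> x \<otimes> d~\<close> being evaluation at \<open>(c, x, d)\<close>. As linear forms separate the points of a
  complex vector space, the span of these elements is the quotient of the free vector space on
  \<open>C \<times> X \<times> D\<close> by the balancing relations. The quasi-bases make \<open>C\<close> and \<open>D\<close> finitely
  generated projective over \<open>A\<close> and \<open>B\<close>, hence this algebraic tensor product is already
  complete and without nonzero null vectors.
\<close>

definition tensor ::
    "('c::complex_vec, 'd::complex_vec, 'y::complex_vec) expectation_data \<Rightarrow>
     'c \<Rightarrow> 'y \<Rightarrow> 'd \<Rightarrow> ('c, 'd, 'y) tensor"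
  where "tensor S c x d = (\<lambda>f. if f \<in> balanced_forms S then f c x d else 0)"

text \<open>
  The inner products are those of the iterated internal tensor product of the
  \<open>C\<^sub>1\<close>-\<open>A\<close>-bimodule \<open>C\<close>, the \<open>A\<close>-\<open>B\<close>-bimodule \<open>X\<close> and the \<open>B\<close>-\<open>D\<^sub>1\<close>-bimodule \<open>D~\<close>:
  the left one of \<open>c \<otimes> x \<otimes> d~\<close> and \<open>c' \<otimes> x' \<otimes> d'~\<close> is
  \<open>c \<langle>x \<cdot> \<langle>d, d'\<rangle>\<^sub>B, x'\<rangle> e\<^sub>A c'\<^sup>*\<close> with the \<open>A\<close>-valued inner product of \<open>X\<close>, the right one is
  \<open>d e\<^sub>B \<langle>x, \<langle>c, c'\<rangle>\<^sub>A \<cdot> x'\<rangle> d'\<^sup>*\<close> with the \<open>B\<close>-valued one.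
  All operations are determined on the carrier by their values on elementary tensors.
\<close>

definition upward_bimod ::
    "('c::complex_vec, 'd::complex_vec, 'y::complex_vec) expectation_data \<Rightarrow>
     ('c \<Rightarrow> 'c, 'd \<Rightarrow> 'd, ('c, 'd, 'y) tensor) bimod"
  where "upward_bimod S =
    (let C = lalg S; E = lexp S; D = ralg S; F = rexp S; Y = bim S;
         X = bexp S ` bcarrier Y; D1 = basic_construction D F
     in \<lparr>bcarrier = cspan {tensor S c x d | c x d. c \<in> acarrier C \<and> x \<in> X \<and> d \<in> acarrier D},
         lact = (\<lambda>T. SOME L. clinear L \<and>
           (\<forall>c\<in>acarrier C. \<forall>x\<in>X. \<forall>d\<in>acarrier D. L (tensor S c x d) = tensor S (T c) x d)),
         ract = (\<lambda>t T. (SOME L. clinear L \<and>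
           (\<forall>c\<in>acarrier C. \<forall>x\<in>X. \<forall>d\<in>acarrier D.
              L (tensor S c x d) = tensor S c x (astar D1 T d))) t),
         lip = (SOME G. (\<forall>t. clinear (\<lambda>s. G s t)) \<and> (\<forall>s. conj_linear (\<lambda>t. G s t)) \<and>
           (\<forall>c\<in>acarrier C. \<forall>x\<in>X. \<forall>d\<in>acarrier D. \<forall>c'\<in>acarrier C. \<forall>x'\<in>X. \<forall>d'\<in>acarrier D.
              G (tensor S c x d) (tensor S c' x' d') =
                jones_elem C E (amul C c (lip Y (ract Y x (F (amul D (astar D d) d'))) x'))
                  (astar C c'))),
         rip = (SOME G. (\<forall>t. conj_linear (\<lambda>s. G s t)) \<and> (\<forall>s. clinear (\<lambda>t. G s t)) \<and>
           (\<forall>c\<in>acarrier C. \<forall>x\<in>X. \<forall>d\<in>acarrier D. \<forall>c'\<in>acarrier C. \<forall>x'\<in>X. \<forall>d'\<in>acarrier D.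
              G (tensor S c x d) (tensor S c' x' d') =
                jones_elem D F d
                  (amul D (rip Y x (lact Y (E (amul C (astar C c) c')) x')) (astar D d'))))\<rparr>)"

text \<open>The embedding \<open>\<phi>\<close> of \<open>Y\<close> into \<open>Y\<^sub>1\<close>; it does not depend on the quasi-bases.\<close>

definition upward_embedding ::
    "('c::complex_vec, 'd::complex_vec, 'y::complex_vec) expectation_data \<Rightarrow>
     'y \<Rightarrow> ('c, 'd, 'y) tensor"
  where "upward_embedding S y =
    (THE t. \<exists>n u m v. quasi_basis (lalg S) (lexp S) n u \<and> quasi_basis (ralg S) (rexp S) m v \<and>
       t = (\<Sum>i<n. \<Sum>j<m. tensor S (u i)
              (bexp S (ract (bim S) (lact (bim S) (astar (lalg S) (u i)) y) (v j))) (v j)))"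

text \<open>The dual conditional expectation, as a map from \<open>Y\<^sub>1\<close> to \<open>Y\<close>.\<close>

definition dual_bimodule_expectation ::
    "('c::complex_vec, 'd::complex_vec, 'y::complex_vec) expectation_data \<Rightarrow>
     ('c, 'd, 'y) tensor \<Rightarrow> 'y"
  where "dual_bimodule_expectation S =
    (let C = lalg S; D = ralg S; Y = bim S; X = bexp S ` bcarrier Y
     in SOME L. clinear L \<and>
       (\<forall>c\<in>acarrier C. \<forall>x\<in>X. \<forall>d\<in>acarrier D. L (tensor S c x d) =
          lact Y (alg_inv C (index_W C (lexp S))) (ract Y (lact Y c x) (astar D d))))"

text \<open>In the result \<open>C\<close>, \<open>D\<close> and \<open>Y\<close> are regarded as subsets of \<open>C\<^sub>1\<close>, \<open>D\<^sub>1\<close> and \<open>Y\<^sub>1\<close>.\<close>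

definition upward ::
    "('c::complex_vec, 'd::complex_vec, 'y::complex_vec) expectation_data \<Rightarrow>
     ('c \<Rightarrow> 'c, 'd \<Rightarrow> 'd, ('c, 'd, 'y) tensor) expectation_data"
  where "upward S =
    \<lparr>lalg = basic_construction (lalg S) (lexp S),
     lexp = left_mult (lalg S) \<circ> dual_expectation (lalg S) (lexp S),
     ralg = basic_construction (ralg S) (rexp S),
     rexp = left_mult (ralg S) \<circ> dual_expectation (ralg S) (rexp S),
     bim = upward_bimod S,
     bexp = upward_embedding S \<circ> dual_bimodule_expectation S\<rparr>"


section \<open>Matrices and corners\<close>

text \<open>A \<open>k \<times> k\<close> matrix is a function of two indices that vanishes unless both are below \<open>k\<close>.\<close>

definition mat_carrier :: "nat \<Rightarrow> 'a::zero set \<Rightarrow> (nat \<Rightarrow> nat \<Rightarrow> 'a) set"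
  where "mat_carrier k U = {M. \<forall>i j. if i < k \<and> j < k then M i j \<in> U else M i j = 0}"

definition mat_alg :: "nat \<Rightarrow> 'c::complex_vec star_alg \<Rightarrow> (nat \<Rightarrow> nat \<Rightarrow> 'c) star_alg"
  where "mat_alg k C =
    \<lparr>acarrier = mat_carrier k (acarrier C),
     amul = (\<lambda>M N i j. \<Sum>l<k. amul C (M i l) (N l j)),
     astar = (\<lambda>M i j. astar C (M j i)),
     aone = (\<lambda>i j. if i = j \<and> i < k then aone C else 0)\<rparr>"

definition mat_bimod :: "nat \<Rightarrow> ('c::complex_vec, 'd::complex_vec, 'y::complex_vec) bimod \<Rightarrow>
    (nat \<Rightarrow> nat \<Rightarrow> 'c, nat \<Rightarrow> nat \<Rightarrow> 'd, nat \<Rightarrow> nat \<Rightarrow> 'y) bimod"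
  where "mat_bimod k Y =
    \<lparr>bcarrier = mat_carrier k (bcarrier Y),
     lact = (\<lambda>M N i j. \<Sum>l<k. lact Y (M i l) (N l j)),
     ract = (\<lambda>M N i j. \<Sum>l<k. ract Y (M i l) (N l j)),
     lip = (\<lambda>M N i j. \<Sum>l<k. lip Y (M i l) (N j l)),
     rip = (\<lambda>M N i j. \<Sum>l<k. rip Y (M l i) (N l j))\<rparr>"

definition mat_map :: "('y \<Rightarrow> 'z) \<Rightarrow> (nat \<Rightarrow> nat \<Rightarrow> 'y) \<Rightarrow> nat \<Rightarrow> nat \<Rightarrow> 'z"
  where "mat_map f M = (\<lambda>i j. f (M i j))"

definition projection :: "'c star_alg \<Rightarrow> 'c \<Rightarrow> bool"
  where "projection C p \<longleftrightarrow> p \<in> acarrier C \<and> amul C p p = p \<and> astar C p = p"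

definition full_projection :: "'c::complex_vec star_alg \<Rightarrow> 'c \<Rightarrow> bool"
  where "full_projection C p \<longleftrightarrow> projection C p \<and>
    cspan {amul C (amul C x p) y | x y. x \<in> acarrier C \<and> y \<in> acarrier C} = acarrier C"

definition corner :: "'c star_alg \<Rightarrow> 'c \<Rightarrow> 'c star_alg"
  where "corner C p =
    C\<lparr>acarrier := {amul C (amul C p x) p | x. x \<in> acarrier C}, aone := p\<rparr>"

definition corner_bimod :: "('c, 'd, 'y) bimod \<Rightarrow> 'c \<Rightarrow> 'd \<Rightarrow> ('c, 'd, 'y) bimod"
  where "corner_bimod Y p q =
    Y\<lparr>bcarrier := {ract Y (lact Y p y) q | y. y \<in> bcarrier Y}\<rparr>"

end

theory Submission
  imports Defs
begin

text \<open>
  A quasi-basis \<open>u\<^sub>1, \<dots>, u\<^sub>k\<close> of \<open>E\<^sup>A\<close> is a frame of the Hilbert \<open>A\<close>-module \<open>C\<close>: every \<open>x\<close> is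
  \<open>\<Sum> u\<^sub>i E\<^sup>A(u\<^sub>i\<^sup>* x)\<close>, so that its coordinates \<open>E\<^sup>A(u\<^sub>i\<^sup>* x)\<close> identify \<open>C\<close> with \<open>p A\<^sup>k\<close> for the Gram
  projection \<open>p = (E\<^sup>A(u\<^sub>i\<^sup>* u\<^sub>j))\<close>. The algebra \<open>C\<^sub>1\<close> of right \<open>A\<close>-linear operators thereby becomes
  \<open>p M\<^sub>k(A) p\<close>. The same happens one level up: the elements \<open>u\<^sub>i e\<^sub>A\<close> form a frame of the right
  \<open>C\<close>-module \<open>C\<^sub>1\<close>, with the same Gram projection; the only change is that the inner product
  \<open>E\<^sup>C(S\<^sup>* T)\<close> is \<open>\<rho>\<close> times the standard one of the coordinates, where \<open>\<rho>\<close> is the inverse of the central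
  element \<open>h = Ind\<^sub>W(E\<^sup>A)\<close>. Hence \<open>C\<^sub>2\<close> is \<open>p M\<^sub>k(C) p\<close>. The locale \<open>frame\<close> treats both levels at once,
  and \<open>star_alg_iso_to_matrix\<close> and \<open>full_projection_gram\<close> are its results. Padding quasi-bases with
  zeros makes \<open>k\<close> the same for \<open>E\<^sup>A\<close> and \<open>E\<^sup>B\<close>.
\<close>

text \<open>
  The tensor products are treated in the same uniform way, in the locale \<open>bimodule_frame\<close>. The
  matrix of \<open>c \<otimes> x \<otimes> d~\<close> has the entries \<open>\<rho> c\<^sub>i x d\<^sub>l\<^sup>*\<close>, where \<open>c\<^sub>i\<close> and \<open>d\<^sub>l\<close> are the coordinates of \<open>c\<close>
  and \<open>d\<close>. The inner products of \<open>C\<close> and of \<open>D\<close> contribute one factor \<open>\<rho>\<close> and one factor \<open>\<rho>'\<close> to an inner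
  product of tensors, and the two factors \<open>\<rho>\<close> on the matrix side match them because \<open>\<rho> x = x \<rho>'\<close>. For
  the second level this is the identity \<open>Ind\<^sub>W(E\<^sup>A) y = y Ind\<^sub>W(E\<^sup>B)\<close>, both sides being
  \<open>\<Sum> u\<^sub>i E\<^sup>X(u\<^sub>i\<^sup>* y v\<^sub>l) v\<^sub>l\<^sup>*\<close> (\<open>reconstruct\<close>, \<open>index_act\<close>). The result is
  \<open>equivalence_bimodule_iso_coordinates\<close>, used for \<open>Y\<^sub>1\<close> and for \<open>Y\<^sub>2\<close>. Under the first isomorphism \<open>y\<close> in
  \<open>Y \<subseteq> Y\<^sub>1\<close> becomes the matrix \<open>(E\<^sup>X(u\<^sub>i\<^sup>* y v\<^sub>l))\<close>. Therefore \<open>E\<^sup>Y\<^sup>1(T \<otimes> y \<otimes> T'~) = h\<^sup>-\<^sup>1 T y T'\<^sup>*\<close>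
  becomes \<open>(E\<^sup>X(h\<^sup>-\<^sup>1 T\<^sub>i y T'\<^sub>l\<^sup>*))\<close>, which is \<open>E\<^sup>X\<close> applied entrywise to the matrix of \<open>T \<otimes> y \<otimes> T'~\<close>
  (\<open>expectation_coordinates\<close>). The formula for \<open>E\<^sup>Y\<^sup>1\<close> rests on \<open>h \<in> A\<close>, which makes the index of \<open>E\<^sup>C\<close>
  equal to \<open>h\<close>.
\<close>

text \<open>
  Two facts come from outside this computation. That \<open>h\<close> is invertible follows from
  \<open>h = 1 + \<Sum> z\<^sub>i z\<^sub>i\<^sup>*\<close> with \<open>z\<^sub>i = u\<^sub>i - E\<^sup>A(u\<^sub>i)\<close>, once elements \<open>z z\<^sup>*\<close> of a C*-algebra are known to
  have nonnegative spectrum; this is Kaplansky's theorem \<open>pos_elem_star_mult\<close>. And a map with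
  prescribed values on elementary tensors exists as soon as these values are balanced
  (\<open>balanced_extension\<close>), because linear forms separate the points of any complex vector space.
\<close>

section \<open>Linear maps\<close>

lemma clinear_iff:
  "clinear f \<longleftrightarrow> (\<forall>x y. f (x + y) = f x + f y) \<and> (\<forall>r x. f (r *\<^sub>C x) = r *\<^sub>C f x)"
  by (auto simp: Vector_Spaces.linear_def module_hom_def module_hom_axioms_def
      complex_vec.vector_space_axioms complex_vec.module_axioms)

lemma clinear_add: "clinear f \<Longrightarrow> f (x + y) = f x + f y"
  and clinear_scale: "clinear f \<Longrightarrow> f (r *\<^sub>C x) = r *\<^sub>C f x"
  by (simp_all add: clinear_iff)

lemma clinear_zero: "clinear f \<Longrightarrow> f 0 = 0"
  using clinear_scale[of f 0 0] by simp

lemma clinear_diff: "clinear f \<Longrightarrow> f (x - y) = f x - f y"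
  using clinear_add[of f "x - y" y] by simp

lemma clinear_sum: "clinear f \<Longrightarrow> f (\<Sum>i\<in>I. g i) = (\<Sum>i\<in>I. f (g i))"
  by (induction I rule: infinite_finite_induct) (simp_all add: clinear_zero clinear_add)

lemma scaleC_apply: "(r *\<^sub>C f) x = r *\<^sub>C f x"
  by (simp add: scaleC_fun_def)

lemma clinear_comp: "clinear f \<Longrightarrow> clinear g \<Longrightarrow> clinear (\<lambda>x. f (g x))"
  by (simp add: clinear_iff)

lemma clinear_eq_on_span:
  assumes "clinear f" "clinear g" "\<And>x. x \<in> B \<Longrightarrow> f x = g x" "x \<in> cspan B"
  shows "f x = g x"
proof -
  have "csubspace {x. f x = g x}"
    using assms(1,2) by (intro complex_vec.subspaceI) (simp_all add: clinear_zero clinear_add clinear_scale)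
  then have "cspan B \<subseteq> {x. f x = g x}" using assms(3) by (intro complex_vec.span_minimal) auto
  then show ?thesis using assms(4) by blast
qed

text \<open>
  The inner products of a tensor product are pinned down by this: they are prescribed on
  elementary tensors only.
\<close>

lemma sesquilinear_eq_on_span:
  assumes "\<And>t. clinear (\<lambda>s. G s t)" "\<And>s. conj_linear (G s)"
    and "\<And>t. clinear (\<lambda>s. H s t)" "\<And>s. conj_linear (H s)"
    and eq: "\<And>s t. s \<in> B \<Longrightarrow> t \<in> B \<Longrightarrow> G s t = H s t"
    and "s \<in> cspan B" "t \<in> cspan B"
  shows "G s t = H s t"
proof -
  have zero: "F s 0 = 0" if "\<And>s. conj_linear (F s)" for F :: "'a \<Rightarrow> 'a \<Rightarrow> 'b" and s
    using that[of s] unfolding conj_linear_def by (metis complex_vec.scale_zero_left complex_cnj_zero)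
  have "cspan B \<subseteq> {t. G s t = H s t}" if s: "s \<in> B" for s
  proof (rule complex_vec.span_minimal)
    show "csubspace {t. G s t = H s t}"
      using assms(2)[of s] assms(4)[of s] zero[of G, OF assms(2)] zero[of H, OF assms(4)]
      by (intro complex_vec.subspaceI) (simp_all add: conj_linear_def)
  qed (use eq s in auto)
  then have "G s t = H s t" if "s \<in> B" for s using that assms(7) by blast
  then show ?thesis
    using clinear_eq_on_span[OF assms(1) assms(3)] assms(6) by blast
qed

lemma fun_sum_apply: "(\<Sum>i\<in>I. f i) x = (\<Sum>i\<in>I. f i x)"
  by (induction I rule: infinite_finite_induct) auto

section \<open>Positive elements of a C*-algebra\<close>

text \<open>An inequality, since \<open>1\<close> has norm \<open>0\<close> in the zero algebra.\<close>

lemma norm_one_le: "norm (1::'a::cstar_algebra) \<le> 1"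
proof -
  have s1: "star (1::'a) = 1"
    by (metis mult_1_left mult_1_right star_mult star_star)
  have "norm (1::'a) = (norm (1::'a))\<^sup>2"
    using cstar_identity[of "1::'a"] s1 by simp
  then have "norm (1::'a) = 0 \<or> norm (1::'a) = 1"
    by (auto simp: power2_eq_square)
  then show ?thesis by auto
qed

lemma star_one [simp]: "star (1::'a::cstar_algebra) = 1"
  by (metis mult_1_left mult_1_right star_mult star_star)

lemma star_scaleR: "star (t *\<^sub>R x) = t *\<^sub>R star (x::'a::cstar_algebra)"
  by (simp add: scaleR_scaleC star_scaleC)

lemma star_zero [simp]: "star (0::'a::cstar_algebra) = 0"
  using star_scaleR[of 0 "0::'a"] by simp

lemma star_minus: "star (- x) = - star (x::'a::cstar_algebra)"
  using star_scaleR[of "-1" x] by simp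

lemma star_diff: "star (x - y) = star x - star (y::'a::cstar_algebra)"
  using star_add[of x "- y"] by (simp add: star_minus)

lemma star_sum: "star (\<Sum>i\<in>I. f i) = (\<Sum>i\<in>I. star (f i :: 'a::cstar_algebra))"
  by (induction I rule: infinite_finite_induct) (simp_all add: star_add)

lemma norm_star: "norm (star x) = norm (x::'a::cstar_algebra)"
proof -
  have *: "norm y \<le> norm (star y)" for y :: 'a
  proof (cases "norm y = 0")
    case False
    have "norm y * norm y \<le> norm (star y) * norm y"
      using cstar_identity[of y] norm_mult_ineq[of "star y" y] by (simp add: power2_eq_square)
    then show ?thesis using False by (simp add: mult_le_cancel_right)
  qed auto
  show ?thesis using *[of x] *[of "star x"] by (simp add: star_star)
qed

lemma star_mult_self_eq_0: "star x * x = 0 \<Longrightarrow> x = (0::'a::cstar_algebra)"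
  using cstar_identity[of x] by simp

lemma norm_square_selfadjoint: "star k = k \<Longrightarrow> norm (k * k) = (norm (k::'a::cstar_algebra))\<^sup>2"
  using cstar_identity[of k] by simp

lemma bounded_linear_star: "bounded_linear (star :: 'a::cstar_algebra \<Rightarrow> 'a)"
  by (rule bounded_linear_intro[of _ 1]) (simp_all add: star_add star_scaleR norm_star)

definition unit_elem :: "'a::monoid_mult \<Rightarrow> bool"
  where "unit_elem x \<longleftrightarrow> (\<exists>y. x * y = 1 \<and> y * x = 1)"

lemma Neumann_series:
  fixes x :: "'a::cstar_algebra"
  assumes "norm x < 1"
  shows "unit_elem (1 - x)"
proof -
  have n: "norm (x ^ Suc n) \<le> norm x ^ Suc n" for n
    by (induction n) (auto intro!: order_trans[OF norm_mult_ineq] mult_left_mono)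
  have "summable (\<lambda>n. x ^ Suc n)"
    by (rule summable_comparison_test'[where g="\<lambda>n. norm x ^ Suc n" and N=0])
      (use assms n in \<open>auto simp: summable_mult\<close>)
  then have s: "summable (\<lambda>n. x ^ n)" by (simp only: summable_Suc_iff)
  let ?y = "\<Sum>n. x ^ n"
  have "?y = 1 + (\<Sum>n. x ^ Suc n)"
    using suminf_split_head[OF s] by simp
  moreover have "(\<Sum>n. x ^ Suc n) = x * ?y"
    using suminf_mult[OF s, of x] by simp
  moreover have "(\<Sum>n. x ^ Suc n) = ?y * x"
    using suminf_mult2[OF s, of x] by (simp only: power_Suc2)
  ultimately have "(1 - x) * ?y = 1" "?y * (1 - x) = 1"
    by (simp_all add: algebra_simps)
  then show ?thesis unfolding unit_elem_def by blast
qed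

text \<open>
  The root is \<open>1 - z\<close>, where \<open>z\<close> is the limit of the iteration \<open>y \<mapsto> (b + y\<^sup>2) / 2\<close> started at \<open>0\<close>. The
  same iteration with the scalar \<open>1\<close> in place of \<open>b\<close> increases and is bounded by \<open>1\<close>, and its increments
  dominate the norms of the increments of \<open>y\<close>; so the iteration also converges when the norm of \<open>b\<close> is
  \<open>1\<close>, where it need not be a contraction. All iterates are polynomials in \<open>b\<close>, whence the root is
  self-adjoint and commutes with whatever commutes with \<open>b\<close>.
\<close>

lemma sqrt_one_minus:
  fixes b :: "'a::cstar_algebra"
  assumes sa: "star b = b" and nb: "norm b \<le> 1"
  obtains k where "star k = k" "norm (1 - k) \<le> 1" "k * k = 1 - b"
    "\<And>c. c * b = b * c \<Longrightarrow> c * k = k * c"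
proof -
  define y where "y = rec_nat 0 (\<lambda>n (z::'a). (1/2) *\<^sub>R (b + z * z))"
  define s where "s = rec_nat 0 (\<lambda>n (z::real). (1/2) * (1 + z * z))"
  have y0: "y 0 = 0" and yS: "y (Suc n) = (1/2) *\<^sub>R (b + y n * y n)" for n
    by (simp_all add: y_def)
  have s0: "s 0 = 0" and sS: "s (Suc n) = (1/2) * (1 + s n * s n)" for n
    by (simp_all add: s_def)
  have s_bd: "0 \<le> s n \<and> s n \<le> 1" for n
  proof (induction n)
    case (Suc n)
    then have "s n * s n \<le> 1 * 1" by (intro mult_mono) auto
    then show ?case by (simp add: sS)
  qed (simp add: s0)
  have s_inc: "s n \<le> s (Suc n)" for n
  proof -
    have "s (Suc n) - s n = (1 - s n)\<^sup>2 / 2"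
      unfolding sS by (simp add: power2_eq_square field_simps)
    then show ?thesis by (metis diff_ge_0_iff_ge divide_nonneg_pos zero_le_power2 zero_less_numeral)
  qed
  have y_bd: "norm (y n) \<le> s n" for n
  proof (induction n)
    case (Suc n)
    have "norm (b + y n * y n) \<le> 1 + s n * s n"
      by (rule order_trans[OF norm_triangle_ineq] add_mono nb order_trans[OF norm_mult_ineq] mult_mono Suc)+
         (use s_bd in auto)
    then show ?case by (simp add: yS sS)
  qed (simp add: y0 s0)
  have step: "norm (y (Suc n) - y n) \<le> s (Suc n) - s n" for n
  proof (induction n)
    case 0
    then show ?case using nb by (simp add: y0 s0 yS sS)
  next
    case (Suc n)
    let ?d = "y (Suc n) - y n"
    have "y (Suc (Suc n)) - y (Suc n) = (1/2) *\<^sub>R (y (Suc n) * ?d + ?d * y n)"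
      unfolding yS[of "Suc n"] yS[of n, symmetric]
      by (subst (3) yS) (simp add: algebra_simps)
    also have "norm \<dots> \<le> (1/2) * (s (Suc n) * (s (Suc n) - s n) + (s (Suc n) - s n) * s n)"
    proof -
      have "norm (y (Suc n) * ?d) \<le> s (Suc n) * (s (Suc n) - s n)"
        by (rule order_trans[OF norm_mult_ineq]) (use s_bd s_inc y_bd Suc in \<open>auto intro!: mult_mono\<close>)
      moreover have "norm (?d * y n) \<le> (s (Suc n) - s n) * s n"
        by (rule order_trans[OF norm_mult_ineq]) (use s_bd s_inc y_bd Suc in \<open>auto intro!: mult_mono\<close>)
      ultimately show ?thesis
        using norm_triangle_ineq[of "y (Suc n) * ?d" "?d * y n"] by simp
    qed
    also have "\<dots> = s (Suc (Suc n)) - s (Suc n)"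
      unfolding sS[of "Suc n"] by (subst (6) sS) (simp add: field_simps)
    finally show ?case .
  qed
  have "convergent s"
    by (rule Bseq_monoseq_convergent)
      (use s_bd s_inc in \<open>auto intro!: BseqI'[of _ 1] simp: monoseq_Suc\<close>)
  then have "summable (\<lambda>n. s (Suc n) - s n)"
    using telescope_summable convergent_LIMSEQ_iff by blast
  then have "summable (\<lambda>n. y (Suc n) - y n)"
    by (rule summable_comparison_test'[where N=0]) (rule step)
  then have "(\<lambda>n. \<Sum>i<n. y (Suc i) - y i) \<longlonglongrightarrow> (\<Sum>i. y (Suc i) - y i)"
    by (rule summable_LIMSEQ)
  moreover have "(\<lambda>n. \<Sum>i<n. y (Suc i) - y i) = y"
    by (rule ext) (simp only: sum_lessThan_telescope y0 diff_zero)
  ultimately obtain z where z: "y \<longlonglongrightarrow> z" by auto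
  have "(\<lambda>n. y (Suc n)) \<longlonglongrightarrow> (1/2) *\<^sub>R (b + z * z)"
    unfolding yS by (intro tendsto_intros z)
  then have zeq: "z = (1/2) *\<^sub>R (b + z * z)"
    using LIMSEQ_unique LIMSEQ_Suc[OF z] by blast
  have sz: "star z = z"
  proof -
    have "star (y n) = y n" for n
      by (induction n) (simp_all add: y0 yS star_add star_mult star_scaleR sa)
    then show ?thesis
      using bounded_linear.tendsto[OF bounded_linear_star z] LIMSEQ_unique z by auto
  qed
  have comm: "c * z = z * c" if c: "c * b = b * c" for c
  proof -
    have "c * y n = y n * c" for n
    proof (induction n)
      case (Suc n)
      have "c * (y n * y n) = y n * y n * c"
        using Suc by (metis mult.assoc)
      then show ?case by (simp add: yS c algebra_simps)
    qed (simp add: y0)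
    moreover have "(\<lambda>n. c * y n) \<longlonglongrightarrow> c * z" "(\<lambda>n. y n * c) \<longlonglongrightarrow> z * c"
      by (intro tendsto_intros z)+
    ultimately show ?thesis using LIMSEQ_unique by auto
  qed
  have nz: "norm z \<le> 1"
    by (rule LIMSEQ_le_const2[OF tendsto_norm[OF z]])
      (use y_bd s_bd in \<open>auto intro: order_trans\<close>)
  have "2 *\<^sub>R z = b + z * z" using arg_cong[OF zeq, of "\<lambda>w. 2 *\<^sub>R w"] by simp
  then have "(1 - z) * (1 - z) = 1 - b"
    by (simp add: algebra_simps scaleR_2)
  moreover have "star (1 - z) = 1 - z" "norm (1 - (1 - z)) \<le> 1"
    using nz sz by (simp_all add: star_diff)
  moreover have "c * (1 - z) = (1 - z) * c" if "c * b = b * c" for c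
    using comm[OF that] by (simp add: right_diff_distrib left_diff_distrib)
  ultimately show thesis using that by blast
qed

text \<open>
  For self-adjoint \<open>a\<close> the norm bound says that the spectrum lies in \<open>[0, 2t]\<close>, so this is the usual
  positivity. In this form sums of positive elements are positive by the triangle inequality.
\<close>

definition pos_elem :: "'a::cstar_algebra \<Rightarrow> bool"
  where "pos_elem a \<longleftrightarrow> star a = a \<and> (\<exists>t\<ge>0. norm (t *\<^sub>R 1 - a) \<le> t)"

lemma pos_elem_add: "pos_elem a \<Longrightarrow> pos_elem b \<Longrightarrow> pos_elem (a + b)"
proof -
  assume "pos_elem a" "pos_elem b"
  then obtain t s where *: "star a = a" "star b = b" "t \<ge> 0" "s \<ge> 0"
    "norm (t *\<^sub>R 1 - a) \<le> t" "norm (s *\<^sub>R 1 - b) \<le> s"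
    unfolding pos_elem_def by blast
  have "norm ((t + s) *\<^sub>R 1 - (a + b)) \<le> t + s"
    using norm_triangle_ineq[of "t *\<^sub>R 1 - a" "s *\<^sub>R 1 - b"] * by (simp add: algebra_simps)
  then show ?thesis unfolding pos_elem_def using * by (auto simp: star_add intro!: exI[of _ "t + s"])
qed

lemma pos_elem_scaleR: "pos_elem a \<Longrightarrow> r \<ge> 0 \<Longrightarrow> pos_elem (r *\<^sub>R a)"
proof -
  assume "pos_elem a" and r: "r \<ge> 0"
  then obtain t where *: "star a = a" "t \<ge> 0" "norm (t *\<^sub>R 1 - a) \<le> t"
    unfolding pos_elem_def by blast
  have "norm ((r * t) *\<^sub>R 1 - r *\<^sub>R a) = r * norm (t *\<^sub>R 1 - a)"
    using r by (metis abs_of_nonneg norm_scaleR scaleR_right_diff_distrib scaleR_scaleR)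
  then have "norm ((r * t) *\<^sub>R 1 - r *\<^sub>R a) \<le> r * t"
    using * r by (simp add: mult_left_mono)
  then show ?thesis unfolding pos_elem_def using * r
    by (auto simp: star_scaleR intro!: exI[of _ "r * t"])
qed

lemma pos_elem_zero: "pos_elem 0"
  unfolding pos_elem_def by (auto intro!: exI[of _ 0])

lemma pos_elem_sum: "(\<And>i. i \<in> I \<Longrightarrow> pos_elem (f i)) \<Longrightarrow> pos_elem (\<Sum>i\<in>I. f i)"
  by (induction I rule: infinite_finite_induct) (auto simp: pos_elem_zero intro: pos_elem_add)

lemma unit_elem_scaleR: "unit_elem (a::'a::cstar_algebra) \<Longrightarrow> r \<noteq> 0 \<Longrightarrow> unit_elem (r *\<^sub>R a)"
  unfolding unit_elem_def by (metis mult_scaleR_left mult_scaleR_right right_inverse scaleR_scaleR scaleR_one)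

text \<open>
  \<open>a + e\<close> differs from the scalar \<open>t + e\<close> by an element of norm at most \<open>t\<close>, so its inverse is a Neumann
  series.
\<close>

lemma pos_elem_shift_unit:
  assumes "pos_elem a" "e > 0"
  shows "unit_elem (a + e *\<^sub>R 1)"
proof -
  obtain t where t: "t \<ge> 0" "norm (t *\<^sub>R 1 - a) \<le> t"
    using assms unfolding pos_elem_def by blast
  let ?x = "(1 / (t + e)) *\<^sub>R (t *\<^sub>R 1 - a)"
  have "norm ?x < 1" using t assms by (simp add: divide_simps)
  then have "unit_elem ((t + e) *\<^sub>R (1 - ?x))"
    using t assms by (intro unit_elem_scaleR Neumann_series) auto
  also have "(t + e) *\<^sub>R (1 - ?x) = (t + e) *\<^sub>R 1 - (t *\<^sub>R 1 - a)"
    using t assms by (simp add: scaleR_right_diff_distrib)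
  also have "\<dots> = a + e *\<^sub>R 1"
    by (simp add: scaleR_add_left)
  finally show ?thesis .
qed

text \<open>
  A rescaled \<open>sqrt_one_minus\<close>. Commuting with the commutant of \<open>a\<close> is what lets several roots be
  multiplied as if in a commutative algebra.
\<close>

lemma pos_elem_sqrt:
  assumes "pos_elem a"
  obtains k where "pos_elem k" "k * k = a" "\<And>c. c * a = a * c \<Longrightarrow> c * k = k * c"
proof -
  obtain t where t: "star a = a" "t \<ge> 0" "norm (t *\<^sub>R 1 - a) \<le> t"
    using assms unfolding pos_elem_def by blast
  show thesis
  proof (cases "t = 0")
    case True
    then show thesis using that[of 0] t by (simp add: pos_elem_zero)
  next
    case False
    let ?b = "1 - (1/t) *\<^sub>R a"
    have "?b = (1/t) *\<^sub>R (t *\<^sub>R 1 - a)" using False by (simp add: algebra_simps)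
    then have "norm ?b \<le> 1" using t False by (simp add: divide_simps)
    moreover have "star ?b = ?b" by (simp add: star_diff star_scaleR t)
    ultimately obtain k where k: "star k = k" "norm (1 - k) \<le> 1" "k * k = 1 - ?b"
      and c: "\<And>c. c * ?b = ?b * c \<Longrightarrow> c * k = k * c"
      using sqrt_one_minus by blast
    have "pos_elem k" unfolding pos_elem_def using k by (auto intro!: exI[of _ 1])
    then have "pos_elem (sqrt t *\<^sub>R k)" using t by (intro pos_elem_scaleR) auto
    moreover have "(sqrt t *\<^sub>R k) * (sqrt t *\<^sub>R k) = a"
      using t k False by simp
    moreover have "c' * (sqrt t *\<^sub>R k) = (sqrt t *\<^sub>R k) * c'" if "c' * a = a * c'" for c'
      using c[of c'] that by (simp add: algebra_simps)
    ultimately show thesis using that by blast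
  qed
qed

lemma pos_elem_selfadjoint: "pos_elem a \<Longrightarrow> star a = a"
  unfolding pos_elem_def by blast

text \<open>\<open>k + i l\<close> is \<open>sqrt s\<close> times a unitary, and \<open>k\<close> is its real part.\<close>

lemma norm_le_of_commuting_squares:
  fixes k l :: "'a::cstar_algebra"
  assumes "star k = k" "star l = l" "k * l = l * k" "k * k + l * l = s *\<^sub>R 1" "s \<ge> 0"
  shows "norm k \<le> sqrt s"
proof -
  let ?w = "k + \<i> *\<^sub>C l"
  have sw: "star ?w = k - \<i> *\<^sub>C l"
    using assms by (simp add: star_add star_scaleC)
  have "star ?w * ?w = s *\<^sub>R 1"
    unfolding sw using assms
    by (simp add: algebra_simps mult_scaleC_left mult_scaleC_right scaleC_scaleC)
  then have "(norm ?w)\<^sup>2 \<le> s"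
    using cstar_identity[of ?w] mult_left_mono[OF norm_one_le[where 'a='a] assms(5)] assms(5) by simp
  then have nw: "norm ?w \<le> sqrt s" by (simp add: real_le_rsqrt)
  have "2 *\<^sub>R k = ?w + star ?w" unfolding sw by (simp add: scaleR_2)
  then have "2 * norm k \<le> norm ?w + norm (star ?w)"
    by (metis norm_scaleR norm_triangle_ineq abs_numeral)
  then show ?thesis using nw by (simp add: norm_star)
qed


text \<open>
  Scale \<open>k\<close> to \<open>h\<close> of norm at most \<open>1\<close> and let \<open>l\<close> be the root of \<open>1 - h\<^sup>2\<close>. Since \<open>h\<^sup>2 + l\<^sup>2 = 1\<close>, the norm
  of \<open>1 - h\<^sup>2 = l\<^sup>2\<close> is at most \<open>1\<close>, which is the bound in the definition of positivity.
\<close>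

lemma pos_elem_square:
  assumes "star k = k"
  shows "pos_elem (k * k)"
proof (cases "norm k = 0")
  case False
  let ?r = "norm k"
  let ?h = "(1 / ?r) *\<^sub>R k"
  have sh: "star ?h = ?h" by (simp add: star_scaleR assms)
  have nh: "norm (?h * ?h) \<le> 1"
    using norm_mult_ineq[of ?h ?h] False by simp
  have "star (?h * ?h) = ?h * ?h" by (simp only: star_mult sh)
  from sqrt_one_minus[OF this nh] obtain l where l: "star l = l" "l * l = 1 - ?h * ?h"
    and c: "\<And>c. c * (?h * ?h) = ?h * ?h * c \<Longrightarrow> c * l = l * c"
    by metis
  have "l * ?h = ?h * l" using c[of ?h] by (simp only: mult.assoc)
  then have "norm l \<le> sqrt 1"
    using l sh by (intro norm_le_of_commuting_squares[of l ?h]) simp_all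
  then have "norm (l * l) \<le> 1"
    using norm_square_selfadjoint[OF l(1)] by (simp add: power_le_one)
  then have "pos_elem (?h * ?h)"
    unfolding pos_elem_def l(2) star_mult sh by (auto intro!: exI[of _ 1])
  then have "pos_elem ((?r * ?r) *\<^sub>R (?h * ?h))" by (intro pos_elem_scaleR) auto
  then show ?thesis using False by simp
qed (simp add: pos_elem_zero)

text \<open>The roots of \<open>b\<close> and \<open>s - b\<close> commute, and their squares add up to \<open>s\<close>.\<close>

lemma norm_le_of_pos_diff:
  assumes "pos_elem b" "pos_elem (s *\<^sub>R 1 - b)" "s \<ge> 0"
  shows "norm b \<le> s"
proof -
  obtain k where k: "pos_elem k" "k * k = b" "\<And>c. c * b = b * c \<Longrightarrow> c * k = k * c"
    using pos_elem_sqrt[OF assms(1)] by metis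
  obtain l where l: "pos_elem l" "l * l = s *\<^sub>R 1 - b"
    "\<And>c. c * (s *\<^sub>R 1 - b) = (s *\<^sub>R 1 - b) * c \<Longrightarrow> c * l = l * c"
    using pos_elem_sqrt[OF assms(2)] by metis
  have "k * b = b * k" using k(2) by (metis mult.assoc)
  then have "k * l = l * k" by (intro l(3)) (simp add: algebra_simps)
  then have "norm k \<le> sqrt s"
    using k(1,2) l(1,2) assms(3)
    by (intro norm_le_of_commuting_squares[of k l]) (auto simp: pos_elem_selfadjoint)
  then have "(norm k)\<^sup>2 \<le> (sqrt s)\<^sup>2" by (intro power_mono) auto
  then show ?thesis
    using norm_square_selfadjoint[OF pos_elem_selfadjoint[OF k(1)]] k(2) assms(3) by simp
qed

text \<open>
  The norm \<open>m\<close> of a nonzero positive element \<open>b\<close> lies in its spectrum: if \<open>m - b\<close> had an inverse \<open>g\<close>, then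
  \<open>g\<close> would be positive and bounded by a scalar \<open>G\<close>, so \<open>m - b - 1/G = (G (m - b) - 1) / G\<close> would be
  positive and the norm of \<open>b\<close> at most \<open>m - 1/G\<close>.
\<close>

lemma pos_elem_eq_0_if_shifts_unit:
  assumes b: "pos_elem b" and inv: "\<And>t. t > 0 \<Longrightarrow> unit_elem (t *\<^sub>R 1 - b)"
  shows "b = (0::'a::cstar_algebra)"
proof (rule ccontr)
  assume "b \<noteq> 0"
  define m where "m = norm b"
  have m: "m > 0" using \<open>b \<noteq> 0\<close> by (simp add: m_def)
  have posd: "pos_elem (r *\<^sub>R 1 - a)" if "pos_elem a" "norm a \<le> r" "r > 0" for a :: 'a and r
  proof -
    have "star ((1/r) *\<^sub>R a) = (1/r) *\<^sub>R a" using that by (simp add: star_scaleR pos_elem_selfadjoint)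
    moreover have "norm ((1/r) *\<^sub>R a) \<le> 1" using that by simp
    ultimately obtain k where "star k = k" "k * k = 1 - (1/r) *\<^sub>R a"
      using sqrt_one_minus by metis
    then have "pos_elem (1 - (1/r) *\<^sub>R a)" using pos_elem_square by metis
    then have "pos_elem (r *\<^sub>R (1 - (1/r) *\<^sub>R a))" using that by (intro pos_elem_scaleR) auto
    then show ?thesis using that by (simp add: scaleR_right_diff_distrib)
  qed
  let ?a = "m *\<^sub>R 1 - b"
  have "pos_elem ?a" using posd[OF b _ m] by (simp add: m_def)
  from pos_elem_sqrt[OF this] obtain l where l: "pos_elem l" "l * l = ?a" by metis
  obtain g where g: "?a * g = 1" "g * ?a = 1"
    using inv[OF m] unfolding unit_elem_def by blast
  have sa: "star ?a = ?a" using b by (simp add: star_diff star_scaleR pos_elem_selfadjoint)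
  have sg: "star g = g"
    by (metis g sa star_mult star_one mult.assoc mult_1_left mult_1_right)
  have lg: "l * g = g * l"
    by (metis g l(2) mult.assoc mult_1_left mult_1_right)
  define n where "n = l * g"
  have sn: "star n = n" unfolding n_def using lg sg l(1) by (simp add: star_mult pos_elem_selfadjoint)
  have nn: "n * n = g"
    unfolding n_def by (metis g lg l(2) mult.assoc mult_1_left)
  \<comment> \<open>The maximum ensures \<open>m - 1/G \<ge> 0\<close>, as the comparison of norms requires.\<close>
  define G where "G = max (norm g) (1 / m)"
  have G: "G > 0" "norm g \<le> G" "1 / m \<le> G" using m by (auto simp: G_def less_max_iff_disj)
  have "pos_elem (G *\<^sub>R 1 - g)"
    using posd[OF _ G(2,1)] pos_elem_square[OF sn] nn by simp
  then obtain h where h: "pos_elem h" "h * h = G *\<^sub>R 1 - g"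
    and hc: "\<And>c. c * (G *\<^sub>R 1 - g) = (G *\<^sub>R 1 - g) * c \<Longrightarrow> c * h = h * c"
    using pos_elem_sqrt by metis
  have hl: "l * h = h * l" by (rule hc) (simp add: algebra_simps lg)
  have "star (h * l) = h * l"
    using hl h l by (simp add: star_mult pos_elem_selfadjoint)
  then have "pos_elem ((h * l) * (h * l))" by (rule pos_elem_square)
  also have "(h * l) * (h * l) = (h * h) * (l * l)" by (metis hl mult.assoc)
  also have "\<dots> = G *\<^sub>R ?a - 1" unfolding h l using g by (simp add: left_diff_distrib)
  finally have "pos_elem ((1 / G) *\<^sub>R (G *\<^sub>R ?a - 1))" using G by (intro pos_elem_scaleR) auto
  also have "(1 / G) *\<^sub>R (G *\<^sub>R ?a - 1) = (m - 1 / G) *\<^sub>R 1 - b"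
    using G by (simp add: algebra_simps)
  finally have "norm b \<le> m - 1 / G"
    using G m by (intro norm_le_of_pos_diff b) (auto simp: field_simps)
  then show False using G by (simp add: m_def)
qed

text \<open>
  Kaplansky's theorem. Let \<open>a = z\<^sup>* z\<close>, let \<open>m\<close> be the positive root of \<open>a\<^sup>2\<close>, and let \<open>n = m - a\<close>, twice
  the negative part of \<open>a\<close>. From \<open>n (m + a) = 0\<close> the element \<open>w = z n\<close> satisfies \<open>w\<^sup>* w = n a n = - b\<close>
  with \<open>b = n\<^sup>2 m\<close> positive. As \<open>w w\<^sup>* + w\<^sup>* w\<close> is a sum of squares, \<open>w w\<^sup>*\<close> is positive too. But \<open>w w\<^sup>*\<close>
  and \<open>w\<^sup>* w\<close> have the same nonzero spectrum, so \<open>b\<close> has no spectrum outside \<open>0\<close>. Hence \<open>b = 0\<close> and \<open>w = 0\<close>,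
  and \<open>z\<^sup>* w = a n = 0\<close> gives \<open>n\<^sup>2 = 0\<close>, that is, \<open>a = m\<close>.
\<close>

lemma pos_elem_star_mult: "pos_elem (star z * (z::'a::cstar_algebra))"
proof -
  define a where "a = star z * z"
  have sa: "star a = a" by (simp add: a_def star_mult star_star)
  obtain m where m: "pos_elem m" "m * m = a * a" and mc: "\<And>c. c * (a * a) = a * a * c \<Longrightarrow> c * m = m * c"
    using pos_elem_sqrt[OF pos_elem_square[OF sa]] by metis
  have am: "a * m = m * a" by (rule mc) (simp add: mult.assoc)
  obtain r where r: "pos_elem r" "r * r = m" and rc: "\<And>c. c * m = m * c \<Longrightarrow> c * r = r * c"
    using pos_elem_sqrt[OF m(1)] by metis
  define n where "n = m - a"
  have sn: "star n = n" using m by (simp add: n_def star_diff sa pos_elem_selfadjoint)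
  have nm: "n * m = m * n" by (simp add: n_def algebra_simps am)
  have nr: "n * r = r * n" by (rule rc) (rule nm)
  have "n * (m + a) = 0" by (simp add: n_def algebra_simps am m)
  then have na: "n * a = - (n * m)" by (simp add: distrib_left eq_neg_iff_add_eq_0 add.commute)
  define b where "b = (n * r) * (n * r)"
  have snr: "star (n * r) = n * r" using nr sn r by (simp add: star_mult pos_elem_selfadjoint)
  then have pb: "pos_elem b" unfolding b_def by (rule pos_elem_square)
  define w where "w = z * n"
  have "star w * w = n * a * n" by (simp add: w_def star_mult sn a_def mult.assoc)
  also have "\<dots> = - b" unfolding na b_def by (metis nr nm r(2) mult.assoc minus_mult_left)
  finally have ww: "star w * w = - b" .
  define x y where "x = (1/2) *\<^sub>R (w + star w)" and "y = (1/2) *\<^sub>R (\<i> *\<^sub>C (star w - w))"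
  have sx: "star x = x" by (simp add: x_def star_scaleR star_add star_star add.commute)
  have sy: "star y = y"
    by (simp add: y_def star_scaleR star_scaleC star_diff star_star complex_vec.scale_right_diff_distrib)
  have "w * star w + star w * w = 2 *\<^sub>R (x * x + y * y)"
    by (simp add: x_def y_def algebra_simps scaleR_scaleC scaleC_scaleC mult_scaleC_left mult_scaleC_right
        complex_vec.scale_right_diff_distrib complex_vec.scale_left_diff_distrib scaleC_add_right flip: scaleC_add_left)
  then have "w * star w = 2 *\<^sub>R (x * x + y * y) + b" by (simp add: ww algebra_simps)
  then have pw: "pos_elem (w * star w)"
    by (auto intro!: pos_elem_add pos_elem_scaleR pos_elem_square sx sy pb)
  have "b = 0"
  proof (rule pos_elem_eq_0_if_shifts_unit[OF pb])
    fix t :: real assume t: "t > 0"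
    obtain g where g: "(w * star w + t *\<^sub>R 1) * g = 1" "g * (w * star w + t *\<^sub>R 1) = 1"
      using pos_elem_shift_unit[OF pw t] unfolding unit_elem_def by blast
    \<comment> \<open>\<open>t + w\<^sup>* w\<close> is inverted by \<open>(1 - w\<^sup>* g w) / t\<close> when \<open>g\<close> inverts \<open>t + w w\<^sup>*\<close>.\<close>
    let ?u = "star w * w + t *\<^sub>R 1" and ?v = "(1/t) *\<^sub>R (1 - star w * g * w)"
    have u1: "?u * star w = star w * (w * star w + t *\<^sub>R 1)" by (simp add: algebra_simps)
    have u2: "w * ?u = (w * star w + t *\<^sub>R 1) * w" by (simp add: algebra_simps)
    have "?u * (star w * g * w) = star w * w"
      using arg_cong[OF u1, of "\<lambda>h. h * (g * w)"] arg_cong[OF g(1), of "\<lambda>h. star w * h * w"]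
      by (simp only: mult.assoc mult_1_left)
    then have "?u * (1 - star w * g * w) = t *\<^sub>R 1" by (simp add: algebra_simps)
    then have 1: "?u * ?v = 1" using t by simp
    have "(star w * g * w) * ?u = star w * w"
      using arg_cong[OF u2, of "\<lambda>h. star w * (g * h)"] arg_cong[OF g(2), of "\<lambda>h. star w * (h * w)"]
      by (simp only: mult.assoc mult_1_left)
    then have "(1 - star w * g * w) * ?u = t *\<^sub>R 1" by (simp add: algebra_simps)
    then have 2: "?v * ?u = 1" using t by simp
    have "?u = t *\<^sub>R 1 - b" by (simp add: ww)
    then show "unit_elem (t *\<^sub>R 1 - b)" using 1 2 unfolding unit_elem_def by metis
  qed
  then have "w = 0" using ww star_mult_self_eq_0 by simp
  then have an: "a * n = 0" by (simp add: a_def w_def mult.assoc)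
  have "n * n = 0"
  proof -
    have "m * n = - (a * n)" using am m by (simp add: n_def right_diff_distrib)
    then have "m * n - a * n = 0" using an by simp
    then show ?thesis by (simp add: n_def left_diff_distrib)
  qed
  then have "n = 0" using star_mult_self_eq_0[of n] sn by simp
  then show ?thesis using m(1) by (simp add: n_def a_def)
qed

lemma unit_elem_one_plus_sum:
  "unit_elem (1 + (\<Sum>i\<in>I. z i * star (z i :: 'a::cstar_algebra)))"
proof -
  have "pos_elem (\<Sum>i\<in>I. z i * star (z i))"
    by (intro pos_elem_sum) (metis pos_elem_star_mult star_star)
  from pos_elem_shift_unit[OF this, of 1] show ?thesis by (simp add: add.commute)
qed

section \<open>Star-algebras on a carrier\<close>

text \<open>
  The basic constructions are algebras on a carrier set with operations of their own, so the laws
  of a \<open>*\<close>-algebra are collected relative to that carrier.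
\<close>

locale star_algebra =
  fixes C :: "'c::complex_vec star_alg"
  assumes subspace_carrier: "csubspace (acarrier C)"
    and mul_closed: "\<lbrakk>x \<in> acarrier C; y \<in> acarrier C\<rbrakk> \<Longrightarrow> amul C x y \<in> acarrier C"
    and astar_closed: "x \<in> acarrier C \<Longrightarrow> astar C x \<in> acarrier C"
    and one_closed: "aone C \<in> acarrier C"
    and mul_add_left: "\<lbrakk>x \<in> acarrier C; y \<in> acarrier C; z \<in> acarrier C\<rbrakk>
      \<Longrightarrow> amul C (x + y) z = amul C x z + amul C y z"
    and mul_add_right: "\<lbrakk>x \<in> acarrier C; y \<in> acarrier C; z \<in> acarrier C\<rbrakk>
      \<Longrightarrow> amul C z (x + y) = amul C z x + amul C z y"
    and mul_scale_left: "\<lbrakk>x \<in> acarrier C; y \<in> acarrier C\<rbrakk> \<Longrightarrow> amul C (r *\<^sub>C x) y = r *\<^sub>C amul C x y"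
    and mul_scale_right: "\<lbrakk>x \<in> acarrier C; y \<in> acarrier C\<rbrakk> \<Longrightarrow> amul C x (r *\<^sub>C y) = r *\<^sub>C amul C x y"
    and mul_assoc: "\<lbrakk>x \<in> acarrier C; y \<in> acarrier C; z \<in> acarrier C\<rbrakk>
      \<Longrightarrow> amul C (amul C x y) z = amul C x (amul C y z)"
    and one_left: "x \<in> acarrier C \<Longrightarrow> amul C (aone C) x = x"
    and one_right: "x \<in> acarrier C \<Longrightarrow> amul C x (aone C) = x"
    and astar_add: "\<lbrakk>x \<in> acarrier C; y \<in> acarrier C\<rbrakk> \<Longrightarrow> astar C (x + y) = astar C x + astar C y"
    and astar_scale: "x \<in> acarrier C \<Longrightarrow> astar C (r *\<^sub>C x) = cnj r *\<^sub>C astar C x"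
    and astar_mul: "\<lbrakk>x \<in> acarrier C; y \<in> acarrier C\<rbrakk>
      \<Longrightarrow> astar C (amul C x y) = amul C (astar C y) (astar C x)"
    and astar_astar: "x \<in> acarrier C \<Longrightarrow> astar C (astar C x) = x"
begin

lemma zero_closed: "0 \<in> acarrier C"
  and add_closed: "\<lbrakk>x \<in> acarrier C; y \<in> acarrier C\<rbrakk> \<Longrightarrow> x + y \<in> acarrier C"
  and scale_closed: "x \<in> acarrier C \<Longrightarrow> r *\<^sub>C x \<in> acarrier C"
  using subspace_carrier
  by (simp_all add: complex_vec.subspace_0 complex_vec.subspace_add complex_vec.subspace_scale)

lemma sum_closed: "(\<And>i. i < n \<Longrightarrow> f i \<in> acarrier C) \<Longrightarrow> (\<Sum>i<n. f i) \<in> acarrier C"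
  for n :: nat
  by (rule complex_vec.subspace_sum[OF subspace_carrier]) simp

lemma mul_zero_left: "x \<in> acarrier C \<Longrightarrow> amul C 0 x = 0"
  using mul_add_left[of 0 0 x] zero_closed by simp

lemma mul_zero_right: "x \<in> acarrier C \<Longrightarrow> amul C x 0 = 0"
  using mul_add_right[of 0 0 x] zero_closed by simp

lemma astar_zero: "astar C 0 = 0"
  using astar_add[of 0 0] zero_closed by simp

lemma mul_sum_left:
  "(\<And>i. i < n \<Longrightarrow> f i \<in> acarrier C) \<Longrightarrow> x \<in> acarrier C \<Longrightarrow>
    amul C (\<Sum>i<n. f i) x = (\<Sum>i<n. amul C (f i) x)"
  for n :: nat
  by (induction n) (simp_all add: mul_zero_left mul_add_left sum_closed)

lemma mul_sum_right:
  "(\<And>i. i < n \<Longrightarrow> f i \<in> acarrier C) \<Longrightarrow> x \<in> acarrier C \<Longrightarrow>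
    amul C x (\<Sum>i<n. f i) = (\<Sum>i<n. amul C x (f i))"
  for n :: nat
  by (induction n) (simp_all add: mul_zero_right mul_add_right sum_closed)

lemma astar_sum:
  "(\<And>i. i < n \<Longrightarrow> f i \<in> acarrier C) \<Longrightarrow> astar C (\<Sum>i<n. f i) = (\<Sum>i<n. astar C (f i))"
  for n :: nat
  by (induction n) (simp_all add: astar_zero astar_add sum_closed)

lemma astar_one: "astar C (aone C) = aone C"
  by (metis astar_astar astar_closed astar_mul one_closed one_left one_right)

end

lemma star_algebra_type_alg: "star_algebra (type_alg :: 'c::cstar_algebra star_alg)"
  by unfold_locales
    (simp_all add: type_alg_def algebra_simps mult_scaleC_left mult_scaleC_right Defs.star_add
      star_scaleC star_mult star_star)

section \<open>Frames\<close>

lemma mat_carrierD: "M \<in> mat_carrier k U \<Longrightarrow> i < k \<Longrightarrow> j < k \<Longrightarrow> M i j \<in> U"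
  by (simp add: mat_carrier_def)

text \<open>
  \<open>C\<close> is a right module over \<open>K\<close>, embedded by \<open>\<iota>\<close>, with the \<open>K\<close>-valued inner product \<open>\<eta> (x\<^sup>* y)\<close>, and the
  last assumption makes the elements \<open>u i\<close> a frame. There are two instances: \<open>A\<close> inside \<open>C\<close> with \<open>\<rho> = 1\<close>,
  and \<open>C\<close> inside \<open>C\<^sub>1\<close> with \<open>\<rho>\<close> the inverse of the index of \<open>E\<^sup>A\<close> and \<open>\<sigma>\<close> that index.
\<close>

locale frame = star_algebra C for C :: "'c::complex_vec star_alg" +
  fixes K :: "'a::cstar_algebra set" and \<iota> :: "'a \<Rightarrow> 'c" and \<eta> :: "'c \<Rightarrow> 'a"
    and \<rho> \<sigma> :: 'a and k :: nat and u :: "nat \<Rightarrow> 'c"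
  assumes subspace_K: "csubspace K" and one_K: "1 \<in> K"
    and mult_K: "\<lbrakk>a \<in> K; b \<in> K\<rbrakk> \<Longrightarrow> a * b \<in> K" and star_K: "a \<in> K \<Longrightarrow> star a \<in> K"
    and \<iota>_linear: "clinear \<iota>" and \<iota>_closed: "a \<in> K \<Longrightarrow> \<iota> a \<in> acarrier C"
    and \<iota>_one: "\<iota> 1 = aone C"
    and \<iota>_mult: "\<lbrakk>a \<in> K; b \<in> K\<rbrakk> \<Longrightarrow> \<iota> (a * b) = amul C (\<iota> a) (\<iota> b)"
    and \<iota>_star: "a \<in> K \<Longrightarrow> \<iota> (star a) = astar C (\<iota> a)"
    and \<eta>_linear: "clinear \<eta>" and \<eta>_closed: "x \<in> acarrier C \<Longrightarrow> \<eta> x \<in> K"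
    and \<eta>_\<iota>: "a \<in> K \<Longrightarrow> \<eta> (\<iota> a) = a"
    and \<eta>_right: "\<lbrakk>x \<in> acarrier C; a \<in> K\<rbrakk> \<Longrightarrow> \<eta> (amul C x (\<iota> a)) = \<eta> x * a"
    and \<eta>_astar: "x \<in> acarrier C \<Longrightarrow> \<eta> (astar C x) = star (\<eta> x)"
    and \<rho>_closed: "\<rho> \<in> K" and \<sigma>_closed: "\<sigma> \<in> K" and \<rho>_\<sigma>: "\<rho> * \<sigma> = 1"
    and \<rho>_central: "a \<in> K \<Longrightarrow> a * \<rho> = \<rho> * a" and star_\<rho>: "star \<rho> = \<rho>"
    and u_closed: "i < k \<Longrightarrow> u i \<in> acarrier C"
    and expansion: "x \<in> acarrier C \<Longrightarrow>
      (\<Sum>i<k. amul C (u i) (\<iota> (\<sigma> * \<eta> (amul C (astar C (u i)) x)))) = x"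
begin

abbreviation basic :: "('c \<Rightarrow> 'c) star_alg"
  where "basic \<equiv> basic_construction C (\<iota> \<circ> \<eta>)"

abbreviation jones :: "'c \<Rightarrow> 'c \<Rightarrow> 'c \<Rightarrow> 'c"
  where "jones \<equiv> jones_elem C (\<iota> \<circ> \<eta>)"

abbreviation matK :: "(nat \<Rightarrow> nat \<Rightarrow> 'a) star_alg"
  where "matK \<equiv> mat_alg k (type_alg\<lparr>acarrier := K\<rparr>)"

definition coord :: "nat \<Rightarrow> 'c \<Rightarrow> 'a"
  where "coord i x = \<sigma> * \<eta> (amul C (astar C (u i)) x)"

definition to_matrix :: "('c \<Rightarrow> 'c) \<Rightarrow> nat \<Rightarrow> nat \<Rightarrow> 'a"
  where "to_matrix T = (\<lambda>i j. if i < k \<and> j < k then coord i (T (u j)) else 0)"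

text \<open>The matrix of the identity operator, with the entries \<open>\<sigma> \<eta> (u\<^sub>i\<^sup>* u\<^sub>j)\<close>.\<close>

definition gram :: "nat \<Rightarrow> nat \<Rightarrow> 'a"
  where "gram = to_matrix id"

lemmas K_rules = one_K mult_K star_K complex_vec.subspace_0[OF subspace_K]
  complex_vec.subspace_add[OF subspace_K] complex_vec.subspace_scale[OF subspace_K]

lemma sum_K: "(\<And>i. i < n \<Longrightarrow> f i \<in> K) \<Longrightarrow> (\<Sum>i<n. f i) \<in> K"
  for n :: nat
  using subspace_K by (auto intro: complex_vec.subspace_sum)

lemmas \<iota>_simps = clinear_add[OF \<iota>_linear] clinear_scale[OF \<iota>_linear]
  clinear_zero[OF \<iota>_linear] clinear_sum[OF \<iota>_linear]

lemmas \<eta>_simps = clinear_add[OF \<eta>_linear] clinear_scale[OF \<eta>_linear]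
  clinear_zero[OF \<eta>_linear] clinear_sum[OF \<eta>_linear]

lemma \<sigma>_\<rho>: "\<sigma> * \<rho> = 1"
  using \<rho>_central[OF \<sigma>_closed] \<rho>_\<sigma> by simp

lemma \<sigma>_central: "a \<in> K \<Longrightarrow> a * \<sigma> = \<sigma> * a"
proof -
  assume a: "a \<in> K"
  have "a * \<sigma> = \<sigma> * (\<rho> * a) * \<sigma>" using \<sigma>_\<rho> by (simp flip: mult.assoc)
  also have "\<dots> = \<sigma> * a * (\<rho> * \<sigma>)" by (simp only: \<rho>_central[OF a, symmetric] mult.assoc)
  finally show ?thesis by (simp add: \<rho>_\<sigma>)
qed

lemma star_\<sigma>: "star \<sigma> = \<sigma>"
  by (metis \<rho>_\<sigma> \<sigma>_\<rho> mult.assoc mult_1_left mult_1_right star_\<rho> star_mult star_one)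

lemma \<eta>_left: "x \<in> acarrier C \<Longrightarrow> a \<in> K \<Longrightarrow> \<eta> (amul C (\<iota> a) x) = a * \<eta> x"
  using \<eta>_astar[of "amul C (astar C x) (\<iota> (star a))"]
  by (simp add: \<iota>_closed astar_closed mul_closed star_K astar_mul \<iota>_star astar_astar \<eta>_right
      \<eta>_astar star_mult star_star flip: \<iota>_star)

lemma \<iota>_inj: "a \<in> K \<Longrightarrow> b \<in> K \<Longrightarrow> \<iota> a = \<iota> b \<Longrightarrow> a = b"
  by (metis \<eta>_\<iota>)

lemma coord_closed: "i < k \<Longrightarrow> x \<in> acarrier C \<Longrightarrow> coord i x \<in> K"
  by (simp add: coord_def mult_K \<sigma>_closed \<eta>_closed mul_closed astar_closed u_closed)

lemma coord_add: "i < k \<Longrightarrow> x \<in> acarrier C \<Longrightarrow> y \<in> acarrier C \<Longrightarrow> coord i (x + y) = coord i x + coord i y"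
  by (simp add: coord_def mul_add_right astar_closed u_closed \<eta>_simps distrib_left)

lemma coord_scale: "i < k \<Longrightarrow> x \<in> acarrier C \<Longrightarrow> coord i (r *\<^sub>C x) = r *\<^sub>C coord i x"
  by (simp add: coord_def mul_scale_right astar_closed u_closed \<eta>_simps mult_scaleC_right)

lemma coord_zero: "i < k \<Longrightarrow> coord i 0 = 0"
  by (simp add: coord_def mul_zero_right astar_closed u_closed \<eta>_simps)

lemma coord_sum:
  "i < k \<Longrightarrow> (\<And>l. l < n \<Longrightarrow> f l \<in> acarrier C) \<Longrightarrow> coord i (\<Sum>l<n. f l) = (\<Sum>l<n. coord i (f l))"
  for n :: nat
  by (induction n) (simp_all add: coord_zero coord_add sum_closed)

lemma coord_right:
  "i < k \<Longrightarrow> x \<in> acarrier C \<Longrightarrow> a \<in> K \<Longrightarrow> coord i (amul C x (\<iota> a)) = coord i x * a"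
  by (simp add: coord_def astar_closed u_closed mul_closed \<iota>_closed mult.assoc \<eta>_right flip: mul_assoc)

lemma sum_coord: "x \<in> acarrier C \<Longrightarrow> (\<Sum>i<k. amul C (u i) (\<iota> (coord i x))) = x"
  unfolding coord_def by (rule expansion)

lemma star_coord:
  assumes "i < k" "x \<in> acarrier C"
  shows "\<eta> (amul C (astar C x) (u i)) = \<rho> * star (coord i x)"
proof -
  have "\<eta> (amul C (astar C x) (u i)) = star (\<eta> (amul C (astar C (u i)) x))"
    using assms by (simp add: \<eta>_astar[symmetric] astar_mul astar_closed u_closed mul_closed astar_astar)
  also have "\<dots> = \<rho> * star (coord i x)"
    unfolding coord_def star_mult star_\<sigma>
    using assms \<sigma>_central \<rho>_\<sigma>
    by (metis \<eta>_closed astar_closed mul_closed mult.assoc mult_1_left star_K u_closed)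
  finally show ?thesis .
qed

text \<open>Expand \<open>y\<close> in the frame; the coordinates of \<open>x\<close> are, up to \<open>\<rho>\<close>, its inner products with the frame.\<close>

lemma inner_coord:
  assumes "x \<in> acarrier C" "y \<in> acarrier C"
  shows "\<eta> (amul C (astar C x) y) = \<rho> * (\<Sum>i<k. star (coord i x) * coord i y)"
proof -
  have "\<eta> (amul C (astar C x) y) = \<eta> (amul C (astar C x) (\<Sum>i<k. amul C (u i) (\<iota> (coord i y))))"
    using assms by (simp add: sum_coord)
  also have "\<dots> = (\<Sum>i<k. \<eta> (amul C (amul C (astar C x) (u i)) (\<iota> (coord i y))))"
    using assms
    by (simp add: mul_sum_right mul_closed u_closed \<iota>_closed coord_closed astar_closed mul_assoc \<eta>_simps)
  also have "\<dots> = (\<Sum>i<k. \<rho> * star (coord i x) * coord i y)"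
    using assms by (intro sum.cong) (simp_all add: \<eta>_right mul_closed astar_closed u_closed coord_closed star_coord)
  finally show ?thesis by (simp add: sum_distrib_left mult.assoc)
qed

text \<open>Pairing with the frame recovers the coordinates.\<close>

lemma eq_if_inner_eq:
  assumes "x \<in> acarrier C" "y \<in> acarrier C"
    and "\<And>z. z \<in> acarrier C \<Longrightarrow> \<eta> (amul C (astar C x) z) = \<eta> (amul C (astar C y) z)"
  shows "x = y"
proof -
  have "coord i x = coord i y" if "i < k" for i
  proof -
    have "\<rho> * star (coord i x) = \<rho> * star (coord i y)"
      using assms(3)[OF u_closed[OF that]] star_coord[OF that] assms by simp
    then have "\<sigma> * \<rho> * star (coord i x) = \<sigma> * \<rho> * star (coord i y)" by (simp only: mult.assoc)
    then show ?thesis by (metis \<sigma>_\<rho> mult_1_left star_star)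
  qed
  then show ?thesis using sum_coord assms(1,2) by (metis (mono_tags, lifting) lessThan_iff sum.cong)
qed

subsection \<open>The basic construction\<close>

lemma jones_elem_apply:
  "x \<in> acarrier C \<Longrightarrow> y \<in> acarrier C \<Longrightarrow>
    jones x y z = (if z \<in> acarrier C then amul C x (\<iota> (\<eta> (amul C y z))) else 0)"
  by (simp add: jones_elem_def left_mult_def jones_projection_def on_carrier_def mul_closed \<iota>_closed
      \<eta>_closed \<eta>_simps \<iota>_simps zero_closed mul_zero_right)

text \<open>
  The right \<open>K\<close>-linear operators, extended by \<open>0\<close> outside the carrier as the elements of the basic
  construction are.
\<close>

definition right_linear :: "('c \<Rightarrow> 'c) \<Rightarrow> bool"
  where "right_linear T \<longleftrightarrow> (\<forall>z. z \<notin> acarrier C \<longrightarrow> T z = 0) \<and> (\<forall>z\<in>acarrier C. T z \<in> acarrier C) \<and>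
    (\<forall>y\<in>acarrier C. \<forall>z\<in>acarrier C. T (y + z) = T y + T z) \<and>
    (\<forall>z\<in>acarrier C. \<forall>r. T (r *\<^sub>C z) = r *\<^sub>C T z) \<and>
    (\<forall>z\<in>acarrier C. \<forall>a\<in>K. T (amul C z (\<iota> a)) = amul C (T z) (\<iota> a))"

lemma right_linearD:
  assumes "right_linear T"
  shows "z \<notin> acarrier C \<Longrightarrow> T z = 0" "z \<in> acarrier C \<Longrightarrow> T z \<in> acarrier C"
    "y \<in> acarrier C \<Longrightarrow> z \<in> acarrier C \<Longrightarrow> T (y + z) = T y + T z"
    "z \<in> acarrier C \<Longrightarrow> T (r *\<^sub>C z) = r *\<^sub>C T z"
    "z \<in> acarrier C \<Longrightarrow> a \<in> K \<Longrightarrow> T (amul C z (\<iota> a)) = amul C (T z) (\<iota> a)"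
  using assms unfolding right_linear_def by blast+

lemma right_linear_zero_value: "right_linear T \<Longrightarrow> T 0 = 0"
  using right_linearD(3)[of T 0 0] zero_closed by simp

lemma right_linear_sum:
  "right_linear T \<Longrightarrow> (\<And>i. i < n \<Longrightarrow> f i \<in> acarrier C) \<Longrightarrow> T (\<Sum>i<n. f i) = (\<Sum>i<n. T (f i))"
  for n :: nat
  by (induction n)
    (simp_all add: right_linear_zero_value right_linearD(3) sum_closed)

lemma right_linear_expansion:
  assumes "right_linear T" "z \<in> acarrier C"
  shows "T z = (\<Sum>i<k. amul C (T (u i)) (\<iota> (coord i z)))"
proof -
  have "T z = T (\<Sum>i<k. amul C (u i) (\<iota> (coord i z)))" using assms by (simp add: sum_coord)
  also have "\<dots> = (\<Sum>i<k. amul C (T (u i)) (\<iota> (coord i z)))"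
    using assms by (simp add: right_linear_sum mul_closed u_closed \<iota>_closed coord_closed right_linearD(5))
  finally show ?thesis .
qed

lemma subspace_right_linear: "csubspace {T. right_linear T}"
  by (rule complex_vec.subspaceI)
    (auto simp: right_linear_def scaleC_fun_def zero_closed mul_zero_left \<iota>_closed add_closed
      mul_add_left algebra_simps scaleC_add_right scale_closed mul_scale_left scaleC_scaleC)

lemma right_linear_jones_elem:
  "x \<in> acarrier C \<Longrightarrow> y \<in> acarrier C \<Longrightarrow> right_linear (jones x y)"
proof -
  assume x: "x \<in> acarrier C" and y: "y \<in> acarrier C"
  have "amul C x (\<iota> (\<eta> (amul C y (amul C z (\<iota> a))))) = amul C (amul C x (\<iota> (\<eta> (amul C y z)))) (\<iota> a)"
    if z: "z \<in> acarrier C" and a: "a \<in> K" for z a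
  proof -
    have "\<eta> (amul C y (amul C z (\<iota> a))) = \<eta> (amul C y z) * a"
      using z a y \<eta>_right[of "amul C y z" a] by (simp add: mul_assoc mul_closed \<iota>_closed)
    then show ?thesis
      using x y z a by (simp add: \<iota>_mult \<eta>_closed mul_closed mul_assoc \<iota>_closed)
  qed
  then show ?thesis
    unfolding right_linear_def using x y
    by (simp add: jones_elem_apply add_closed scale_closed mul_closed \<iota>_closed \<eta>_closed mul_add_right
        mul_scale_right \<eta>_simps \<iota>_simps)
qed

text \<open>
  A right linear operator is determined by its values on the frame. As the coordinates are
  themselves inner products with the frame, this writes it as a sum of rank one operators; so the
  basic construction consists of all right linear operators.
\<close>

lemma jones_expansion:
  assumes "right_linear T"
  shows "T = (\<Sum>i<k. jones (amul C (T (u i)) (\<iota> \<sigma>)) (astar C (u i)))"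
proof
  fix z
  show "T z = (\<Sum>i<k. jones (amul C (T (u i)) (\<iota> \<sigma>)) (astar C (u i))) z"
  proof (cases "z \<in> acarrier C")
    case True
    show ?thesis
      unfolding right_linear_expansion[OF assms True] fun_sum_apply
      by (rule sum.cong) (use assms True in \<open>simp_all add: jones_elem_apply mul_closed right_linearD u_closed \<iota>_closed \<sigma>_closed
          astar_closed \<eta>_closed mul_assoc coord_def flip: \<iota>_mult\<close>)
  next
    case False
    then show ?thesis
      unfolding fun_sum_apply
      by (subst sum.neutral) (use assms in \<open>auto simp: jones_elem_apply mul_closed right_linearD u_closed \<iota>_closed \<sigma>_closed
          astar_closed\<close>)
  qed
qed

lemma basic_carrier_iff: "T \<in> acarrier basic \<longleftrightarrow> right_linear T"
proof
  assume "T \<in> acarrier basic"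
  then show "right_linear T"
    using complex_vec.span_minimal[OF _ subspace_right_linear] right_linear_jones_elem
    unfolding basic_construction_def basic_carrier_def by (smt (verit) mem_Collect_eq select_convs(1) star_alg.select_convs(1) subset_iff)
next
  assume T: "right_linear T"
  have "(\<Sum>i<k. jones (amul C (T (u i)) (\<iota> \<sigma>)) (astar C (u i))) \<in> basic_carrier C (\<iota> \<circ> \<eta>)"
    unfolding basic_carrier_def
    by (intro complex_vec.span_sum complex_vec.span_base)
      (use T in \<open>blast intro: mul_closed astar_closed \<iota>_closed \<sigma>_closed u_closed right_linearD\<close>)
  then show "T \<in> acarrier basic"
    using jones_expansion[OF T] by (simp add: basic_construction_def)
qed

lemma jones_elem_closed: "x \<in> acarrier C \<Longrightarrow> y \<in> acarrier C \<Longrightarrow> jones x y \<in> acarrier basic"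
  by (simp add: basic_carrier_iff right_linear_jones_elem)

lemma amul_basic: "amul basic = (\<circ>)" and aone_basic: "aone basic = on_carrier C id"
  by (simp_all add: basic_construction_def)

lemma acarrier_basic: "acarrier basic = cspan {jones x y | x y. x \<in> acarrier C \<and> y \<in> acarrier C}"
  by (simp add: basic_construction_def basic_carrier_def)

text \<open>The condition that determines \<open>astar basic\<close>, with the injective \<open>\<iota>\<close> stripped off.\<close>

definition adjoint_of :: "('c \<Rightarrow> 'c) \<Rightarrow> ('c \<Rightarrow> 'c) \<Rightarrow> bool"
  where "adjoint_of T S \<longleftrightarrow> S \<in> acarrier basic \<and> (\<forall>x\<in>acarrier C. \<forall>y\<in>acarrier C.
    \<eta> (amul C (astar C (S x)) y) = \<eta> (amul C (astar C x) (T y)))"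

lemma adjoint_of_unique:
  assumes "adjoint_of T S" "adjoint_of T S'"
  shows "S = S'"
proof
  fix z
  have rl: "right_linear S" "right_linear S'"
    using assms by (simp_all add: adjoint_of_def basic_carrier_iff)
  show "S z = S' z"
  proof (cases "z \<in> acarrier C")
    case True
    then show ?thesis
      using assms rl by (intro eq_if_inner_eq) (simp_all add: adjoint_of_def right_linearD)
  qed (use rl in \<open>simp add: right_linearD\<close>)
qed

lemma adjoint_of_add:
  assumes "adjoint_of T S" "adjoint_of T' S'" "right_linear T" "right_linear T'"
  shows "adjoint_of (T + T') (S + S')"
  using assms complex_vec.subspace_add[OF subspace_right_linear, of S S']
  by (auto simp: adjoint_of_def basic_carrier_iff right_linearD astar_add astar_closed mul_add_left
      mul_add_right \<eta>_simps)

lemma adjoint_of_scale: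
  assumes "adjoint_of T S" "right_linear T"
  shows "adjoint_of (r *\<^sub>C T) (cnj r *\<^sub>C S)"
  using assms complex_vec.subspace_scale[OF subspace_right_linear, of S]
  by (auto simp: adjoint_of_def basic_carrier_iff right_linearD astar_scale astar_closed mul_scale_left
      mul_scale_right \<eta>_simps scaleC_fun_def scale_closed)

lemma adjoint_of_jones_elem:
  assumes "x \<in> acarrier C" "y \<in> acarrier C"
  shows "adjoint_of (jones x y) (jones (astar C y) (astar C x))"
  unfolding adjoint_of_def
proof (intro conjI ballI)
  show "jones (astar C y) (astar C x) \<in> acarrier basic"
    using assms by (simp add: jones_elem_closed astar_closed)
  fix z w assume z: "z \<in> acarrier C" "w \<in> acarrier C"
  let ?a = "\<eta> (amul C (astar C x) z)"
  have a: "?a \<in> K" "star ?a = \<eta> (amul C (astar C z) x)"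
    using assms z by (simp_all add: \<eta>_closed mul_closed astar_closed \<eta>_astar[symmetric] astar_mul astar_astar)
  have "\<eta> (amul C (astar C (amul C (astar C y) (\<iota> ?a))) w) = star ?a * \<eta> (amul C y w)"
    using assms z a(1)
    by (simp add: astar_mul astar_closed \<iota>_closed astar_astar mul_closed mul_assoc \<eta>_left star_K flip: \<iota>_star)
  also have "\<dots> = \<eta> (amul C (astar C z) (amul C x (\<iota> (\<eta> (amul C y w)))))"
    unfolding a(2) using assms z
    by (simp add: \<eta>_right[symmetric] mul_closed astar_closed \<eta>_closed mul_assoc \<iota>_closed)
  finally show "\<eta> (amul C (astar C (jones (astar C y) (astar C x) z)) w) =
      \<eta> (amul C (astar C z) (jones x y w))"
    using assms z by (simp add: jones_elem_apply astar_closed)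
qed

lemma adjoint_of_exists:
  assumes "T \<in> acarrier basic"
  shows "\<exists>S. adjoint_of T S"
proof -
  have "T \<in> acarrier basic \<and> (\<exists>S. adjoint_of T S)"
    using assms unfolding acarrier_basic
  proof (induction rule: complex_vec.span_induct_alt)
    case base
    have "adjoint_of 0 0"
      using complex_vec.subspace_0[OF subspace_right_linear]
      by (auto simp: adjoint_of_def basic_carrier_iff mul_zero_left mul_zero_right astar_zero astar_closed)
    then show ?case using complex_vec.span_zero by blast
  next
    case (step r U V)
    then obtain x y S where U: "U = jones x y" "x \<in> acarrier C" "y \<in> acarrier C"
      and S: "adjoint_of V S"
      by blast
    have V: "right_linear V" using step(2) basic_carrier_iff[unfolded acarrier_basic] by blast
    have "adjoint_of (r *\<^sub>C U + V) (cnj r *\<^sub>C jones (astar C y) (astar C x) + S)"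
      unfolding U(1) using U S V
      by (intro adjoint_of_add adjoint_of_scale adjoint_of_jones_elem)
        (auto intro: right_linear_jones_elem complex_vec.subspace_scale[OF subspace_right_linear, simplified])
    then have "\<exists>S. adjoint_of (r *\<^sub>C U + V) S" unfolding U(1) by blast
    moreover have "r *\<^sub>C U + V \<in> cspan {jones x y | x y. x \<in> acarrier C \<and> y \<in> acarrier C}"
      by (rule complex_vec.span_add[OF complex_vec.span_scale[OF complex_vec.span_base[OF step(1)]]
            conjunct1[OF step(2)]])
    ultimately show ?case by blast
  qed
  then show ?thesis by blast
qed

lemma adjoint_of_astar:
  assumes "T \<in> acarrier basic"
  shows "adjoint_of T (astar basic T)"
proof -
  obtain S where S: "adjoint_of T S" using adjoint_of_exists[OF assms] by blast
  have *: "(S \<in> basic_carrier C (\<iota> \<circ> \<eta>) \<and> (\<forall>x\<in>acarrier C. \<forall>y\<in>acarrier C.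
      (\<iota> \<circ> \<eta>) (amul C (astar C (S x)) y) = (\<iota> \<circ> \<eta>) (amul C (astar C x) (T y)))) = adjoint_of T S" for S
  proof -
    have "(\<iota> (\<eta> (amul C (astar C (S x)) y)) = \<iota> (\<eta> (amul C (astar C x) (T y)))) =
      (\<eta> (amul C (astar C (S x)) y) = \<eta> (amul C (astar C x) (T y)))"
      if "S \<in> acarrier basic" "x \<in> acarrier C" "y \<in> acarrier C" for x y
      using that assms \<iota>_inj[OF \<eta>_closed \<eta>_closed]
      by (auto simp: basic_carrier_iff right_linearD mul_closed astar_closed)
    then show ?thesis unfolding adjoint_of_def by (auto simp: basic_construction_def)
  qed
  have "astar basic T = (THE S. adjoint_of T S)"
    unfolding basic_construction_def by (simp only: star_alg.select_convs *)
  then show ?thesis using S adjoint_of_unique theI by metis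
qed

lemma astar_basic_eqI: "T \<in> acarrier basic \<Longrightarrow> adjoint_of T S \<Longrightarrow> astar basic T = S"
  using adjoint_of_astar adjoint_of_unique by blast

lemma astar_jones_elem:
  "x \<in> acarrier C \<Longrightarrow> y \<in> acarrier C \<Longrightarrow>
    astar basic (jones x y) = jones (astar C y) (astar C x)"
  by (intro astar_basic_eqI adjoint_of_jones_elem jones_elem_closed)

lemma right_linear_comp: "right_linear T \<Longrightarrow> right_linear T' \<Longrightarrow> right_linear (T \<circ> T')"
  unfolding right_linear_def[of "T \<circ> T'"]
  by (simp add: right_linearD right_linear_zero_value)

lemma right_linear_one: "right_linear (on_carrier C id)"
  by (auto simp: right_linear_def on_carrier_def add_closed scale_closed mul_closed \<iota>_closed)

lemma right_linear_left_mult: "x \<in> acarrier C \<Longrightarrow> right_linear (left_mult C x)"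
  by (auto simp: right_linear_def left_mult_def on_carrier_def add_closed scale_closed mul_closed \<iota>_closed
      mul_add_right mul_scale_right mul_assoc)

lemma adjoint_of_left_mult: "x \<in> acarrier C \<Longrightarrow> adjoint_of (left_mult C x) (left_mult C (astar C x))"
  by (auto simp: adjoint_of_def basic_carrier_iff right_linear_left_mult astar_closed)
    (simp add: left_mult_def on_carrier_def astar_mul astar_closed mul_assoc astar_astar)

lemma adjoint_of_sym:
  assumes "adjoint_of T S" "right_linear T"
  shows "adjoint_of S T"
  unfolding adjoint_of_def
proof (intro conjI ballI)
  show "T \<in> acarrier basic" using assms by (simp add: basic_carrier_iff)
  fix x y assume xy: "x \<in> acarrier C" "y \<in> acarrier C"
  have S: "right_linear S" using assms by (simp add: adjoint_of_def basic_carrier_iff)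
  have "\<eta> (amul C (astar C (T x)) y) = star (\<eta> (amul C (astar C y) (T x)))"
    using xy assms by (simp add: \<eta>_astar[symmetric] mul_closed astar_closed right_linearD astar_mul astar_astar)
  also have "\<dots> = star (\<eta> (amul C (astar C (S y)) x))"
    using xy assms(1) by (simp add: adjoint_of_def)
  also have "\<dots> = \<eta> (amul C (astar C x) (S y))"
    using xy S by (simp add: \<eta>_astar[symmetric] mul_closed astar_closed right_linearD astar_mul astar_astar)
  finally show "\<eta> (amul C (astar C (T x)) y) = \<eta> (amul C (astar C x) (S y))" .
qed

lemma adjoint_of_comp:
  assumes "adjoint_of T S" "adjoint_of T' S'" "right_linear T" "right_linear T'"
  shows "adjoint_of (T \<circ> T') (S' \<circ> S)"
  using assms right_linear_comp[of S' S]
  by (auto simp: adjoint_of_def basic_carrier_iff right_linearD)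

lemma star_algebra_basic: "star_algebra basic"
proof
  show "csubspace (acarrier basic)"
    unfolding acarrier_basic by (rule complex_vec.subspace_span)
  fix x y z :: "'c \<Rightarrow> 'c" and r
  note rl = basic_carrier_iff
  show "x \<in> acarrier basic \<Longrightarrow> y \<in> acarrier basic \<Longrightarrow> amul basic x y \<in> acarrier basic"
    by (simp add: rl right_linear_comp amul_basic)
  show "x \<in> acarrier basic \<Longrightarrow> astar basic x \<in> acarrier basic"
    using adjoint_of_astar adjoint_of_def by blast
  show "aone basic \<in> acarrier basic"
    by (simp add: rl right_linear_one aone_basic)
  show "x \<in> acarrier basic \<Longrightarrow> y \<in> acarrier basic \<Longrightarrow> z \<in> acarrier basic \<Longrightarrow>
    amul basic (x + y) z = amul basic x z + amul basic y z"
    by (auto simp: amul_basic)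
  show "x \<in> acarrier basic \<Longrightarrow> y \<in> acarrier basic \<Longrightarrow> z \<in> acarrier basic \<Longrightarrow>
    amul basic z (x + y) = amul basic z x + amul basic z y"
    by (rule ext) (simp add: amul_basic rl, metis right_linearD(1-3) right_linear_zero_value add.left_neutral)
  show "x \<in> acarrier basic \<Longrightarrow> y \<in> acarrier basic \<Longrightarrow> amul basic (r *\<^sub>C x) y = r *\<^sub>C amul basic x y"
    by (auto simp: amul_basic scaleC_fun_def)
  show "x \<in> acarrier basic \<Longrightarrow> y \<in> acarrier basic \<Longrightarrow> amul basic x (r *\<^sub>C y) = r *\<^sub>C amul basic x y"
    by (rule ext) (simp add: amul_basic rl scaleC_fun_def, metis right_linearD(1,2,4) right_linear_zero_value complex_vec.scale_zero_right)
  show "amul basic (amul basic x y) z = amul basic x (amul basic y z)"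
    by (simp add: amul_basic o_assoc)
  show "x \<in> acarrier basic \<Longrightarrow> amul basic (aone basic) x = x"
    by (rule ext) (auto simp: amul_basic rl aone_basic on_carrier_def right_linearD, metis right_linearD(1,2))
  show "x \<in> acarrier basic \<Longrightarrow> amul basic x (aone basic) = x"
    by (rule ext) (auto simp: amul_basic rl aone_basic on_carrier_def right_linearD right_linear_zero_value)
  show "x \<in> acarrier basic \<Longrightarrow> y \<in> acarrier basic \<Longrightarrow> astar basic (x + y) = astar basic x + astar basic y"
    using complex_vec.subspace_add[OF subspace_right_linear]
    by (intro astar_basic_eqI adjoint_of_add adjoint_of_astar) (simp_all add: rl)
  show "x \<in> acarrier basic \<Longrightarrow> astar basic (r *\<^sub>C x) = cnj r *\<^sub>C astar basic x"
    using complex_vec.subspace_scale[OF subspace_right_linear]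
    by (intro astar_basic_eqI adjoint_of_scale adjoint_of_astar) (simp_all add: rl)
  show "x \<in> acarrier basic \<Longrightarrow> y \<in> acarrier basic \<Longrightarrow>
    astar basic (amul basic x y) = amul basic (astar basic y) (astar basic x)"
    unfolding amul_basic
    by (intro astar_basic_eqI adjoint_of_comp adjoint_of_astar) (simp_all add: rl right_linear_comp)
  show "x \<in> acarrier basic \<Longrightarrow> astar basic (astar basic x) = x"
    using adjoint_of_astar[of x] adjoint_of_sym[of x] adjoint_of_def astar_basic_eqI rl by blast
qed


subsection \<open>The basic construction as a corner of a matrix algebra\<close>

lemma matK_simps:
  "acarrier matK = mat_carrier k K"
  "amul matK M N = (\<lambda>i j. \<Sum>l<k. M i l * N l j)"
  "astar matK M = (\<lambda>i j. star (M j i))"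
  by (simp_all add: mat_alg_def type_alg_def)

lemma to_matrix_apply: "i < k \<Longrightarrow> j < k \<Longrightarrow> to_matrix T i j = coord i (T (u j))"
  and to_matrix_outside: "\<not> (i < k \<and> j < k) \<Longrightarrow> to_matrix T i j = 0"
  by (auto simp: to_matrix_def)

lemma to_matrix_closed: "right_linear T \<Longrightarrow> to_matrix T \<in> mat_carrier k K"
  by (auto simp: mat_carrier_def to_matrix_def coord_closed right_linearD u_closed)

lemma to_matrix_add:
  "right_linear T \<Longrightarrow> right_linear T' \<Longrightarrow> to_matrix (T + T') = to_matrix T + to_matrix T'"
  by (auto simp: to_matrix_def coord_add right_linearD(2) u_closed intro!: ext)

lemma to_matrix_scale: "right_linear T \<Longrightarrow> to_matrix (r *\<^sub>C T) = r *\<^sub>C to_matrix T"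
  by (auto simp: to_matrix_def scaleC_fun_def coord_scale right_linearD(2) u_closed intro!: ext)

lemma to_matrix_one: "to_matrix (on_carrier C id) = gram"
  by (auto simp: gram_def to_matrix_def on_carrier_def u_closed intro!: ext)

lemma coord_image:
  assumes "right_linear T" "z \<in> acarrier C" "i < k"
  shows "coord i (T z) = (\<Sum>l<k. to_matrix T i l * coord l z)"
  using assms
  by (subst right_linear_expansion)
    (simp_all add: coord_sum mul_closed right_linearD u_closed \<iota>_closed coord_closed coord_right
      to_matrix_apply cong: sum.cong_simp)

lemma coord_gram: "z \<in> acarrier C \<Longrightarrow> i < k \<Longrightarrow> (\<Sum>l<k. gram i l * coord l z) = coord i z"
  using coord_image[OF right_linear_one, of z i] unfolding to_matrix_one by (simp add: on_carrier_def)

lemma to_matrix_comp: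
  assumes "right_linear T" "right_linear T'"
  shows "to_matrix (T \<circ> T') = amul matK (to_matrix T) (to_matrix T')"
proof (intro ext)
  fix i j
  show "to_matrix (T \<circ> T') i j = amul matK (to_matrix T) (to_matrix T') i j"
  proof (cases "i < k \<and> j < k")
    case True
    then show ?thesis
      using assms by (simp add: matK_simps to_matrix_apply coord_image right_linearD u_closed cong: sum.cong_simp)
  next
    case False
    then show ?thesis by (auto simp: matK_simps to_matrix_def)
  qed
qed

lemma to_matrix_adjoint:
  assumes T: "right_linear T" and S: "adjoint_of T S"
  shows "to_matrix S = astar matK (to_matrix T)"
proof (intro ext)
  have S': "right_linear S" using S by (simp add: adjoint_of_def basic_carrier_iff)
  fix i j
  show "to_matrix S i j = astar matK (to_matrix T) i j"
  proof (cases "i < k \<and> j < k")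
    case True
    then have ij: "i < k" "j < k" by auto
    have "\<rho> * star (coord i (S (u j))) = \<eta> (amul C (astar C (S (u j))) (u i))"
      using ij S' by (simp add: star_coord right_linearD u_closed)
    also have "\<dots> = \<eta> (amul C (astar C (u j)) (T (u i)))"
      using S ij by (simp add: adjoint_of_def u_closed)
    also have "\<dots> = \<rho> * coord j (T (u i))"
      by (simp add: coord_def \<rho>_\<sigma> flip: mult.assoc)
    finally have "\<sigma> * \<rho> * star (coord i (S (u j))) = \<sigma> * \<rho> * coord j (T (u i))"
      by (simp only: mult.assoc)
    then have "star (coord i (S (u j))) = coord j (T (u i))" by (simp add: \<sigma>_\<rho>)
    then show ?thesis using ij by (simp add: matK_simps to_matrix_apply) (metis star_star)
  qed (auto simp: matK_simps to_matrix_def)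
qed

text \<open>
  The operator \<open>z \<mapsto> \<Sum> u\<^sub>i M\<^sub>i\<^sub>j z\<^sub>j\<close> in the coordinates \<open>z\<^sub>j\<close> of \<open>z\<close>, spelled out in rank one operators
  so that it visibly lies in the basic construction.
\<close>

definition of_matrix :: "(nat \<Rightarrow> nat \<Rightarrow> 'a) \<Rightarrow> 'c \<Rightarrow> 'c"
  where "of_matrix M =
    (\<Sum>i<k. \<Sum>j<k. jones (amul C (u i) (\<iota> (M i j * \<sigma>))) (astar C (u j)))"

lemma right_linear_of_matrix:
  assumes M: "M \<in> mat_carrier k K"
  shows "right_linear (of_matrix M)"
proof -
  have "of_matrix M \<in> {T. right_linear T}"
    unfolding of_matrix_def
    using M by (intro complex_vec.subspace_sum subspace_right_linear)
      (auto intro!: right_linear_jones_elem mul_closed \<iota>_closed astar_closed u_closed mult_K \<sigma>_closed mat_carrierD[OF M])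
  then show ?thesis by simp
qed

lemma of_matrix_add:
  assumes M: "M \<in> mat_carrier k K" "N \<in> mat_carrier k K"
  shows "of_matrix (M + N) = of_matrix M + of_matrix N"
proof -
  have "jones (amul C (u i) (\<iota> ((M + N) i j * \<sigma>))) (astar C (u j)) =
      jones (amul C (u i) (\<iota> (M i j * \<sigma>))) (astar C (u j)) +
      jones (amul C (u i) (\<iota> (N i j * \<sigma>))) (astar C (u j))" if "i < k" "j < k" for i j
    using that mat_carrierD[OF M(1) that] mat_carrierD[OF M(2) that]
    by (intro ext) (simp add: jones_elem_apply mul_closed \<iota>_closed u_closed astar_closed mult_K \<sigma>_closed K_rules
        distrib_right \<iota>_simps mul_add_right mul_add_left \<eta>_closed add_closed)
  then show ?thesis by (simp add: of_matrix_def sum.distrib)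
qed

lemma of_matrix_scale:
  assumes M: "M \<in> mat_carrier k K"
  shows "of_matrix (r *\<^sub>C M) = r *\<^sub>C of_matrix M"
proof -
  have "jones (amul C (u i) (\<iota> ((r *\<^sub>C M) i j * \<sigma>))) (astar C (u j)) =
      r *\<^sub>C jones (amul C (u i) (\<iota> (M i j * \<sigma>))) (astar C (u j))" if "i < k" "j < k" for i j
    using that mat_carrierD[OF M(1) that]
    by (intro ext) (simp add: scaleC_fun_def jones_elem_apply mul_closed \<iota>_closed u_closed astar_closed mult_K \<sigma>_closed
        K_rules mult_scaleC_left \<iota>_simps mul_scale_right mul_scale_left \<eta>_closed scale_closed)
  then show ?thesis by (simp only: of_matrix_def complex_vec.scale_sum_right) (intro sum.cong refl, simp)
qed

lemma of_matrix_apply: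
  assumes M: "M \<in> mat_carrier k K" and z: "z \<in> acarrier C"
  shows "of_matrix M z = (\<Sum>i<k. amul C (u i) (\<iota> (\<Sum>j<k. M i j * coord j z)))"
proof -
  have "jones (amul C (u i) (\<iota> (M i j * \<sigma>))) (astar C (u j)) z =
      amul C (u i) (\<iota> (M i j * coord j z))" if "i < k" "j < k" for i j
  proof -
    have "M i j \<in> K" using M that by (rule mat_carrierD)
    then show ?thesis
      using z that
      by (simp add: jones_elem_apply mul_closed u_closed \<iota>_closed mult_K \<sigma>_closed astar_closed
          mul_assoc \<eta>_closed coord_def mult.assoc flip: \<iota>_mult)
  qed
  then have "of_matrix M z = (\<Sum>i<k. \<Sum>j<k. amul C (u i) (\<iota> (M i j * coord j z)))"
    by (simp add: of_matrix_def fun_sum_apply)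
  also have "\<dots> = (\<Sum>i<k. amul C (u i) (\<iota> (\<Sum>j<k. M i j * coord j z)))"
  proof (rule sum.cong)
    fix i assume "i \<in> {..<k}"
    then have i: "i < k" by simp
    have c: "\<iota> (M i j * coord j z) \<in> acarrier C" if "j < k" for j
      using M i z that by (intro \<iota>_closed mult_K mat_carrierD[OF M] coord_closed)
    show "(\<Sum>j<k. amul C (u i) (\<iota> (M i j * coord j z))) = amul C (u i) (\<iota> (\<Sum>j<k. M i j * coord j z))"
      unfolding \<iota>_simps using i c by (subst mul_sum_right) (simp_all add: u_closed)
  qed simp
  finally show ?thesis .
qed

lemma coord_of_matrix:
  assumes M: "M \<in> mat_carrier k K" and z: "z \<in> acarrier C" and i: "i < k"
  shows "coord i (of_matrix M z) = (\<Sum>l<k. \<Sum>j<k. gram i l * M l j * coord j z)"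
proof -
  have c: "(\<Sum>j<k. M i j * coord j z) \<in> K" if "i < k" for i
    using that assms by (intro sum_K mult_K mat_carrierD[OF M] coord_closed)
  have "coord i (of_matrix M z) = (\<Sum>l<k. coord i (amul C (u l) (\<iota> (\<Sum>j<k. M l j * coord j z))))"
    unfolding of_matrix_apply[OF M z] using i c by (intro coord_sum mul_closed u_closed \<iota>_closed)
  also have "\<dots> = (\<Sum>l<k. coord i (u l) * (\<Sum>j<k. M l j * coord j z))"
    using i c by (intro sum.cong refl coord_right) (simp_all add: u_closed)
  also have "\<dots> = (\<Sum>l<k. \<Sum>j<k. gram i l * M l j * coord j z)"
    using i by (intro sum.cong refl) (simp add: gram_def to_matrix_apply sum_distrib_left mult.assoc)
  finally show ?thesis .
qed

lemma of_matrix_to_matrix: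
  assumes "right_linear T"
  shows "of_matrix (to_matrix T) = T"
proof
  fix z
  show "of_matrix (to_matrix T) z = T z"
  proof (cases "z \<in> acarrier C")
    case True
    have "of_matrix (to_matrix T) z = (\<Sum>i<k. amul C (u i) (\<iota> (coord i (T z))))"
      unfolding of_matrix_apply[OF to_matrix_closed[OF assms] True]
      by (intro sum.cong refl) (simp add: coord_image[OF assms True])
    also have "\<dots> = T z" using assms True by (simp add: sum_coord right_linearD)
    finally show ?thesis .
  next
    case False
    then show ?thesis
      using right_linearD(1)[OF assms] right_linearD(1)[OF right_linear_of_matrix[OF to_matrix_closed[OF assms]]]
      by simp
  qed
qed

lemma to_matrix_of_matrix:
  assumes "M \<in> mat_carrier k K"
  shows "to_matrix (of_matrix M) = amul matK (amul matK gram M) gram"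
proof (intro ext)
  fix i j
  show "to_matrix (of_matrix M) i j = amul matK (amul matK gram M) gram i j"
  proof (cases "i < k \<and> j < k")
    case True
    then have "to_matrix (of_matrix M) i j = (\<Sum>l<k. \<Sum>m<k. gram i l * M l m * gram m j)"
      using assms by (simp add: to_matrix_apply coord_of_matrix u_closed gram_def cong: sum.cong_simp)
    also have "\<dots> = amul matK (amul matK gram M) gram i j"
      unfolding matK_simps sum_distrib_right by (rule sum.swap)
    finally show ?thesis .
  qed (auto simp: matK_simps to_matrix_def gram_def)
qed

lemma projection_gram: "projection matK gram"
proof -
  have one: "aone basic \<in> acarrier basic" "right_linear (on_carrier C id)"
    using star_algebra.one_closed[OF star_algebra_basic] right_linear_one by simp_all
  have "amul matK gram gram = gram"
    using to_matrix_comp[OF one(2) one(2)] star_algebra.one_left[OF star_algebra_basic one(1)]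
    by (simp add: to_matrix_one amul_basic aone_basic)
  moreover have "astar matK gram = gram"
    using to_matrix_adjoint[OF one(2) adjoint_of_astar] star_algebra.astar_one[OF star_algebra_basic] one
    by (simp add: to_matrix_one aone_basic)
  moreover have "gram \<in> acarrier matK"
    using to_matrix_closed[OF one(2)] by (simp add: to_matrix_one matK_simps)
  ultimately show ?thesis by (simp add: projection_def)
qed

lemma mat_carrier_add: "M \<in> mat_carrier k K \<Longrightarrow> N \<in> mat_carrier k K \<Longrightarrow> M + N \<in> mat_carrier k K"
  and mat_carrier_scale: "M \<in> mat_carrier k K \<Longrightarrow> r *\<^sub>C M \<in> mat_carrier k K"
  and mat_carrier_zero: "0 \<in> mat_carrier k K"
  by (auto simp: mat_carrier_def scaleC_fun_def K_rules split: if_splits)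

lemma mat_carrier_mult:
  "M \<in> mat_carrier k K \<Longrightarrow> N \<in> mat_carrier k K \<Longrightarrow> amul matK M N \<in> mat_carrier k K"
  unfolding matK_simps mat_carrier_def mem_Collect_eq
  by (intro allI) (smt (verit) mult_K mult_zero_left mult_zero_right sum_K sum.neutral)

text \<open>
  A matrix with the single entry \<open>m\<close> is \<open>x p y\<close>, where \<open>x\<close> has one row and \<open>y\<close> one column made from the
  coordinates \<open>e\<^sub>i\<close> of \<open>1\<close>, because \<open>1 = \<rho> \<Sum> e\<^sub>i\<^sup>* e\<^sub>i\<close>.
\<close>

lemma full_projection_gram: "full_projection matK gram"
  unfolding full_projection_def
proof (intro conjI projection_gram subset_antisym)
  let ?G = "{amul matK (amul matK x gram) y | x y. x \<in> acarrier matK \<and> y \<in> acarrier matK}"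
  have "csubspace (mat_carrier k K)"
    by (intro complex_vec.subspaceI mat_carrier_add mat_carrier_scale mat_carrier_zero)
  then show "cspan ?G \<subseteq> acarrier matK"
    using projection_gram
    by (intro complex_vec.span_minimal) (auto simp: matK_simps(1) projection_def intro!: mat_carrier_mult)
  show "acarrier matK \<subseteq> cspan ?G"
  proof
    fix M assume M: "M \<in> acarrier matK"
    let ?e = "\<lambda>i. coord i (aone C)"
    define x where "x r s = (\<lambda>a b. if a = r \<and> r < k \<and> b < k then M r s * \<rho> * star (?e b) else 0)" for r s
    define y where "y s = (\<lambda>a b. if b = s \<and> s < k \<and> a < k then ?e a else 0)" for s
    have one: "\<rho> * (\<Sum>i<k. star (?e i) * ?e i) = 1"
      using inner_coord[OF one_closed one_closed] \<eta>_\<iota>[OF one_K]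
      by (simp add: astar_one one_left one_closed \<iota>_one)
    have xy: "amul matK (amul matK (x r s) gram) (y s) = (\<lambda>a b. if a = r \<and> b = s then M r s else 0)"
      if rs: "r < k" "s < k" for r s
    proof (intro ext)
      fix a b
      have "(\<Sum>l<k. (\<Sum>i<k. M r s * \<rho> * star (?e i) * gram i l) * ?e l)
          = (\<Sum>l<k. \<Sum>i<k. M r s * \<rho> * star (?e i) * gram i l * ?e l)"
        by (simp add: sum_distrib_right)
      also have "\<dots> = (\<Sum>i<k. \<Sum>l<k. M r s * \<rho> * star (?e i) * gram i l * ?e l)"
        by (rule sum.swap)
      also have "\<dots> = (\<Sum>i<k. M r s * \<rho> * star (?e i) * ?e i)"
        by (simp add: mult.assoc sum_distrib_left[symmetric] coord_gram one_closed cong: sum.cong_simp)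
      also have "\<dots> = M r s"
        using one by (simp add: mult.assoc sum_distrib_left[symmetric])
      finally show "amul matK (amul matK (x r s) gram) (y s) a b = (if a = r \<and> b = s then M r s else 0)"
        using rs by (auto simp: matK_simps x_def y_def cong: sum.cong_simp)
    qed
    have in_G: "(\<lambda>a b. if a = r \<and> b = s then M r s else 0) \<in> cspan ?G" if rs: "r < k" "s < k" for r s
    proof (rule complex_vec.span_base)
      have "M r s \<in> K" using M rs mat_carrierD unfolding matK_simps by blast
      then have "x r s \<in> acarrier matK" "y s \<in> acarrier matK"
        using rs unfolding matK_simps(1) x_def y_def mat_carrier_def
        by (simp_all add: K_rules coord_closed one_closed \<rho>_closed)
      then show "(\<lambda>a b. if a = r \<and> b = s then M r s else 0) \<in> ?G"
        unfolding xy[OF rs, symmetric] by blast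
    qed
    have "M = (\<Sum>r<k. \<Sum>s<k. (\<lambda>a b. if a = r \<and> b = s then M r s else 0))"
    proof (intro ext)
      fix a b
      have "(\<Sum>r<k. \<Sum>s<k. if a = r \<and> b = s then M r s else 0) = (\<Sum>r<k. if a = r then (\<Sum>s<k. if b = s then M r s else 0) else 0)"
        by (intro sum.cong refl) auto
      also have "\<dots> = (if a < k \<and> b < k then M a b else 0)" by simp
      also have "\<dots> = M a b" using M by (auto simp: matK_simps mat_carrier_def)
      finally show "M a b = (\<Sum>r<k. \<Sum>s<k. (\<lambda>a b. if a = r \<and> b = s then M r s else 0)) a b"
        by (simp add: fun_sum_apply)
    qed
    also have "\<dots> \<in> cspan ?G"
      using in_G by (intro complex_vec.span_sum) simp
    finally show "M \<in> cspan ?G" .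
  qed
qed

lemma to_matrix_corner:
  assumes "right_linear T"
  shows "amul matK (amul matK gram (to_matrix T)) gram = to_matrix T"
  using to_matrix_of_matrix[OF to_matrix_closed[OF assms]] by (simp add: of_matrix_to_matrix assms)

lemma star_alg_iso_to_matrix: "star_alg_iso to_matrix basic (corner matK gram)"
  unfolding star_alg_iso_def
proof (intro conjI ballI allI)
  show "bij_betw to_matrix (acarrier basic) (acarrier (corner matK gram))"
  proof (rule bij_betw_byWitness[where f'=of_matrix])
    show "\<forall>T\<in>acarrier basic. of_matrix (to_matrix T) = T"
      by (simp add: basic_carrier_iff of_matrix_to_matrix)
    have *: "amul matK (amul matK gram M) gram \<in> mat_carrier k K \<and>
        to_matrix (of_matrix (amul matK (amul matK gram M) gram)) = amul matK (amul matK gram M) gram"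
      if "M \<in> mat_carrier k K" for M
      using to_matrix_of_matrix[OF that] right_linear_of_matrix[OF that] of_matrix_to_matrix to_matrix_closed
      by metis
    then show "\<forall>M\<in>acarrier (corner matK gram). to_matrix (of_matrix M) = M"
      by (auto simp: corner_def matK_simps(1))
    show "to_matrix ` acarrier basic \<subseteq> acarrier (corner matK gram)"
    proof
      fix M assume "M \<in> to_matrix ` acarrier basic"
      then obtain T where "right_linear T" "M = to_matrix T" by (auto simp: basic_carrier_iff)
      then show "M \<in> acarrier (corner matK gram)"
        using to_matrix_corner to_matrix_closed by (auto simp: corner_def matK_simps(1)) metis
    qed
    show "of_matrix ` acarrier (corner matK gram) \<subseteq> acarrier basic"
      using * by (auto simp: corner_def matK_simps(1) basic_carrier_iff intro!: right_linear_of_matrix)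
  qed
  fix T T' assume T: "T \<in> acarrier basic" and T': "T' \<in> acarrier basic"
  show "to_matrix (T + T') = to_matrix T + to_matrix T'"
    using T T' by (simp add: basic_carrier_iff to_matrix_add)
  show "to_matrix (amul basic T T') = amul (corner matK gram) (to_matrix T) (to_matrix T')"
    using T T' by (simp add: corner_def amul_basic to_matrix_comp basic_carrier_iff)
next
  fix T r assume T: "T \<in> acarrier basic"
  show "to_matrix (astar basic T) = astar (corner matK gram) (to_matrix T)"
    using T to_matrix_adjoint adjoint_of_astar by (simp add: corner_def basic_carrier_iff)
  show "to_matrix (r *\<^sub>C T) = r *\<^sub>C to_matrix T"
    using T by (simp add: basic_carrier_iff to_matrix_scale)
qed

lemma to_matrix_jones_elem:
  assumes "x \<in> acarrier C" "y \<in> acarrier C" "i < k" "j < k"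
  shows "to_matrix (jones x (astar C y)) i j = coord i x * \<rho> * star (coord j y)"
  using assms
  by (simp add: to_matrix_apply jones_elem_apply astar_closed u_closed coord_right \<eta>_closed mul_closed
      star_coord mult.assoc mult_K \<rho>_closed star_K coord_closed)

end

section \<open>Linear extension from balanced tensor products\<close>

text \<open>
  Linear forms separate points, so the canonical map into the bidual is injective and has a linear
  left inverse.
\<close>

lemma bidual_retraction:
  obtains R where "clinear R"
    "\<And>v::'v::complex_vec. R (\<lambda>l::'v \<Rightarrow> complex. if clinear l then l v else 0) = v"
proof -
  interpret vc: vector_space_pair "scaleC :: complex \<Rightarrow> 'v \<Rightarrow> 'v" "scaleC :: complex \<Rightarrow> complex \<Rightarrow> complex"
    by unfold_locales
  interpret vb: vector_space_pair "scaleC :: complex \<Rightarrow> 'v \<Rightarrow> 'v"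
    "scaleC :: complex \<Rightarrow> (('v \<Rightarrow> complex) \<Rightarrow> complex) \<Rightarrow> (('v \<Rightarrow> complex) \<Rightarrow> complex)"
    by unfold_locales
  let ?J = "\<lambda>(v::'v) (l::'v \<Rightarrow> complex). if clinear l then l v else 0"
  have lin: "clinear ?J"
    by (intro clinear_iff[THEN iffD2] conjI allI ext) (simp_all add: scaleC_fun_def clinear_add clinear_scale)
  have "inj ?J"
  proof (rule injI)
    fix v w assume eq: "?J v = ?J w"
    show "v = w"
    proof (rule ccontr)
      assume "v \<noteq> w"
      then have "complex_vec.independent {v - w}" by simp
      then obtain l where l: "clinear l" "l (v - w) = (1::complex)"
        using vc.linear_independent_extend[of "{v - w}" "\<lambda>_. 1"] by auto
      have "l v = l w" using fun_cong[OF eq, of l] l(1) by simp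
      then show False using l clinear_add[OF l(1), of "v - w" w] by simp
    qed
  qed
  then obtain R where R: "clinear R" "R \<circ> ?J = id"
    using vb.linear_injective_left_inverse[OF lin] by blast
  have "R (?J v) = v" for v using fun_cong[OF R(2), of v] by (simp only: o_apply id_apply)
  then show thesis by (rule that[OF R(1)])
qed

text \<open>
  The universal property of the tensor product for maps into an arbitrary space \<open>V\<close>. A tensor \<open>t\<close> acts
  on balanced forms, so \<open>l \<mapsto> t (l \<circ> F)\<close> is an element of the bidual of \<open>V\<close> that depends linearly on \<open>t\<close>;
  on \<open>c \<otimes> x \<otimes> d~\<close> it is evaluation at \<open>F c x d\<close>, which the retraction turns into \<open>F c x d\<close>.
\<close>

lemma balanced_extension:
  fixes F :: "'c::complex_vec \<Rightarrow> 'y::complex_vec \<Rightarrow> 'd::complex_vec \<Rightarrow> 'v::complex_vec"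
  assumes "\<And>l. clinear l \<Longrightarrow> (\<lambda>c x d. l (F c x d)) \<in> balanced_forms S"
  obtains f where "clinear f" "\<And>c x d. f (tensor S c x d) = F c x d"
proof -
  obtain R where R: "clinear R" "\<And>v::'v. R (\<lambda>l::'v \<Rightarrow> complex. if clinear l then l v else 0) = v"
    using bidual_retraction by blast
  define f where "f t = R (\<lambda>l. if clinear l then t (\<lambda>c x d. l (F c x d)) else 0)"
    for t :: "('c, 'd, 'y) tensor"
  have "clinear f"
    unfolding clinear_iff
  proof (intro conjI allI)
    fix s t :: "('c, 'd, 'y) tensor" and r
    have "(\<lambda>l. if clinear l then (s + t) (\<lambda>c x d. l (F c x d)) else 0)
      = (\<lambda>l. if clinear l then s (\<lambda>c x d. l (F c x d)) else 0)
        + (\<lambda>l. if clinear l then t (\<lambda>c x d. l (F c x d)) else 0)"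
      by auto
    then show "f (s + t) = f s + f t" unfolding f_def by (simp only: clinear_add[OF R(1)])
    have "(\<lambda>l. if clinear l then (r *\<^sub>C t) (\<lambda>c x d. l (F c x d)) else 0)
      = r *\<^sub>C (\<lambda>l. if clinear l then t (\<lambda>c x d. l (F c x d)) else 0)"
      by (auto simp: scaleC_fun_def)
    then show "f (r *\<^sub>C t) = r *\<^sub>C f t" unfolding f_def by (simp only: clinear_scale[OF R(1)])
  qed
  moreover have "f (tensor S c x d) = F c x d" for c x d
  proof -
    have "(\<lambda>l. if clinear l then tensor S c x d (\<lambda>c x d. l (F c x d)) else 0)
      = (\<lambda>l. if clinear l then l (F c x d) else 0)"
      using assms by (auto simp: tensor_def)
    then show ?thesis by (simp only: f_def R(2))
  qed
  ultimately show thesis using that by blast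
qed

section \<open>Equivalence bimodules\<close>

locale eq_bimodule =
  fixes Y :: "('a::cstar_algebra, 'b::cstar_algebra, 'y::complex_banach) bimod"
  assumes equivalence_bimodule: "equivalence_bimodule Y"
begin

lemma lact_linear_left: "clinear (\<lambda>c. lact Y c y)" and lact_linear: "clinear (lact Y c)"
  and ract_linear_right: "clinear (ract Y y)" and ract_linear: "clinear (\<lambda>y. ract Y y d)"
  and lact_one: "lact Y 1 y = y" and lact_mult: "lact Y (c * c') y = lact Y c (lact Y c' y)"
  and ract_one: "ract Y y 1 = y" and ract_mult: "ract Y y (d * d') = ract Y (ract Y y d) d'"
  and ract_lact: "ract Y (lact Y c y) d = lact Y c (ract Y y d)"
  and lip_linear: "clinear (\<lambda>y. lip Y y z)" and lip_sym: "lip Y y z = star (lip Y z y)"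
  and lip_lact: "lip Y (lact Y c y) z = c * lip Y y z"
  and rip_linear: "clinear (rip Y y)" and rip_sym: "rip Y y z = star (rip Y z y)"
  and rip_ract: "rip Y y (ract Y z d) = rip Y y z * d"
  and lip_ract: "lip Y (ract Y y d) z = lip Y y (ract Y z (star d))"
  and rip_lact: "rip Y (lact Y c y) z = rip Y y (lact Y (star c) z)"
  and imprimitivity: "lact Y (lip Y x y) z = ract Y x (rip Y y z)"
  and carrier_UNIV: "bcarrier Y = UNIV"
  using equivalence_bimodule unfolding equivalence_bimodule_def by - (elim conjE; fast)+

lemmas act_simps =
  clinear_add[OF lact_linear_left] clinear_scale[OF lact_linear_left] clinear_zero[OF lact_linear_left]
  clinear_add[OF lact_linear] clinear_scale[OF lact_linear] clinear_zero[OF lact_linear]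
  clinear_add[OF ract_linear_right] clinear_scale[OF ract_linear_right] clinear_zero[OF ract_linear_right]
  clinear_add[OF ract_linear] clinear_scale[OF ract_linear] clinear_zero[OF ract_linear]

lemmas act_sum = clinear_sum[OF lact_linear_left] clinear_sum[OF lact_linear]
  clinear_sum[OF ract_linear_right] clinear_sum[OF ract_linear]

lemma lip_add_right: "lip Y y (z + z') = lip Y y z + lip Y y z'"
  and lip_scale_right: "lip Y y (r *\<^sub>C z) = cnj r *\<^sub>C lip Y y z"
  by (subst (1 2 3) lip_sym, simp add: clinear_add[OF lip_linear] star_add)
    (subst (1 2) lip_sym, simp add: clinear_scale[OF lip_linear] star_scaleC)

lemma rip_add_left: "rip Y (z + z') y = rip Y z y + rip Y z' y"
  and rip_scale_left: "rip Y (r *\<^sub>C z) y = cnj r *\<^sub>C rip Y z y"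
  by (subst (1 2 3) rip_sym, simp add: clinear_add[OF rip_linear] star_add)
    (subst (1 2) rip_sym, simp add: clinear_scale[OF rip_linear] star_scaleC)

lemmas ip_simps = clinear_add[OF lip_linear] clinear_scale[OF lip_linear] clinear_zero[OF lip_linear]
  clinear_add[OF rip_linear] clinear_scale[OF rip_linear] clinear_zero[OF rip_linear]
  lip_add_right lip_scale_right rip_add_left rip_scale_left

lemma lip_zero_right: "lip Y y 0 = 0" and rip_zero_left: "rip Y 0 y = 0"
  using lip_scale_right[of y 0 0] rip_scale_left[of 0 0 y] by simp_all

lemma lip_sum_right: "lip Y y (\<Sum>i\<in>I. g i) = (\<Sum>i\<in>I. lip Y y (g i))"
  and rip_sum_left: "rip Y (\<Sum>i\<in>I. g i) y = (\<Sum>i\<in>I. rip Y (g i) y)"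
  by (induction I rule: infinite_finite_induct) (simp_all add: lip_zero_right rip_zero_left ip_simps)

lemmas ip_sum = clinear_sum[OF lip_linear] clinear_sum[OF rip_linear] lip_sum_right rip_sum_left

lemma lip_lact_right: "lip Y y (lact Y c z) = lip Y y z * star c"
  by (metis lip_lact lip_sym star_mult star_star)

lemma rip_ract_left: "rip Y (ract Y y d) z = star d * rip Y y z"
  by (metis rip_ract rip_sym star_mult star_star)

lemma act_double_sum:
  "(\<Sum>i\<in>I. \<Sum>l\<in>J. ract Y (lact Y (a i) x) (b l)) = ract Y (lact Y (\<Sum>i\<in>I. a i) x) (\<Sum>l\<in>J. b l)"
  by (simp only: act_sum(1) act_sum(4)) (simp only: act_sum(3))

end

section \<open>The upward basic construction in coordinates\<close>

text \<open>
  The middle factor of the tensor product is the image of \<open>g\<close> in the bimodule \<open>W\<close>. It is presented as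
  a subspace \<open>Z\<close> of an equivalence bimodule \<open>Y\<close> together with an embedding \<open>j\<close> into \<open>W\<close> that respects the
  actions and the inner products. At the first level \<open>Z = X\<close>, \<open>W = Y\<close> and \<open>j\<close> is the inclusion; at the
  second level \<open>Z = Y\<close>, \<open>W = Y\<^sub>1\<close> and \<open>j\<close> is the embedding of \<open>Y\<close> into \<open>Y\<^sub>1\<close>. The linear retraction \<open>P\<close> onto \<open>Z\<close>
  serves to define linear maps on all matrices over \<open>Y\<close>.
\<close>

locale bimodule_frame =
  left: frame C K \<iota> \<eta> \<rho> \<sigma> k u + right: frame D L \<kappa> \<zeta> \<rho>' \<sigma>' k v + eq_bimodule Y
  for C :: "'c::complex_vec star_alg" and K :: "'a::cstar_algebra set" and \<iota> \<eta> \<rho> \<sigma> k u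
    and D :: "'d::complex_vec star_alg" and L :: "'b::cstar_algebra set" and \<kappa> \<zeta> \<rho>' \<sigma>' v
    and Y :: "('a, 'b, 'y::complex_banach) bimod" +
  fixes Z :: "'y set" and P :: "'y \<Rightarrow> 'y" and j :: "'y \<Rightarrow> 'z::complex_vec"
    and W :: "('c, 'd, 'z) bimod" and g :: "'z \<Rightarrow> 'z"
  assumes subspace_Z: "csubspace Z"
    and lact_Z: "\<lbrakk>a \<in> K; z \<in> Z\<rbrakk> \<Longrightarrow> lact Y a z \<in> Z" and ract_Z: "\<lbrakk>b \<in> L; z \<in> Z\<rbrakk> \<Longrightarrow> ract Y z b \<in> Z"
    and lip_Z: "\<lbrakk>z \<in> Z; z' \<in> Z\<rbrakk> \<Longrightarrow> lip Y z z' \<in> K" and rip_Z: "\<lbrakk>z \<in> Z; z' \<in> Z\<rbrakk> \<Longrightarrow> rip Y z z' \<in> L"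
    and P_linear: "clinear P" and P_Z: "P y \<in> Z" and P_id: "z \<in> Z \<Longrightarrow> P z = z"
    and j_linear: "clinear j" and j_inj: "inj_on j Z" and range_g: "g ` bcarrier W = j ` Z"
    and lact_j: "\<lbrakk>a \<in> K; z \<in> Z\<rbrakk> \<Longrightarrow> lact W (\<iota> a) (j z) = j (lact Y a z)"
    and ract_j: "\<lbrakk>b \<in> L; z \<in> Z\<rbrakk> \<Longrightarrow> ract W (j z) (\<kappa> b) = j (ract Y z b)"
    and lip_j: "\<lbrakk>z \<in> Z; z' \<in> Z\<rbrakk> \<Longrightarrow> lip W (j z) (j z') = \<iota> (lip Y z z')"
    and rip_j: "\<lbrakk>z \<in> Z; z' \<in> Z\<rbrakk> \<Longrightarrow> rip W (j z) (j z') = \<kappa> (rip Y z z')"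
    and \<rho>_act: "z \<in> Z \<Longrightarrow> lact Y \<rho> z = ract Y z \<rho>'"
begin

definition data :: "('c, 'd, 'z) expectation_data"
  where "data = \<lparr>lalg = C, lexp = \<iota> \<circ> \<eta>, ralg = D, rexp = \<kappa> \<circ> \<zeta>, bim = W, bexp = g\<rparr>"

lemma data_simps: "lalg data = C" "lexp data = \<iota> \<circ> \<eta>" "ralg data = D" "rexp data = \<kappa> \<circ> \<zeta>"
  "bim data = W" "bexp data = g"
  by (simp_all add: data_def)

abbreviation tens :: "'c \<Rightarrow> 'y \<Rightarrow> 'd \<Rightarrow> ('c, 'd, 'z) tensor"
  where "tens c x d \<equiv> tensor data c (j x) d"

abbreviation Y1 :: "('c \<Rightarrow> 'c, 'd \<Rightarrow> 'd, ('c, 'd, 'z) tensor) bimod"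
  where "Y1 \<equiv> upward_bimod data"

abbreviation matZ :: "(nat \<Rightarrow> nat \<Rightarrow> 'a, nat \<Rightarrow> nat \<Rightarrow> 'b, nat \<Rightarrow> nat \<Rightarrow> 'y) bimod"
  where "matZ \<equiv> mat_bimod k (Y\<lparr>bcarrier := Z\<rparr>)"

abbreviation left_value :: "'c \<Rightarrow> 'y \<Rightarrow> 'd \<Rightarrow> 'y \<Rightarrow> 'd \<Rightarrow> 'c"
  where "left_value c x d x' d' \<equiv> amul C c (lip W (ract W (j x) ((\<kappa> \<circ> \<zeta>) (amul D (astar D d) d'))) (j x'))"

abbreviation right_value :: "'c \<Rightarrow> 'y \<Rightarrow> 'c \<Rightarrow> 'y \<Rightarrow> 'd \<Rightarrow> 'd"
  where "right_value c x c' x' d' \<equiv> amul D (rip W (j x) (lact W ((\<iota> \<circ> \<eta>) (amul C (astar C c) c')) (j x'))) (astar D d')"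

definition tensors :: "('c, 'd, 'z) tensor set"
  where "tensors = {tens c x d | c x d. c \<in> acarrier C \<and> x \<in> Z \<and> d \<in> acarrier D}"

text \<open>
  The factor \<open>\<rho>\<close> makes the inner products agree: the matrices then carry \<open>\<rho>\<close> twice, and the inner
  product of tensors carries \<open>\<rho>\<close> once from \<open>C\<close> and \<open>\<rho>'\<close> once from \<open>D\<close>.
\<close>

definition elem_matrix :: "'c \<Rightarrow> 'y \<Rightarrow> 'd \<Rightarrow> nat \<Rightarrow> nat \<Rightarrow> 'y"
  where "elem_matrix c x d = (\<lambda>i l. if i < k \<and> l < k
    then lact Y (\<rho> * left.coord i c) (ract Y x (star (right.coord l d))) else 0)"

lemma matZ_simps:
  "bcarrier matZ = mat_carrier k Z"
  "lact matZ M N = (\<lambda>i l. \<Sum>m<k. lact Y (M i m) (N m l))"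
  "ract matZ N M' = (\<lambda>i l. \<Sum>m<k. ract Y (N i m) (M' m l))"
  "lip matZ N N' = (\<lambda>i l. \<Sum>m<k. lip Y (N i m) (N' l m))"
  "rip matZ N N' = (\<lambda>i l. \<Sum>m<k. rip Y (N m i) (N' m l))"
  by (simp_all add: mat_bimod_def)

lemma Z_rules: "0 \<in> Z" "x \<in> Z \<Longrightarrow> y \<in> Z \<Longrightarrow> x + y \<in> Z" "x \<in> Z \<Longrightarrow> r *\<^sub>C x \<in> Z"
  using subspace_Z by (simp_all add: complex_vec.subspace_0 complex_vec.subspace_add complex_vec.subspace_scale)

text \<open>The conditions on a balanced form, pulled back along \<open>j\<close>, \<open>\<iota>\<close> and \<open>\<kappa>\<close>.\<close>

lemma balanced_iff:
  "f \<in> balanced_forms data \<longleftrightarrow> (\<forall>c\<in>acarrier C. \<forall>x\<in>Z. \<forall>d\<in>acarrier D.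
      (\<forall>c'\<in>acarrier C. f (c + c') (j x) d = f c (j x) d + f c' (j x) d) \<and>
      (\<forall>x'\<in>Z. f c (j (x + x')) d = f c (j x) d + f c (j x') d) \<and>
      (\<forall>d'\<in>acarrier D. f c (j x) (d + d') = f c (j x) d + f c (j x) d') \<and>
      (\<forall>r. f (r *\<^sub>C c) (j x) d = r * f c (j x) d \<and> f c (j (r *\<^sub>C x)) d = r * f c (j x) d \<and>
           f c (j x) (r *\<^sub>C d) = cnj r * f c (j x) d) \<and>
      (\<forall>a\<in>K. f (amul C c (\<iota> a)) (j x) d = f c (j (lact Y a x)) d) \<and>
      (\<forall>b\<in>L. f c (j (ract Y x b)) d = f c (j x) (amul D d (\<kappa> (star b)))))"
proof -
  have A: "(\<iota> \<circ> \<eta>) ` acarrier C = \<iota> ` K"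
  proof -
    have "\<eta> ` acarrier C = K"
      using left.\<eta>_closed left.\<eta>_\<iota> left.\<iota>_closed by (auto simp: image_iff) metis
    then show ?thesis by (simp only: image_comp[symmetric])
  qed
  have B: "(\<kappa> \<circ> \<zeta>) ` acarrier D = \<kappa> ` L"
  proof -
    have "\<zeta> ` acarrier D = L"
      using right.\<eta>_closed right.\<eta>_\<iota> right.\<iota>_closed by (auto simp: image_iff) metis
    then show ?thesis by (simp only: image_comp[symmetric])
  qed
  show ?thesis
    unfolding balanced_forms_def Let_def data_simps A B range_g mem_Collect_eq
    unfolding ball_simps(9)
    by (simp add: lact_j ract_j right.\<iota>_star[symmetric] clinear_add[OF j_linear] clinear_scale[OF j_linear])
qed

lemma tens_rules:
  assumes c: "c \<in> acarrier C" and x: "x \<in> Z" and d: "d \<in> acarrier D"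
  shows "c' \<in> acarrier C \<Longrightarrow> tens (c + c') x d = tens c x d + tens c' x d"
    and "x' \<in> Z \<Longrightarrow> tens c (x + x') d = tens c x d + tens c x' d"
    and "d' \<in> acarrier D \<Longrightarrow> tens c x (d + d') = tens c x d + tens c x d'"
    and "tens c (r *\<^sub>C x) d = r *\<^sub>C tens c x d"
    and "a \<in> K \<Longrightarrow> tens (amul C c (\<iota> a)) x d = tens c (lact Y a x) d"
    and "b \<in> L \<Longrightarrow> tens c x (amul D d (\<kappa> b)) = tens c (ract Y x (star b)) d"
proof -
  have b': "b \<in> L \<Longrightarrow> star b \<in> L \<and> star (star b) = b" by (simp add: right.star_K star_star)
  show "c' \<in> acarrier C \<Longrightarrow> tens (c + c') x d = tens c x d + tens c' x d"
    "x' \<in> Z \<Longrightarrow> tens c (x + x') d = tens c x d + tens c x' d"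
    "d' \<in> acarrier D \<Longrightarrow> tens c x (d + d') = tens c x d + tens c x d'"
    "tens c (r *\<^sub>C x) d = r *\<^sub>C tens c x d"
    "a \<in> K \<Longrightarrow> tens (amul C c (\<iota> a)) x d = tens c (lact Y a x) d"
    using assms by (auto intro!: ext simp: tensor_def balanced_iff scaleC_apply scaleC_complex_def)
  show "b \<in> L \<Longrightarrow> tens c x (amul D d (\<kappa> b)) = tens c (ract Y x (star b)) d"
    using assms b' by (auto intro!: ext simp: tensor_def balanced_iff)
qed

lemma tens_zero: "c \<in> acarrier C \<Longrightarrow> d \<in> acarrier D \<Longrightarrow> tens c 0 d = 0"
  "x \<in> Z \<Longrightarrow> d \<in> acarrier D \<Longrightarrow> tens 0 x d = 0" "c \<in> acarrier C \<Longrightarrow> x \<in> Z \<Longrightarrow> tens c x 0 = 0"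
  using tens_rules(2)[of c 0 d 0] tens_rules(1)[of 0 x d 0] tens_rules(3)[of c x 0 0]
  by (simp_all add: Z_rules left.zero_closed right.zero_closed)

lemma tens_sum_left:
  "(\<And>i. i < n \<Longrightarrow> f i \<in> acarrier C) \<Longrightarrow> x \<in> Z \<Longrightarrow> d \<in> acarrier D \<Longrightarrow>
    tens (\<Sum>i<n. f i) x d = (\<Sum>i<n. tens (f i) x d)" for n :: nat
  by (induction n) (simp_all add: tens_zero tens_rules(1) left.sum_closed)

lemma tens_sum_right:
  "(\<And>i. i < n \<Longrightarrow> f i \<in> acarrier D) \<Longrightarrow> c \<in> acarrier C \<Longrightarrow> x \<in> Z \<Longrightarrow>
    tens c x (\<Sum>i<n. f i) = (\<Sum>i<n. tens c x (f i))" for n :: nat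
  by (induction n) (simp_all add: tens_zero tens_rules(3) right.sum_closed)

lemma elem_matrix_closed:
  assumes "c \<in> acarrier C" "x \<in> Z" "d \<in> acarrier D"
  shows "elem_matrix c x d \<in> mat_carrier k Z"
  using assms
  by (simp add: mat_carrier_def elem_matrix_def lact_Z ract_Z left.mult_K left.\<rho>_closed left.coord_closed
      right.star_K right.coord_closed)

text \<open>Composition with \<open>P\<close> keeps the entries in \<open>Z\<close> even at arguments outside the tensor product.\<close>

lemma coordinates_exist:
  obtains f where "clinear f" "\<And>t. f t \<in> mat_carrier k Z"
    "\<And>c x d. \<lbrakk>c \<in> acarrier C; x \<in> Z; d \<in> acarrier D\<rbrakk> \<Longrightarrow> f (tens c x d) = elem_matrix c x d"
proof -
  define F where "F c z d = elem_matrix c (inv_into Z j z) d" for c z d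
  have F: "F c (j x) d = elem_matrix c x d" if "x \<in> Z" for c x d
    using that j_inj by (simp add: F_def)
  have add1: "elem_matrix (c + c') x d = elem_matrix c x d + elem_matrix c' x d"
    if "c \<in> acarrier C" "c' \<in> acarrier C" for c c' x d
    using that by (auto intro!: ext simp: elem_matrix_def left.coord_add distrib_left act_simps)
  have add2: "elem_matrix c (x + x') d = elem_matrix c x d + elem_matrix c x' d" for c x x' d
    by (auto intro!: ext simp: elem_matrix_def act_simps)
  have add3: "elem_matrix c x (d + d') = elem_matrix c x d + elem_matrix c x d'"
    if "d \<in> acarrier D" "d' \<in> acarrier D" for c x d d'
    using that by (auto intro!: ext simp: elem_matrix_def right.coord_add Defs.star_add act_simps)
  have scale1: "elem_matrix (r *\<^sub>C c) x d = r *\<^sub>C elem_matrix c x d" if "c \<in> acarrier C" for c x d r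
    using that by (auto intro!: ext simp: elem_matrix_def left.coord_scale mult_scaleC_right act_simps scaleC_apply)
  have scale2: "elem_matrix c (r *\<^sub>C x) d = r *\<^sub>C elem_matrix c x d" for c x d r
    by (auto intro!: ext simp: elem_matrix_def act_simps scaleC_apply)
  have scale3: "elem_matrix c x (r *\<^sub>C d) = cnj r *\<^sub>C elem_matrix c x d" if "d \<in> acarrier D" for c x d r
    using that by (auto intro!: ext simp: elem_matrix_def right.coord_scale star_scaleC act_simps scaleC_apply)
  have bal1: "elem_matrix (amul C c (\<iota> a)) x d = elem_matrix c (lact Y a x) d"
    if "c \<in> acarrier C" "a \<in> K" for c x d a
    using that by (auto intro!: ext simp: elem_matrix_def left.coord_right lact_mult ract_lact)
  have bal2: "elem_matrix c (ract Y x b) d = elem_matrix c x (amul D d (\<kappa> (star b)))"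
    if "d \<in> acarrier D" "b \<in> L" for c x d b
    using that by (auto intro!: ext simp: elem_matrix_def right.coord_right right.star_K star_mult star_star ract_mult)
  have "(\<lambda>c x d. l (F c x d)) \<in> balanced_forms data" if l: "clinear l" for l
    unfolding balanced_iff
    by (simp add: F Z_rules lact_Z ract_Z add1 add2 add3 scale1 scale2 scale3 bal1 bal2
        clinear_add[OF l] clinear_scale[OF l] scaleC_complex_def)
  then obtain f where f: "clinear f" "\<And>c x d. f (tensor data c x d) = F c x d"
    using balanced_extension by blast
  define f' where "f' t = (\<lambda>i l. if i < k \<and> l < k then P (f t i l) else 0)" for t
  have "clinear f'"
    by (auto intro!: ext simp: clinear_iff f'_def clinear_add[OF f(1)] clinear_scale[OF f(1)]
        clinear_add[OF P_linear] clinear_scale[OF P_linear] scaleC_apply)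
  moreover have "f' t \<in> mat_carrier k Z" for t by (simp add: mat_carrier_def f'_def P_Z)
  moreover have "f' (tens c x d) = elem_matrix c x d" if "c \<in> acarrier C" "x \<in> Z" "d \<in> acarrier D" for c x d
    using elem_matrix_closed[OF that]
    by (auto intro!: ext simp: f'_def f(2) F[OF that(2)] mat_carrier_def P_id)
  ultimately show thesis using that by blast
qed

definition coordinates :: "('c, 'd, 'z) tensor \<Rightarrow> nat \<Rightarrow> nat \<Rightarrow> 'y"
  where "coordinates = (SOME f. clinear f \<and> (\<forall>t. f t \<in> mat_carrier k Z) \<and>
    (\<forall>c\<in>acarrier C. \<forall>x\<in>Z. \<forall>d\<in>acarrier D. f (tens c x d) = elem_matrix c x d))"

lemma coordinates_linear: "clinear coordinates"
  and coordinates_closed: "coordinates t \<in> mat_carrier k Z"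
  and coordinates_tens: "\<lbrakk>c \<in> acarrier C; x \<in> Z; d \<in> acarrier D\<rbrakk> \<Longrightarrow> coordinates (tens c x d) = elem_matrix c x d"
proof -
  have "\<exists>f. clinear f \<and> (\<forall>t. f t \<in> mat_carrier k Z) \<and>
    (\<forall>c\<in>acarrier C. \<forall>x\<in>Z. \<forall>d\<in>acarrier D. f (tens c x d) = elem_matrix c x d)"
    using coordinates_exist by metis
  from someI_ex[OF this] show "clinear coordinates" "coordinates t \<in> mat_carrier k Z"
    "\<lbrakk>c \<in> acarrier C; x \<in> Z; d \<in> acarrier D\<rbrakk> \<Longrightarrow> coordinates (tens c x d) = elem_matrix c x d"
    by (fold coordinates_def) blast+
qed

definition from_matrix :: "(nat \<Rightarrow> nat \<Rightarrow> 'y) \<Rightarrow> ('c, 'd, 'z) tensor"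
  where "from_matrix M = (\<Sum>i<k. \<Sum>l<k. tens (u i) (lact Y \<sigma> (P (M i l))) (v l))"

lemma from_matrix_linear: "clinear from_matrix"
  by (simp add: clinear_iff from_matrix_def clinear_add[OF P_linear] clinear_scale[OF P_linear] act_simps
      tens_rules left.u_closed right.u_closed lact_Z left.\<sigma>_closed P_Z sum.distrib
      complex_vec.scale_sum_right scaleC_apply)

lemma from_matrix_closed: "from_matrix M \<in> cspan tensors"
  unfolding from_matrix_def tensors_def
  by (intro complex_vec.span_sum complex_vec.span_base)
    (use left.u_closed right.u_closed lact_Z[OF left.\<sigma>_closed P_Z] in blast)

text \<open>Moving the coordinates across the tensor signs reassembles \<open>c = \<Sum> u\<^sub>i c\<^sub>i\<close> and \<open>d = \<Sum> v\<^sub>l d\<^sub>l\<close>.\<close>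

lemma from_matrix_tens:
  assumes c: "c \<in> acarrier C" and x: "x \<in> Z" and d: "d \<in> acarrier D"
  shows "from_matrix (elem_matrix c x d) = tens c x d"
proof -
  have "tens (u i) (lact Y \<sigma> (P (elem_matrix c x d i l))) (v l) =
      tens (amul C (u i) (\<iota> (left.coord i c))) x (amul D (v l) (\<kappa> (right.coord l d)))"
    if "i < k" "l < k" for i l
  proof -
    have "elem_matrix c x d i l \<in> Z" using elem_matrix_closed[OF assms] that by (rule mat_carrierD)
    then have "lact Y \<sigma> (P (elem_matrix c x d i l)) =
        lact Y (left.coord i c) (ract Y x (star (right.coord l d)))"
      using that by (simp add: P_id elem_matrix_def left.\<sigma>_\<rho> flip: lact_mult mult.assoc)
    then show ?thesis
      using assms that
      by (simp add: tens_rules left.u_closed right.u_closed left.coord_closed right.coord_closed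
          ract_Z lact_Z right.star_K right.\<iota>_closed right.mul_closed ract_lact)
  qed
  then have "from_matrix (elem_matrix c x d) = (\<Sum>i<k. \<Sum>l<k.
      tens (amul C (u i) (\<iota> (left.coord i c))) x (amul D (v l) (\<kappa> (right.coord l d))))"
    by (simp add: from_matrix_def)
  also have "\<dots> = (\<Sum>i<k. tens (amul C (u i) (\<iota> (left.coord i c))) x d)"
  proof (rule sum.cong)
    fix i assume "i \<in> {..<k}"
    then have "amul C (u i) (\<iota> (left.coord i c)) \<in> acarrier C"
      using c by (simp add: left.mul_closed left.u_closed left.\<iota>_closed left.coord_closed)
    then have "(\<Sum>l<k. tens (amul C (u i) (\<iota> (left.coord i c))) x (amul D (v l) (\<kappa> (right.coord l d)))) =
        tens (amul C (u i) (\<iota> (left.coord i c))) x (\<Sum>l<k. amul D (v l) (\<kappa> (right.coord l d)))"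
      using x d by (intro tens_sum_right[symmetric])
        (auto intro!: right.mul_closed right.u_closed right.\<iota>_closed right.coord_closed)
    then show "(\<Sum>l<k. tens (amul C (u i) (\<iota> (left.coord i c))) x (amul D (v l) (\<kappa> (right.coord l d)))) =
        tens (amul C (u i) (\<iota> (left.coord i c))) x d"
      using d by (simp add: right.sum_coord)
  qed simp
  also have "\<dots> = tens (\<Sum>i<k. amul C (u i) (\<iota> (left.coord i c))) x d"
    using assms by (intro tens_sum_left[symmetric])
      (auto intro!: left.mul_closed left.u_closed left.\<iota>_closed left.coord_closed)
  finally show ?thesis using c by (simp add: left.sum_coord)
qed

lemma from_matrix_coordinates:
  assumes "t \<in> cspan tensors"
  shows "from_matrix (coordinates t) = t"
proof (rule clinear_eq_on_span[OF _ _ _ assms])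
  show "clinear (\<lambda>t. from_matrix (coordinates t))"
    by (rule clinear_comp[OF from_matrix_linear coordinates_linear])
  show "clinear (\<lambda>t::('c, 'd, 'z) tensor. t)" by (simp add: clinear_iff)
qed (auto simp: tensors_def coordinates_tens from_matrix_tens)

lemma coordinates_from_matrix:
  assumes M: "M \<in> mat_carrier k Z"
  shows "coordinates (from_matrix M) = ract matZ (lact matZ left.gram M) right.gram"
proof (intro ext)
  fix i l
  have star_q: "star (right.coord l (v m)) = right.gram m l" if "l < k" "m < k" for m
  proof -
    have "star (right.gram l m) = right.gram m l"
      using right.projection_gram unfolding projection_def right.matK_simps by metis
    then show ?thesis using that by (simp add: right.gram_def right.to_matrix_apply)
  qed
  show "coordinates (from_matrix M) i l = ract matZ (lact matZ left.gram M) right.gram i l"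
  proof (cases "i < k \<and> l < k")
    case True
    have "elem_matrix (u a) (lact Y \<sigma> (P (M a b))) (v b) i l = ract Y (lact Y (left.gram i a) (M a b)) (right.gram b l)"
      if "a < k" "b < k" for a b
    proof -
      have "elem_matrix (u a) (lact Y \<sigma> (P (M a b))) (v b) i l =
          ract Y (lact Y (\<rho> * left.coord i (u a) * \<sigma>) (M a b)) (star (right.coord l (v b)))"
        using True that M by (simp add: elem_matrix_def P_id mat_carrierD[OF M] ract_lact lact_mult)
      also have "\<rho> * left.coord i (u a) * \<sigma> = left.coord i (u a)"
        using True that left.\<sigma>_central[OF left.mult_K[OF left.\<rho>_closed left.coord_closed[OF _ left.u_closed]]]
        by (simp add: left.\<sigma>_\<rho> flip: mult.assoc)
      finally show ?thesis using True that by (simp add: star_q left.gram_def left.to_matrix_apply)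
    qed
    then have "coordinates (from_matrix M) i l =
        (\<Sum>a<k. \<Sum>b<k. ract Y (lact Y (left.gram i a) (M a b)) (right.gram b l))"
      by (simp add: from_matrix_def clinear_sum[OF coordinates_linear] coordinates_tens left.u_closed
          right.u_closed lact_Z left.\<sigma>_closed P_Z fun_sum_apply)
    also have "\<dots> = (\<Sum>b<k. \<Sum>a<k. ract Y (lact Y (left.gram i a) (M a b)) (right.gram b l))"
      by (rule sum.swap)
    finally show ?thesis by (simp add: matZ_simps act_sum)
  next
    case False
    then show ?thesis
      using coordinates_closed[of "from_matrix M"]
      by (auto simp: mat_carrier_def matZ_simps left.gram_def right.gram_def left.to_matrix_outside
          right.to_matrix_outside act_simps)
  qed
qed

lemma coordinates_bij: "bij_betw coordinates (cspan tensors) (bcarrier (corner_bimod matZ left.gram right.gram))"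
proof (rule bij_betw_byWitness[where f'=from_matrix])
  show "\<forall>t\<in>cspan tensors. from_matrix (coordinates t) = t" by (simp add: from_matrix_coordinates)
  show "\<forall>M\<in>bcarrier (corner_bimod matZ left.gram right.gram). coordinates (from_matrix M) = M"
    using coordinates_from_matrix from_matrix_coordinates[OF from_matrix_closed]
    by (auto simp: corner_bimod_def matZ_simps(1)) metis
  show "coordinates ` cspan tensors \<subseteq> bcarrier (corner_bimod matZ left.gram right.gram)"
    using coordinates_from_matrix[OF coordinates_closed] from_matrix_coordinates coordinates_closed
    by (auto simp: corner_bimod_def matZ_simps(1)) metis
  show "from_matrix ` bcarrier (corner_bimod matZ left.gram right.gram) \<subseteq> cspan tensors"
    using from_matrix_closed by blast
qed

lemma bcarrier_upward: "bcarrier Y1 = cspan tensors"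
proof -
  have "{tensor data c x d | c x d. c \<in> acarrier C \<and> x \<in> j ` Z \<and> d \<in> acarrier D} = tensors"
    by (auto simp: tensors_def)
  then show ?thesis by (simp add: upward_bimod_def Let_def data_simps range_g)
qed

lemma matZ_act_linear: "clinear (lact matZ M)" "clinear (\<lambda>N. ract matZ N M')"
  by (auto simp: clinear_iff matZ_simps act_simps sum.distrib scaleC_apply complex_vec.scale_sum_right
      intro!: ext)

lemma matZ_ip_linear: "clinear (\<lambda>N. lip matZ N N')" "conj_linear (lip matZ N)"
  "clinear (rip matZ N)" "conj_linear (\<lambda>N. rip matZ N N')"
  by (auto simp: clinear_iff conj_linear_def matZ_simps ip_simps sum.distrib scaleC_apply
      complex_vec.scale_sum_right intro!: ext)

lemma lact_elem_matrix:
  assumes T: "left.right_linear T" and c: "c \<in> acarrier C"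
  shows "lact matZ (left.to_matrix T) (elem_matrix c x d) = elem_matrix (T c) x d"
proof (intro ext)
  fix i l
  show "lact matZ (left.to_matrix T) (elem_matrix c x d) i l = elem_matrix (T c) x d i l"
  proof (cases "i < k \<and> l < k")
    case True
    have "left.to_matrix T i m * (\<rho> * left.coord m c) = \<rho> * (left.to_matrix T i m * left.coord m c)"
      if "m < k" for m
      using left.\<rho>_central[OF mat_carrierD[OF left.to_matrix_closed[OF T]], of i m] True that
      by (simp flip: mult.assoc)
    then show ?thesis
      using True
      by (simp add: matZ_simps elem_matrix_def left.coord_image[OF T c] sum_distrib_left act_sum flip: lact_mult)
  next
    case False
    then show ?thesis by (auto simp: matZ_simps elem_matrix_def left.to_matrix_outside act_simps)
  qed
qed

lemma ract_elem_matrix: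
  assumes T: "right.right_linear T" and T': "right.adjoint_of T T'" and d: "d \<in> acarrier D"
  shows "ract matZ (elem_matrix c x d) (right.to_matrix T) = elem_matrix c x (T' d)"
proof (intro ext)
  have rl: "right.right_linear T'" using T' by (simp add: right.adjoint_of_def right.basic_carrier_iff)
  fix i l
  show "ract matZ (elem_matrix c x d) (right.to_matrix T) i l = elem_matrix c x (T' d) i l"
  proof (cases "i < k \<and> l < k")
    case True
    have "star (right.to_matrix T' l m * right.coord m d) = star (right.coord m d) * right.to_matrix T m l"
      if "m < k" for m
      by (simp add: right.to_matrix_adjoint[OF T T'] right.matK_simps star_mult star_star)
    then show ?thesis
      using True
      by (simp add: matZ_simps elem_matrix_def right.coord_image[OF rl d] star_sum act_sum ract_lact
          flip: ract_mult)
  next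
    case False
    then show ?thesis by (auto simp: matZ_simps elem_matrix_def right.to_matrix_outside act_simps)
  qed
qed

text \<open>
  A linear map with the prescribed values on elementary tensors exists, since matrix
  multiplication in coordinates is one; so the map selected in \<open>upward_bimod\<close> has these values. The
  right action and the inner products are handled in the same way.
\<close>

lemma lact_upward:
  assumes T: "T \<in> acarrier left.basic"
  shows "clinear (lact Y1 T)"
    "\<lbrakk>c \<in> acarrier C; x \<in> Z; d \<in> acarrier D\<rbrakk> \<Longrightarrow> lact Y1 T (tens c x d) = tens (T c) x d"
proof -
  let ?Q = "\<lambda>L. clinear L \<and> (\<forall>c\<in>acarrier C. \<forall>x\<in>j ` Z. \<forall>d\<in>acarrier D.
    L (tensor data c x d) = tensor data (T c) x d)"
  have T': "left.right_linear T" using T by (simp add: left.basic_carrier_iff)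
  have "?Q (\<lambda>t. from_matrix (lact matZ (left.to_matrix T) (coordinates t)))"
    using clinear_comp[OF from_matrix_linear clinear_comp[OF matZ_act_linear(1) coordinates_linear]]
    by (simp add: coordinates_tens lact_elem_matrix[OF T'] from_matrix_tens left.right_linearD(2)[OF T'])
  then have "?Q (SOME L. ?Q L)" by (rule someI[of ?Q])
  moreover have "lact Y1 T = (SOME L. ?Q L)"
    unfolding upward_bimod_def Let_def data_simps range_g by (simp only: bimod.select_convs)
  ultimately show "clinear (lact Y1 T)"
    "\<lbrakk>c \<in> acarrier C; x \<in> Z; d \<in> acarrier D\<rbrakk> \<Longrightarrow> lact Y1 T (tens c x d) = tens (T c) x d"
    by auto
qed

lemma ract_upward:
  assumes T: "T \<in> acarrier right.basic"
  shows "clinear (\<lambda>t. ract Y1 t T)"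
    "\<lbrakk>c \<in> acarrier C; x \<in> Z; d \<in> acarrier D\<rbrakk> \<Longrightarrow>
      ract Y1 (tens c x d) T = tens c x (astar right.basic T d)"
proof -
  let ?Q = "\<lambda>L. clinear L \<and> (\<forall>c\<in>acarrier C. \<forall>x\<in>j ` Z. \<forall>d\<in>acarrier D.
    L (tensor data c x d) = tensor data c x (astar right.basic T d))"
  have T': "right.right_linear T" using T by (simp add: right.basic_carrier_iff)
  have adj: "right.adjoint_of T (astar right.basic T)" using T by (rule right.adjoint_of_astar)
  then have S: "right.right_linear (astar right.basic T)" by (simp add: right.adjoint_of_def right.basic_carrier_iff)
  have "?Q (\<lambda>t. from_matrix (ract matZ (coordinates t) (right.to_matrix T)))"
    using clinear_comp[OF from_matrix_linear clinear_comp[OF matZ_act_linear(2) coordinates_linear]]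
    by (simp add: coordinates_tens ract_elem_matrix[OF T' adj] from_matrix_tens right.right_linearD(2)[OF S])
  then have Q: "?Q (SOME L. ?Q L)" by (rule someI[of ?Q])
  have G: "(\<lambda>t. ract Y1 t T) = (SOME L. ?Q L)"
    unfolding upward_bimod_def Let_def data_simps range_g by (simp only: bimod.select_convs)
  have "?Q (\<lambda>t. ract Y1 t T)" using Q unfolding G[symmetric] by simp
  then show "clinear (\<lambda>t. ract Y1 t T)"
    "\<lbrakk>c \<in> acarrier C; x \<in> Z; d \<in> acarrier D\<rbrakk> \<Longrightarrow>
      ract Y1 (tens c x d) T = tens c x (astar right.basic T d)"
    by blast+
qed

lemma coordinates_lact:
  assumes T: "T \<in> acarrier left.basic" and t: "t \<in> cspan tensors"
  shows "coordinates (lact Y1 T t) = lact matZ (left.to_matrix T) (coordinates t)"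
proof (rule clinear_eq_on_span[OF _ _ _ t])
  show "clinear (\<lambda>t. coordinates (lact Y1 T t))"
    "clinear (\<lambda>t. lact matZ (left.to_matrix T) (coordinates t))"
    by (intro clinear_comp[OF coordinates_linear] clinear_comp[OF matZ_act_linear(1)] lact_upward(1)[OF T]
        coordinates_linear)+
  have T': "left.right_linear T" using T by (simp add: left.basic_carrier_iff)
  then show "coordinates (lact Y1 T x) = lact matZ (left.to_matrix T) (coordinates x)"
    if "x \<in> tensors" for x
    using that by (auto simp: tensors_def lact_upward(2)[OF T] coordinates_tens lact_elem_matrix left.right_linearD(2))
qed

lemma coordinates_ract:
  assumes T: "T \<in> acarrier right.basic" and t: "t \<in> cspan tensors"
  shows "coordinates (ract Y1 t T) = ract matZ (coordinates t) (right.to_matrix T)"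
proof (rule clinear_eq_on_span[OF _ _ _ t])
  show "clinear (\<lambda>t. coordinates (ract Y1 t T))"
    "clinear (\<lambda>t. ract matZ (coordinates t) (right.to_matrix T))"
    by (intro clinear_comp[OF coordinates_linear] clinear_comp[OF matZ_act_linear(2)] ract_upward(1)[OF T]
        coordinates_linear)+
  have T': "right.right_linear T" using T by (simp add: right.basic_carrier_iff)
  have adj: "right.adjoint_of T (astar right.basic T)" using T by (rule right.adjoint_of_astar)
  then have S: "right.right_linear (astar right.basic T)" by (simp add: right.adjoint_of_def right.basic_carrier_iff)
  show "coordinates (ract Y1 x T) = ract matZ (coordinates x) (right.to_matrix T)"
    if "x \<in> tensors" for x
    using that by (auto simp: tensors_def ract_upward(2)[OF T] coordinates_tens ract_elem_matrix[OF T' adj]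
        right.right_linearD(2)[OF S])
qed


text \<open>
  With \<open>s = \<Sum> d\<^sub>m\<^sup>* d'\<^sub>m\<close> both sides have the entries \<open>c\<^sub>i \<rho> \<langle>x s, x'\<rangle> \<rho> c'\<^sub>l\<^sup>*\<close>: on the right one \<open>\<rho>\<close>
  belongs to the inner product of \<open>C\<close>, and the other arises from \<open>x \<rho>' = \<rho> x\<close>.
\<close>

lemma lip_elem_matrix:
  assumes c: "c \<in> acarrier C" "c' \<in> acarrier C" and x: "x \<in> Z" "x' \<in> Z" and d: "d \<in> acarrier D" "d' \<in> acarrier D"
  shows "lip matZ (elem_matrix c x d) (elem_matrix c' x' d') =
    left.to_matrix (left.jones (left_value c x d x' d') (astar C c'))"
proof (intro ext)
  let ?b = "\<zeta> (amul D (astar D d) d')" and ?s = "\<Sum>m<k. star (right.coord m d) * right.coord m d'"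
  have b: "?b \<in> L" using d by (simp add: right.\<eta>_closed right.mul_closed right.astar_closed)
  have b2: "?b = \<rho>' * ?s" using d by (rule right.inner_coord)
  let ?a = "lip Y (ract Y x ?b) x'" and ?h = "lip Y (ract Y x ?s) x'"
  have s: "?s \<in> L" using d by (intro right.sum_K right.mult_K right.star_K right.coord_closed)
  have aK: "?a \<in> K" "?h \<in> K" using x b s by (auto intro!: lip_Z ract_Z)
  have a: "?a = \<rho> * ?h"
    using x by (simp add: b2 ract_mult \<rho>_act[symmetric] ract_lact lip_lact)
  have W: "lip W (ract W (j x) ((\<kappa> \<circ> \<zeta>) (amul D (astar D d) d'))) (j x') = \<iota> ?a"
    using x b by (simp add: ract_j lip_j ract_Z)
  fix i l
  show "lip matZ (elem_matrix c x d) (elem_matrix c' x' d') i l =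
    left.to_matrix (left.jones (left_value c x d x' d') (astar C c')) i l"
  proof (cases "i < k \<and> l < k")
    case True
    then have il: "i < k" "l < k" by auto
    let ?e = "left.coord i c" and ?e' = "left.coord l c'"
    have e: "?e \<in> K" "?e' \<in> K" using c il by (simp_all add: left.coord_closed)
    have "lip matZ (elem_matrix c x d) (elem_matrix c' x' d') i l =
        (\<Sum>m<k. \<rho> * ?e * lip Y (ract Y x (star (right.coord m d))) (ract Y x' (star (right.coord m d'))) * (star ?e' * \<rho>))"
      using il by (simp add: matZ_simps elem_matrix_def lip_lact lip_lact_right star_mult left.star_\<rho> mult.assoc)
    also have "\<dots> = \<rho> * ?e * (\<Sum>m<k. lip Y (ract Y x (star (right.coord m d) * right.coord m d')) x') * (star ?e' * \<rho>)"
      by (simp add: sum_distrib_left sum_distrib_right ract_mult lip_ract star_star)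
    also have "\<dots> = \<rho> * ?e * ?h * (star ?e' * \<rho>)"
      by (simp add: act_sum ip_sum)
    also have "\<rho> * ?e = ?e * \<rho>" using left.\<rho>_central[OF e(1)] by simp
    also have "star ?e' * \<rho> = \<rho> * star ?e'" using left.\<rho>_central[OF left.star_K[OF e(2)]] .
    also have "?e * \<rho> * ?h * (\<rho> * star ?e') = ?e * ?a * \<rho> * star ?e'"
      unfolding a by (simp only: mult.assoc)
    also have "\<dots> = left.to_matrix (left.jones (amul C c (\<iota> ?a)) (astar C c')) i l"
      using c il aK by (simp add: left.to_matrix_jones_elem left.mul_closed left.\<iota>_closed left.coord_right)
    finally show ?thesis by (simp only: W)
  next
    case False
    then show ?thesis
      by (auto simp: matZ_simps elem_matrix_def left.to_matrix_outside lip_zero_right ip_simps)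
  qed
qed

lemma rip_elem_matrix:
  assumes c: "c \<in> acarrier C" "c' \<in> acarrier C" and x: "x \<in> Z" "x' \<in> Z" and d: "d \<in> acarrier D" "d' \<in> acarrier D"
  shows "rip matZ (elem_matrix c x d) (elem_matrix c' x' d') =
    right.to_matrix (right.jones d (right_value c x c' x' d'))"
proof (intro ext)
  let ?a = "\<eta> (amul C (astar C c) c')" and ?s = "\<Sum>m<k. star (left.coord m c) * left.coord m c'"
  have a: "?a \<in> K" using c by (simp add: left.\<eta>_closed left.mul_closed left.astar_closed)
  have a2: "?a = \<rho> * ?s" using c by (rule left.inner_coord)
  let ?b = "rip Y x (lact Y ?a x')"
  have s: "?s \<in> K" using c by (intro left.sum_K left.mult_K left.star_K left.coord_closed)
  have b: "?b \<in> L" using x a by (auto intro!: rip_Z lact_Z)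
  have W: "right_value c x c' x' d' =
      astar D (amul D d' (\<kappa> (star ?b)))"
    using x a b d by (simp add: lact_j rip_j lact_Z right.astar_mul right.\<iota>_closed right.star_K right.\<iota>_star[symmetric] star_star)
  fix i l
  show "rip matZ (elem_matrix c x d) (elem_matrix c' x' d') i l =
    right.to_matrix (right.jones d (right_value c x c' x' d')) i l"
  proof (cases "i < k \<and> l < k")
    case True
    then have il: "i < k" "l < k" by auto
    let ?f = "right.coord i d" and ?f' = "right.coord l d'"
    have e: "left.coord m c \<in> K" "left.coord m c' \<in> K" if "m < k" for m
      using c that by (simp_all add: left.coord_closed)
    have "rip matZ (elem_matrix c x d) (elem_matrix c' x' d') i l =
        (\<Sum>m<k. ?f * rip Y (lact Y (\<rho> * left.coord m c) x) (lact Y (\<rho> * left.coord m c') x') * star ?f')"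
      using il by (simp add: matZ_simps elem_matrix_def rip_ract rip_ract_left star_star mult.assoc flip: ract_lact)
    also have "\<dots> = (\<Sum>m<k. ?f * rip Y x (lact Y (\<rho> * (\<rho> * (star (left.coord m c) * left.coord m c'))) x') * star ?f')"
    proof (intro sum.cong refl)
      fix m assume "m \<in> {..<k}"
      then have "star (\<rho> * left.coord m c) * (\<rho> * left.coord m c') = \<rho> * (\<rho> * (star (left.coord m c) * left.coord m c'))"
        using e left.\<rho>_central left.star_K by (simp add: star_mult left.star_\<rho>) (metis mult.assoc)
      then show "?f * rip Y (lact Y (\<rho> * left.coord m c) x) (lact Y (\<rho> * left.coord m c') x') * star ?f' =
          ?f * rip Y x (lact Y (\<rho> * (\<rho> * (star (left.coord m c) * left.coord m c'))) x') * star ?f'"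
        by (simp only: rip_lact lact_mult[symmetric])
    qed
    also have "\<dots> = ?f * rip Y x (lact Y (\<rho> * ?a) x') * star ?f'"
      unfolding a2 by (simp add: sum_distrib_left sum_distrib_right act_sum ip_sum)
    also have "rip Y x (lact Y (\<rho> * ?a) x') = ?b * \<rho>'"
      using x a by (simp add: lact_mult \<rho>_act lact_Z rip_ract)
    also have "\<dots> = \<rho>' * ?b" using right.\<rho>_central b by simp
    also have "?f * (\<rho>' * ?b) * star ?f' = ?f * \<rho>' * star (?f' * star ?b)"
      by (simp add: star_mult star_star mult.assoc)
    also have "\<dots> = right.to_matrix (right.jones d (astar D (amul D d' (\<kappa> (star ?b))))) i l"
      using d il b by (simp add: right.to_matrix_jones_elem right.mul_closed right.\<iota>_closed right.star_K right.coord_right)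
    finally show ?thesis by (simp only: W)
  next
    case False
    then show ?thesis
      by (auto simp: matZ_simps elem_matrix_def right.to_matrix_outside rip_zero_left ip_simps)
  qed
qed

lemma lip_matZ_closed: "M \<in> mat_carrier k Z \<Longrightarrow> N \<in> mat_carrier k Z \<Longrightarrow> lip matZ M N \<in> mat_carrier k K"
  by (auto simp: mat_carrier_def matZ_simps clinear_zero[OF lip_linear] lip_zero_right
      intro!: left.sum_K lip_Z)

lemma rip_matZ_closed: "M \<in> mat_carrier k Z \<Longrightarrow> N \<in> mat_carrier k Z \<Longrightarrow> rip matZ M N \<in> mat_carrier k L"
  by (auto simp: mat_carrier_def matZ_simps clinear_zero[OF rip_linear] rip_zero_left
      intro!: right.sum_K rip_Z)

lemma middle_closed:
  assumes "c \<in> acarrier C" "c' \<in> acarrier C" "x \<in> Z" "x' \<in> Z" "d \<in> acarrier D" "d' \<in> acarrier D"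
  shows "left_value c x d x' d' \<in> acarrier C"
    and "right_value c x c' x' d' \<in> acarrier D"
  using assms
  by (simp_all add: ract_j lact_j lip_j rip_j ract_Z lact_Z left.\<eta>_closed right.\<eta>_closed left.mul_closed
      right.mul_closed left.astar_closed right.astar_closed left.\<iota>_closed right.\<iota>_closed lip_Z rip_Z)

lemma coordinates_lip:
  assumes "s \<in> cspan tensors" "t \<in> cspan tensors"
  shows "lip matZ (coordinates s) (coordinates t) = left.to_matrix (lip Y1 s t)"
    and "lip Y1 s t = left.of_matrix (lip matZ (coordinates s) (coordinates t))"
proof -
  let ?H = "\<lambda>s t. left.of_matrix (lip matZ (coordinates s) (coordinates t))"
  let ?Q = "\<lambda>G. (\<forall>t. clinear (\<lambda>s. G s t)) \<and> (\<forall>s. conj_linear (\<lambda>t. G s t)) \<and>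
    (\<forall>c\<in>acarrier C. \<forall>x\<in>j ` Z. \<forall>d\<in>acarrier D. \<forall>c'\<in>acarrier C. \<forall>x'\<in>j ` Z. \<forall>d'\<in>acarrier D.
      G (tensor data c x d) (tensor data c' x' d') =
        left.jones (amul C c (lip W (ract W x ((\<kappa> \<circ> \<zeta>) (amul D (astar D d) d'))) x')) (astar C c'))"
  note closed = lip_matZ_closed[OF coordinates_closed coordinates_closed]
  have H1: "clinear (\<lambda>s. ?H s t)" and H2: "conj_linear (?H s)" for s t
    using closed
    by (auto simp: clinear_iff conj_linear_def clinear_add[OF coordinates_linear] clinear_scale[OF coordinates_linear]
        clinear_add[OF matZ_ip_linear(1)] clinear_scale[OF matZ_ip_linear(1)]
        matZ_ip_linear(2)[unfolded conj_linear_def] left.of_matrix_add left.of_matrix_scale)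
  have H3: "lip matZ (coordinates (tens c x d)) (coordinates (tens c' x' d')) = left.to_matrix (left.jones (left_value c x d x' d') (astar C c'))"
    if "c \<in> acarrier C" "c' \<in> acarrier C" "x \<in> Z" "x' \<in> Z" "d \<in> acarrier D" "d' \<in> acarrier D" for c c' x x' d d'
    using that by (simp add: coordinates_tens lip_elem_matrix)
  have H4: "?H (tens c x d) (tens c' x' d') = left.jones (left_value c x d x' d') (astar C c')"
    if "c \<in> acarrier C" "c' \<in> acarrier C" "x \<in> Z" "x' \<in> Z" "d \<in> acarrier D" "d' \<in> acarrier D" for c c' x x' d d'
    unfolding H3[OF that] using that middle_closed[OF that]
    by (intro left.of_matrix_to_matrix left.right_linear_jones_elem left.astar_closed)
  have Q': "?Q ?H" using H1 H2 H4 by simp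
  have G: "lip Y1 = (SOME G. ?Q G)"
    unfolding upward_bimod_def Let_def data_simps range_g by (simp only: bimod.select_convs)
  have Q: "?Q (lip Y1)" unfolding G by (rule someI[of ?Q, OF Q'])
  have eq: "lip Y1 s t = ?H s t"
  proof (rule sesquilinear_eq_on_span[OF _ _ H1 H2 _ assms])
    show "lip Y1 s t = ?H s t" if "s \<in> tensors" "t \<in> tensors" for s t
      using that Q H4 by (auto simp: tensors_def)
  qed (use Q in blast)+
  have "lip matZ (coordinates s) (coordinates t) = left.to_matrix (?H s t)"
  proof (rule sesquilinear_eq_on_span[OF _ _ _ _ _ assms, where G="\<lambda>s t. lip matZ (coordinates s) (coordinates t)"
        and H="\<lambda>s t. left.to_matrix (?H s t)"])
    show "clinear (\<lambda>s. lip matZ (coordinates s) (coordinates t))" for t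
      by (rule clinear_comp[OF matZ_ip_linear(1) coordinates_linear])
    show "conj_linear (\<lambda>t. lip matZ (coordinates s) (coordinates t))" for s
      using matZ_ip_linear(2) coordinates_linear by (simp add: conj_linear_def clinear_iff)
    show "clinear (\<lambda>s. left.to_matrix (?H s t))" for t
      using H1[of t] closed by (simp add: clinear_iff left.to_matrix_add left.to_matrix_scale left.right_linear_of_matrix)
    show "conj_linear (\<lambda>t. left.to_matrix (?H s t))" for s
      using H2[of s] closed by (simp add: conj_linear_def left.to_matrix_add left.to_matrix_scale left.right_linear_of_matrix)
    show "lip matZ (coordinates s) (coordinates t) = left.to_matrix (?H s t)" if "s \<in> tensors" "t \<in> tensors" for s t
      using that H3 H4 by (auto simp: tensors_def)
  qed
  then show "lip matZ (coordinates s) (coordinates t) = left.to_matrix (lip Y1 s t)"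
    "lip Y1 s t = ?H s t"
    by (simp_all only: eq)
qed

lemma coordinates_rip:
  assumes "s \<in> cspan tensors" "t \<in> cspan tensors"
  shows "rip matZ (coordinates s) (coordinates t) = right.to_matrix (rip Y1 s t)"
    and "rip Y1 s t = right.of_matrix (rip matZ (coordinates s) (coordinates t))"
proof -
  let ?H = "\<lambda>s t. right.of_matrix (rip matZ (coordinates s) (coordinates t))"
  let ?Q = "\<lambda>G. (\<forall>t. conj_linear (\<lambda>s. G s t)) \<and> (\<forall>s. clinear (\<lambda>t. G s t)) \<and>
    (\<forall>c\<in>acarrier C. \<forall>x\<in>j ` Z. \<forall>d\<in>acarrier D. \<forall>c'\<in>acarrier C. \<forall>x'\<in>j ` Z. \<forall>d'\<in>acarrier D.
      G (tensor data c x d) (tensor data c' x' d') =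
        right.jones d (amul D (rip W x (lact W ((\<iota> \<circ> \<eta>) (amul C (astar C c) c')) x')) (astar D d')))"
  note closed = rip_matZ_closed[OF coordinates_closed coordinates_closed]
  have H1: "clinear (?H s)" and H2: "conj_linear (\<lambda>s. ?H s t)" for s t
    using closed
    by (auto simp: clinear_iff conj_linear_def clinear_add[OF coordinates_linear] clinear_scale[OF coordinates_linear]
        clinear_add[OF matZ_ip_linear(3)] clinear_scale[OF matZ_ip_linear(3)]
        matZ_ip_linear(4)[unfolded conj_linear_def] right.of_matrix_add right.of_matrix_scale)
  have H3: "rip matZ (coordinates (tens c x d)) (coordinates (tens c' x' d')) = right.to_matrix (right.jones d (right_value c x c' x' d'))"
    if "c \<in> acarrier C" "c' \<in> acarrier C" "x \<in> Z" "x' \<in> Z" "d \<in> acarrier D" "d' \<in> acarrier D" for c c' x x' d d'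
    using that by (simp add: coordinates_tens rip_elem_matrix)
  have H4: "?H (tens c x d) (tens c' x' d') = right.jones d (right_value c x c' x' d')"
    if "c \<in> acarrier C" "c' \<in> acarrier C" "x \<in> Z" "x' \<in> Z" "d \<in> acarrier D" "d' \<in> acarrier D" for c c' x x' d d'
    unfolding H3[OF that] using that middle_closed[OF that]
    by (intro right.of_matrix_to_matrix right.right_linear_jones_elem)
  have Q': "?Q ?H" using H1 H2 H4 by simp
  have G: "rip Y1 = (SOME G. ?Q G)"
    unfolding upward_bimod_def Let_def data_simps range_g by (simp only: bimod.select_convs)
  have Q: "?Q (rip Y1)" unfolding G by (rule someI[of ?Q, OF Q'])
  have eq: "rip Y1 s t = ?H s t"
  proof (rule sesquilinear_eq_on_span[of "\<lambda>t s. rip Y1 s t" "\<lambda>t s. ?H s t", OF _ _ H1 H2 _ assms(2,1)])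
    show "rip Y1 s t = ?H s t" if "t \<in> tensors" "s \<in> tensors" for s t
      using that Q H4 by (auto simp: tensors_def)
  qed (use Q in blast)+
  have "rip matZ (coordinates s) (coordinates t) = right.to_matrix (?H s t)"
  proof (rule sesquilinear_eq_on_span[of "\<lambda>t s. rip matZ (coordinates s) (coordinates t)"
        "\<lambda>t s. right.to_matrix (?H s t)", OF _ _ _ _ _ assms(2,1)])
    show "clinear (\<lambda>t. rip matZ (coordinates s) (coordinates t))" for s
      by (rule clinear_comp[OF matZ_ip_linear(3) coordinates_linear])
    show "conj_linear (\<lambda>s. rip matZ (coordinates s) (coordinates t))" for t
      using matZ_ip_linear(4) coordinates_linear by (simp add: conj_linear_def clinear_iff)
    show "clinear (\<lambda>t. right.to_matrix (?H s t))" for s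
      using H1[of s] closed by (simp add: clinear_iff right.to_matrix_add right.to_matrix_scale right.right_linear_of_matrix)
    show "conj_linear (\<lambda>s. right.to_matrix (?H s t))" for t
      using H2[of t] closed by (simp add: conj_linear_def right.to_matrix_add right.to_matrix_scale right.right_linear_of_matrix)
    show "rip matZ (coordinates s) (coordinates t) = right.to_matrix (?H s t)" if "t \<in> tensors" "s \<in> tensors" for s t
      using that H3 H4 by (auto simp: tensors_def)
  qed
  then show "rip matZ (coordinates s) (coordinates t) = right.to_matrix (rip Y1 s t)"
    "rip Y1 s t = ?H s t"
    by (simp_all only: eq)
qed

lemma clinear_span_closed:
  assumes "clinear f" "\<And>x. x \<in> tensors \<Longrightarrow> f x \<in> cspan tensors" "t \<in> cspan tensors"
  shows "f t \<in> cspan tensors"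
proof -
  have "cspan tensors \<subseteq> {t. f t \<in> cspan tensors}"
    using assms(1,2)
    by (intro complex_vec.span_minimal complex_vec.subspaceI)
      (auto simp: clinear_zero clinear_add clinear_scale complex_vec.span_zero complex_vec.span_add complex_vec.span_scale)
  then show ?thesis using assms(3) by blast
qed

lemma lact_upward_closed:
  assumes T: "T \<in> acarrier left.basic" and t: "t \<in> cspan tensors"
  shows "lact Y1 T t \<in> cspan tensors"
proof (rule clinear_span_closed[OF lact_upward(1)[OF T] _ t])
  fix s assume "s \<in> tensors"
  then obtain c x d where s: "s = tens c x d" "c \<in> acarrier C" "x \<in> Z" "d \<in> acarrier D"
    unfolding tensors_def by blast
  have "T c \<in> acarrier C" using T s by (simp add: left.basic_carrier_iff left.right_linearD(2))
  then show "lact Y1 T s \<in> cspan tensors"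
    using s by (simp add: lact_upward(2)[OF T]) (auto simp: tensors_def intro!: complex_vec.span_base)
qed

lemma ract_upward_closed:
  assumes T: "T \<in> acarrier right.basic" and t: "t \<in> cspan tensors"
  shows "ract Y1 t T \<in> cspan tensors"
proof (rule clinear_span_closed[OF ract_upward(1)[OF T] _ t])
  fix s assume "s \<in> tensors"
  then obtain c x d where s: "s = tens c x d" "c \<in> acarrier C" "x \<in> Z" "d \<in> acarrier D"
    unfolding tensors_def by blast
  have "astar right.basic T d \<in> acarrier D"
    using star_algebra.astar_closed[OF right.star_algebra_basic T] s
    by (simp add: right.basic_carrier_iff right.right_linearD(2))
  then show "ract Y1 s T \<in> cspan tensors"
    using s by (simp add: ract_upward(2)[OF T]) (auto simp: tensors_def intro!: complex_vec.span_base)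
qed

lemma coordinates_inj: "s \<in> cspan tensors \<Longrightarrow> t \<in> cspan tensors \<Longrightarrow> coordinates s = coordinates t \<Longrightarrow> s = t"
  by (metis from_matrix_coordinates)

theorem equivalence_bimodule_iso_coordinates:
  "equivalence_bimodule_iso left.basic right.basic left.to_matrix right.to_matrix coordinates
    Y1 (corner_bimod matZ left.gram right.gram)"
proof -
  have "lip (corner_bimod matZ left.gram right.gram) = lip matZ" "rip (corner_bimod matZ left.gram right.gram) = rip matZ"
    "lact (corner_bimod matZ left.gram right.gram) = lact matZ" "ract (corner_bimod matZ left.gram right.gram) = ract matZ"
    by (simp_all add: corner_bimod_def)
  then show ?thesis
    unfolding equivalence_bimodule_iso_def bcarrier_upward
    using coordinates_bij coordinates_lip(1) coordinates_rip(1) coordinates_lact coordinates_ract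
      clinear_add[OF coordinates_linear] clinear_scale[OF coordinates_linear]
    by auto
qed

lemma dual_expectation_eq:
  "dual_bimodule_expectation data = (SOME h. clinear h \<and> (\<forall>c\<in>acarrier C. \<forall>x\<in>j ` Z. \<forall>d\<in>acarrier D.
    h (tensor data c x d) = lact W (alg_inv C (index_W C (\<iota> \<circ> \<eta>))) (ract W (lact W c x) (astar D d))))"
  unfolding dual_bimodule_expectation_def Let_def data_simps range_g by (rule refl)

end

section \<open>Quasi-bases and the Watatani index\<close>

context star_algebra
begin

lemma quasi_basisD:
  assumes "quasi_basis C E n u"
  shows "i < n \<Longrightarrow> u i \<in> acarrier C"
    and "c \<in> acarrier C \<Longrightarrow> (\<Sum>i<n. amul C (u i) (E (amul C (astar C (u i)) c))) = c"
    and "c \<in> acarrier C \<Longrightarrow> (\<Sum>i<n. amul C (E (amul C c (u i))) (astar C (u i))) = c"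
  using assms unfolding quasi_basis_def by blast+

text \<open>The second expansion of a quasi-basis is the adjoint of the first.\<close>

lemma quasi_basisI:
  assumes u: "\<And>i. i < n \<Longrightarrow> u i \<in> acarrier C"
    and E: "\<And>x. x \<in> acarrier C \<Longrightarrow> E x \<in> acarrier C" "\<And>x. x \<in> acarrier C \<Longrightarrow> E (astar C x) = astar C (E x)"
    and exp: "\<And>c. c \<in> acarrier C \<Longrightarrow> (\<Sum>i<n. amul C (u i) (E (amul C (astar C (u i)) c))) = c"
  shows "quasi_basis C E n u"
  unfolding quasi_basis_def
proof (intro conjI allI ballI impI)
  fix c assume c: "c \<in> acarrier C"
  have "(\<Sum>i<n. amul C (E (amul C c (u i))) (astar C (u i))) =
      (\<Sum>i<n. astar C (amul C (u i) (E (amul C (astar C (u i)) (astar C c)))))"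
    using u c by (intro sum.cong refl)
      (simp add: astar_mul astar_astar E mul_closed astar_closed flip: E(2))
  also have "\<dots> = astar C (\<Sum>i<n. amul C (u i) (E (amul C (astar C (u i)) (astar C c))))"
    using u c by (intro astar_sum[symmetric]) (simp add: mul_closed E astar_closed)
  also have "\<dots> = c" using c by (simp add: exp astar_closed astar_astar)
  finally show "(\<Sum>i<n. amul C (E (amul C c (u i))) (astar C (u i))) = c" .
qed (use u exp in auto)

text \<open>
  Both sides equal \<open>\<Sum> u\<^sub>i E(u\<^sub>i\<^sup>* c w\<^sub>j) w\<^sub>j\<^sup>*\<close>. For \<open>c = 1\<close> this makes the index independent of the
  quasi-basis, and for \<open>w = u\<close> it makes the index central.
\<close>

lemma index_intertwines:
  assumes u: "quasi_basis C E n u" and w: "quasi_basis C E m w"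
    and E: "\<And>x. x \<in> acarrier C \<Longrightarrow> E x \<in> acarrier C" and c: "c \<in> acarrier C"
  shows "amul C (\<Sum>i<n. amul C (u i) (astar C (u i))) c = amul C c (\<Sum>i<m. amul C (w i) (astar C (w i)))"
proof -
  note uD = quasi_basisD[OF u] and wD = quasi_basisD[OF w]
  let ?M = "\<lambda>i j. E (amul C (amul C (astar C (u i)) c) (w j))"
  have M: "?M i j \<in> acarrier C" if "i < n" "j < m" for i j
    using that c uD wD by (simp add: E mul_closed astar_closed)
  have "amul C (\<Sum>i<n. amul C (u i) (astar C (u i))) c = (\<Sum>i<n. amul C (u i) (amul C (astar C (u i)) c))"
    using c uD by (simp add: mul_sum_left mul_closed astar_closed mul_assoc)
  also have "\<dots> = (\<Sum>i<n. amul C (u i) (\<Sum>j<m. amul C (?M i j) (astar C (w j))))"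
    using c uD wD by (intro sum.cong refl) (simp add: mul_closed astar_closed)
  also have "\<dots> = (\<Sum>i<n. \<Sum>j<m. amul C (u i) (amul C (?M i j) (astar C (w j))))"
    using uD wD M by (intro sum.cong refl mul_sum_right) (simp_all add: mul_closed astar_closed)
  also have "\<dots> = (\<Sum>j<m. \<Sum>i<n. amul C (amul C (u i) (?M i j)) (astar C (w j)))"
    using uD wD M by (subst sum.swap, intro sum.cong refl) (simp add: mul_assoc astar_closed)
  also have "\<dots> = (\<Sum>j<m. amul C (\<Sum>i<n. amul C (u i) (?M i j)) (astar C (w j)))"
    using uD wD M by (intro sum.cong refl mul_sum_left[symmetric]) (simp_all add: mul_closed astar_closed)
  also have "\<dots> = (\<Sum>j<m. amul C (amul C c (w j)) (astar C (w j)))"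
  proof (intro sum.cong refl)
    fix j assume "j \<in> {..<m}"
    then have j: "w j \<in> acarrier C" using wD by simp
    have "(\<Sum>i<n. amul C (u i) (?M i j)) = (\<Sum>i<n. amul C (u i) (E (amul C (astar C (u i)) (amul C c (w j)))))"
      using uD c j by (intro sum.cong refl) (simp add: mul_assoc astar_closed)
    also have "\<dots> = amul C c (w j)" using c j by (intro uD(2) mul_closed)
    finally show "amul C (\<Sum>i<n. amul C (u i) (?M i j)) (astar C (w j)) = amul C (amul C c (w j)) (astar C (w j))"
      by simp
  qed
  also have "\<dots> = amul C c (\<Sum>i<m. amul C (w i) (astar C (w i)))"
    using c wD by (simp add: mul_sum_right mul_closed astar_closed mul_assoc)
  finally show ?thesis .
qed

lemma index_W_eqI:
  assumes u: "quasi_basis C E n u" and E: "\<And>x. x \<in> acarrier C \<Longrightarrow> E x \<in> acarrier C"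
  shows "index_W C E = (\<Sum>i<n. amul C (u i) (astar C (u i)))"
  unfolding index_W_def
proof (rule the_equality)
  show "\<exists>n' u'. quasi_basis C E n' u' \<and> (\<Sum>i<n. amul C (u i) (astar C (u i))) = (\<Sum>i<n'. amul C (u' i) (astar C (u' i)))"
    using u by blast
  fix h assume "\<exists>m w. quasi_basis C E m w \<and> h = (\<Sum>i<m. amul C (w i) (astar C (w i)))"
  then obtain m w where w: "quasi_basis C E m w" "h = (\<Sum>i<m. amul C (w i) (astar C (w i)))" by blast
  have c: "(\<Sum>i<m. amul C (w i) (astar C (w i))) \<in> acarrier C" "(\<Sum>i<n. amul C (u i) (astar C (u i))) \<in> acarrier C"
    using quasi_basisD(1)[OF u] quasi_basisD(1)[OF w(1)] by (simp_all add: sum_closed mul_closed astar_closed)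
  show "h = (\<Sum>i<n. amul C (u i) (astar C (u i)))"
    using index_intertwines[OF u w(1) E one_closed] c w(2) by (simp add: one_left one_right)
qed

lemma alg_inv_eqI:
  assumes "h \<in> acarrier C" "g \<in> acarrier C" "amul C g h = aone C" "amul C h g = aone C"
  shows "alg_inv C h = g"
  unfolding alg_inv_def
proof (rule the_equality)
  fix g' assume g': "g' \<in> acarrier C \<and> amul C g' h = aone C \<and> amul C h g' = aone C"
  have "g' = amul C g' (amul C h g)" using assms g' by (simp only: one_right)
  also have "\<dots> = amul C (amul C g' h) g" using assms g' by (subst mul_assoc) simp_all
  also have "\<dots> = g" using assms g' by (simp add: one_left)
  finally show "g' = g" .
qed (use assms in blast)

end

lemma type_alg_simps [simp]:
  "acarrier type_alg = UNIV" "amul type_alg = (*)" "astar type_alg = star" "aone type_alg = 1"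
  by (simp_all add: type_alg_def)

lemma jones_elem_type_alg: "jones_elem type_alg E x y = (\<lambda>z. x * E (y * z))"
  by (auto simp: jones_elem_def left_mult_def jones_projection_def on_carrier_def)

lemma left_mult_type_alg: "left_mult type_alg x = (\<lambda>z. x * z)"
  by (simp add: left_mult_def on_carrier_def)

text \<open>Padding with zeros gives the two expectations frames of the same length.\<close>

lemma quasi_basis_pad:
  fixes E :: "'c::cstar_algebra \<Rightarrow> 'c"
  assumes "quasi_basis type_alg E n u" "n \<le> k"
  shows "quasi_basis type_alg E k (\<lambda>i. if i < n then u i else 0)"
proof -
  have pad: "(\<Sum>i<k. f i) = (\<Sum>i<n. f i)" if "\<And>i. i \<ge> n \<Longrightarrow> f i = 0" for f :: "nat \<Rightarrow> 'c"
    using assms(2) that by (intro sum.mono_neutral_right) auto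
  show ?thesis
    using assms(1) unfolding quasi_basis_def
    by (simp add: pad)
qed

section \<open>Conditional expectations of index-finite type\<close>

text \<open>
  \<open>E(c\<^sup>* c)\<close> is self-adjoint because it is positive. Polarising with \<open>1 + c\<close> and \<open>1 + i c\<close> gives the
  real and the imaginary part of the claim.
\<close>

lemma conditional_expectation_star:
  assumes "conditional_expectation A E"
  shows "E (star c) = star (E c)"
proof -
  have lin: "clinear E" and pos: "\<And>c. cstar_positive (E (star c * c))"
    using assms by (auto simp: conditional_expectation_def)
  have sa: "star (E (star c * c)) = E (star c * c)" for c
    using pos[of c] by (auto simp: cstar_positive_def star_mult star_star)
  have quad: "star (E (r *\<^sub>C c + cnj r *\<^sub>C star c)) = E (r *\<^sub>C c + cnj r *\<^sub>C star c)" for r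
  proof -
    have "star (1 + r *\<^sub>C c) * (1 + r *\<^sub>C c) = star 1 * 1 + (r *\<^sub>C c + cnj r *\<^sub>C star c) + star (r *\<^sub>C c) * (r *\<^sub>C c)"
      by (simp add: algebra_simps star_add star_scaleC)
    then show ?thesis
      using sa[of "1 + r *\<^sub>C c"] sa[of 1] sa[of "r *\<^sub>C c"]
      by (simp only: clinear_add[OF lin] star_add) simp
  qed
  have 1: "star (E c) + star (E (star c)) = E c + E (star c)"
    using quad[of 1] by (simp add: clinear_add[OF lin] star_add scaleC_one)
  have "\<i> *\<^sub>C star (E (star c)) - \<i> *\<^sub>C star (E c) = \<i> *\<^sub>C E c - \<i> *\<^sub>C E (star c)"
    using quad[of "\<i>"] by (simp add: clinear_diff[OF lin] clinear_scale[OF lin] star_diff star_scaleC)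
  then have "(- \<i>) *\<^sub>C (\<i> *\<^sub>C (star (E (star c)) - star (E c))) = (- \<i>) *\<^sub>C (\<i> *\<^sub>C (E c - E (star c)))"
    by (simp only: complex_vec.scale_right_diff_distrib)
  then have 2: "star (E (star c)) - star (E c) = E c - E (star c)"
    by (simp add: scaleC_scaleC scaleC_one)
  have "2 *\<^sub>R star (E c) = (star (E c) + star (E (star c))) - (star (E (star c)) - star (E c))"
    by (simp add: scaleR_2)
  also have "\<dots> = 2 *\<^sub>R E (star c)" unfolding 1 2 by (simp add: scaleR_2)
  finally have "2 *\<^sub>R star (E c) = 2 *\<^sub>R E (star c)" .
  then show ?thesis by simp
qed

locale finite_index =
  fixes A :: "'c::cstar_algebra set" and E :: "'c \<Rightarrow> 'c" and k :: nat and u :: "nat \<Rightarrow> 'c"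
  assumes subalgebra: "unital_cstar_subalgebra A"
    and expectation: "conditional_expectation A E"
    and quasi_basis: "quasi_basis type_alg E k u"
begin

abbreviation jones :: "'c \<Rightarrow> 'c \<Rightarrow> 'c \<Rightarrow> 'c"
  where "jones \<equiv> jones_elem type_alg E"

abbreviation lmult :: "'c \<Rightarrow> 'c \<Rightarrow> 'c"
  where "lmult \<equiv> left_mult type_alg"


sublocale alg: star_algebra "type_alg :: 'c star_alg"
  by (rule star_algebra_type_alg)

lemma A_rules: "csubspace A" "1 \<in> A" "a \<in> A \<Longrightarrow> b \<in> A \<Longrightarrow> a * b \<in> A" "a \<in> A \<Longrightarrow> star a \<in> A"
  using subalgebra by (auto simp: unital_cstar_subalgebra_def)

lemma E_linear: "clinear E" and E_closed: "E c \<in> A" and E_id: "a \<in> A \<Longrightarrow> E a = a"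
  and E_left: "a \<in> A \<Longrightarrow> E (a * c) = a * E c" and E_right: "a \<in> A \<Longrightarrow> E (c * a) = E c * a"
  and E_star: "E (star c) = star (E c)"
proof -
  have bim: "\<And>a b c. a \<in> A \<Longrightarrow> b \<in> A \<Longrightarrow> E (a * c * b) = a * E c * b"
    using expectation by (auto simp: conditional_expectation_def)
  show "a \<in> A \<Longrightarrow> E (a * c) = a * E c" "a \<in> A \<Longrightarrow> E (c * a) = E c * a"
    using bim[of a 1 c] bim[of 1 a c] A_rules(2) by simp_all
  show "clinear E" "E c \<in> A" "a \<in> A \<Longrightarrow> E a = a"
    using expectation by (auto simp: conditional_expectation_def)
  show "E (star c) = star (E c)" using expectation by (rule conditional_expectation_star)
qed

lemma expansion_left: "(\<Sum>i<k. u i * E (star (u i) * c)) = c"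
  and expansion_right: "(\<Sum>i<k. E (c * u i) * star (u i)) = c"
  using alg.quasi_basisD(2,3)[OF quasi_basis, of c] by simp_all

definition index :: 'c
  where "index = (\<Sum>i<k. u i * star (u i))"

lemma index_W: "index_W type_alg E = index"
  using alg.index_W_eqI[OF quasi_basis] by (simp add: index_def)

lemma index_central: "c * index = index * c"
  using alg.index_intertwines[OF quasi_basis quasi_basis, of c] by (simp add: index_def)

lemma star_index: "star index = index"
  by (simp add: index_def star_sum star_mult star_star)

text \<open>
  \<open>Ind - 1 = \<Sum> z\<^sub>i z\<^sub>i\<^sup>*\<close> with \<open>z\<^sub>i = u\<^sub>i - E(u\<^sub>i)\<close>; this is the image under \<open>x e y \<mapsto> x y\<close> of the
  projection \<open>1 - e\<close>.
\<close>

lemma index_unit: "unit_elem index"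
proof -
  let ?z = "\<lambda>i. u i - E (u i)"
  have e1: "(\<Sum>i<k. E (u i) * star (u i)) = 1" and e2: "(\<Sum>i<k. u i * E (star (u i))) = 1"
    using expansion_right[of 1] expansion_left[of 1] by simp_all
  have "(\<Sum>i<k. E (u i) * E (star (u i))) = E (\<Sum>i<k. u i * E (star (u i)))"
    by (simp add: clinear_sum[OF E_linear] E_right E_closed)
  then have e3: "(\<Sum>i<k. E (u i) * E (star (u i))) = 1" by (simp add: e2 E_id A_rules)
  have "(\<Sum>i<k. ?z i * star (?z i)) = index - (\<Sum>i<k. u i * E (star (u i)))
      - (\<Sum>i<k. E (u i) * star (u i)) + (\<Sum>i<k. E (u i) * E (star (u i)))"
    by (simp add: index_def star_diff E_star algebra_simps sum.distrib sum_subtractf)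
  then have "index = 1 + (\<Sum>i<k. ?z i * star (?z i))" by (simp add: e1 e2 e3)
  then show ?thesis using unit_elem_one_plus_sum[of ?z "{..<k}"] by simp
qed

definition index_inv :: 'c
  where "index_inv = (SOME g. index * g = 1 \<and> g * index = 1)"

lemma index_inv: "index * index_inv = 1" "index_inv * index = 1"
  using index_unit someI_ex[of "\<lambda>g. index * g = 1 \<and> g * index = 1"]
  unfolding unit_elem_def index_inv_def by blast+

lemma index_inv_central: "c * index_inv = index_inv * c"
proof -
  have "c * index_inv = index_inv * (index * c) * index_inv"
    by (simp add: index_inv flip: mult.assoc)
  also have "\<dots> = index_inv * c * (index * index_inv)"
    by (simp only: index_central[symmetric] mult.assoc)
  finally show ?thesis by (simp add: index_inv)
qed

lemma star_index_inv: "star index_inv = index_inv"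
proof -
  have "star index_inv * index = 1"
    using index_inv(1) star_mult[of index index_inv] by (simp add: star_index)
  then have "star index_inv * index * index_inv = index_inv" by simp
  then show ?thesis by (simp add: mult.assoc index_inv)
qed

lemma alg_inv_index: "alg_inv type_alg index = index_inv"
  by (rule alg.alg_inv_eqI) (simp_all add: index_inv)

text \<open>\<open>E\<close> fixes the inverse as well, by uniqueness of inverses.\<close>

lemma index_inv_closed:
  assumes "index \<in> A"
  shows "index_inv \<in> A"
proof -
  have "E index_inv * index = 1" using E_right[OF assms, of index_inv] by (simp add: index_inv E_id A_rules)
  then have "E index_inv * index * index_inv = index_inv" by simp
  then have "E index_inv = index_inv" by (simp add: mult.assoc index_inv)
  then show ?thesis using E_closed by metis
qed

sublocale first: frame "type_alg :: 'c star_alg" A id E 1 1 k u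
proof (intro frame.intro frame_axioms.intro alg.star_algebra_axioms)
  show "clinear (id :: 'c \<Rightarrow> 'c)" by (simp add: clinear_iff)
  show "clinear E" by (rule E_linear)
qed (simp_all add: A_rules E_closed E_id E_right E_star expansion_left)

abbreviation C1 :: "('c \<Rightarrow> 'c) star_alg"
  where "C1 \<equiv> basic_construction type_alg E"

abbreviation E1 :: "('c \<Rightarrow> 'c) \<Rightarrow> 'c"
  where "E1 \<equiv> dual_expectation type_alg E"

lemma C1_carrier: "acarrier C1 = cspan {jones x y | x y. True}"
  using first.acarrier_basic by simp

lemma C1_iff: "T \<in> acarrier C1 \<longleftrightarrow> first.right_linear T"
  using first.basic_carrier_iff by simp

lemma C1_eqI:
  assumes "clinear f" "clinear g" "\<And>x y. f (jones x y) = g (jones x y)"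
    "T \<in> acarrier C1"
  shows "f T = g T"
  by (rule clinear_eq_on_span[OF assms(1,2) _ assms(4)[unfolded C1_carrier]]) (use assms(3) in blast)

text \<open>
  The prescription \<open>x e y \<mapsto> Ind\<^sup>-\<^sup>1 x y\<close> extends to all operators by the linear formula
  \<open>T \<mapsto> \<Sum> Ind\<^sup>-\<^sup>1 T(u\<^sub>i) u\<^sub>i\<^sup>*\<close>, since \<open>\<Sum> E(y u\<^sub>i) u\<^sub>i\<^sup>* = y\<close>.
\<close>

lemma E1_linear: "clinear E1"
  and E1_jones: "E1 (jones x y) = index_inv * (x * y)"
proof -
  let ?Q = "\<lambda>L. clinear L \<and> (\<forall>x\<in>acarrier type_alg. \<forall>y\<in>acarrier type_alg.
    L (jones x y) = amul type_alg (alg_inv type_alg (index_W type_alg E)) (amul type_alg x y))"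
  have "clinear (\<lambda>T. \<Sum>i<k. index_inv * (T (u i) * star (u i)))"
    by (simp add: clinear_iff scaleC_fun_def distrib_left distrib_right sum.distrib mult_scaleC_left
        mult_scaleC_right complex_vec.scale_sum_right)
  moreover have "(\<Sum>i<k. index_inv * (x * E (y * u i) * star (u i))) = index_inv * (x * y)" for x y
    using expansion_right[of y] by (simp add: mult.assoc flip: sum_distrib_left)
  ultimately have "?Q (\<lambda>T. \<Sum>i<k. index_inv * (T (u i) * star (u i)))"
    by (simp add: index_W alg_inv_index jones_elem_type_alg)
  then have "?Q (SOME L. ?Q L)" by (rule someI[of ?Q])
  then have "?Q E1" unfolding dual_expectation_def .
  then show "clinear E1" "E1 (jones x y) = index_inv * (x * y)"
    by (simp_all add: index_W alg_inv_index)
qed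

lemma E1_eq: "T \<in> acarrier C1 \<Longrightarrow> E1 T = (\<Sum>i<k. index_inv * (T (u i) * star (u i)))"
proof (rule C1_eqI[OF E1_linear])
  show "clinear (\<lambda>T. \<Sum>i<k. index_inv * (T (u i) * star (u i)))"
    by (simp add: clinear_iff scaleC_fun_def distrib_left distrib_right sum.distrib mult_scaleC_left
        mult_scaleC_right complex_vec.scale_sum_right)
  show "E1 (jones x y) =
      (\<Sum>i<k. index_inv * (jones x y (u i) * star (u i)))" for x y
    unfolding E1_jones using expansion_right[of y]
    by (simp add: jones_elem_type_alg mult.assoc flip: sum_distrib_left)
qed

lemma left_mult_closed: "lmult c \<in> acarrier C1"
  using first.right_linear_left_mult[of c] by (simp add: C1_iff)

lemma jones_closed: "jones x y \<in> acarrier C1"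
  using first.right_linear_jones_elem[of x y] by (simp add: C1_iff)

lemma star_algebra_C1: "star_algebra C1"
  using first.star_algebra_basic by simp

lemma amul_C1: "amul C1 = (\<circ>)" and aone_C1: "aone C1 = lmult 1"
  by (auto simp: basic_construction_def on_carrier_def left_mult_type_alg)

lemma astar_jones: "astar C1 (jones x y) = jones (star y) (star x)"
  using first.astar_jones_elem[of x y] by simp

lemma astar_left_mult: "astar C1 (lmult c) = lmult (star c)"
  using first.astar_basic_eqI[OF _ first.adjoint_of_left_mult[of c]] left_mult_closed by simp

lemma jones_comp_jones:
  "jones x y \<circ> jones x' y' = jones (x * E (y * x')) y'"
  by (rule ext) (simp add: jones_elem_type_alg mult.assoc[symmetric] E_right E_closed)

lemma jones_comp_left_mult:
  "jones x y \<circ> lmult c = jones x (y * c)"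
  by (rule ext) (simp add: jones_elem_type_alg left_mult_type_alg mult.assoc)

lemma left_mult_comp_jones:
  "lmult c \<circ> jones x y = jones (c * x) y"
  by (rule ext) (simp add: jones_elem_type_alg left_mult_type_alg mult.assoc)

lemma comp_linear: "clinear (\<lambda>T. T \<circ> S)" for S :: "'c \<Rightarrow> 'c"
  by (auto simp: clinear_iff scaleC_fun_def)

lemma jones_apply_linear: "clinear (jones x y)"
  by (simp add: clinear_iff jones_elem_type_alg distrib_left mult_scaleC_right clinear_add[OF E_linear]
      clinear_scale[OF E_linear])

lemma comp_linear_right: "clinear S \<Longrightarrow> clinear (\<lambda>T. S \<circ> T)" for S :: "'c \<Rightarrow> 'c"
  by (auto simp: clinear_iff scaleC_fun_def)

lemma jones_sum_right: "jones x (\<Sum>i\<in>I. f i) = (\<Sum>i\<in>I. jones x (f i))"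
  and jones_sum_left: "jones (\<Sum>i\<in>I. f i) y = (\<Sum>i\<in>I. jones (f i) y)"
  by (auto simp: fun_sum_apply jones_elem_type_alg sum_distrib_right sum_distrib_left clinear_sum[OF E_linear])

lemma jones_expand:
  "(\<Sum>i<k. jones (u i) (E (star (u i) * x) * y)) = jones x y"
proof -
  have "jones (u i) (E (star (u i) * x) * y) = jones (u i * E (star (u i) * x)) y" for i
    by (simp add: jones_elem_type_alg mult.assoc E_left E_closed)
  then show ?thesis by (simp add: expansion_left flip: jones_sum_left)
qed

text \<open>
  On \<open>x e y\<close> the coordinate belonging to \<open>u\<^sub>i e\<close> is \<open>Ind E\<^sup>C(e u\<^sub>i\<^sup>* x e y) = E(u\<^sub>i\<^sup>* x) y\<close>, and
  \<open>\<Sum> u\<^sub>i e E(u\<^sub>i\<^sup>* x) y = \<Sum> u\<^sub>i E(u\<^sub>i\<^sup>* x) e y = x e y\<close>.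
\<close>

sublocale second: frame C1 UNIV "lmult" E1 index_inv index k "\<lambda>i. jones (u i) 1"
proof (intro frame.intro star_algebra_C1 frame_axioms.intro)
  show "clinear (lmult)"
    by (auto simp: clinear_iff left_mult_type_alg distrib_right mult_scaleC_left scaleC_fun_def)
  show "E1 (lmult a) = a" for a
  proof -
    have "E1 (lmult a) = (\<Sum>i<k. index_inv * (a * u i * star (u i)))"
      by (simp add: E1_eq left_mult_closed) (simp add: left_mult_type_alg)
    also have "\<dots> = index_inv * a * index" by (simp add: index_def sum_distrib_left mult.assoc)
    also have "\<dots> = index_inv * index * a" by (simp only: index_central mult.assoc)
    also have "\<dots> = a" by (simp add: index_inv)
    finally show ?thesis .
  qed
  show "E1 (amul C1 T (lmult a)) = E1 T * a" if "T \<in> acarrier C1" for T a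
    unfolding amul_C1
  proof (rule C1_eqI[OF _ _ _ that])
    show "clinear (\<lambda>T. E1 (T \<circ> lmult a))"
      by (rule clinear_comp[OF E1_linear comp_linear])
    show "clinear (\<lambda>T. E1 T * a)"
      using E1_linear by (simp add: clinear_iff distrib_right mult_scaleC_left)
  qed (simp add: jones_comp_left_mult E1_jones mult.assoc)
  show "E1 (astar C1 T) = star (E1 T)" if "T \<in> acarrier C1" for T
  proof -
    interpret C1: star_algebra C1 by (rule star_algebra_C1)
    have "T \<in> acarrier C1 \<and> E1 (astar C1 T) = star (E1 T)"
      using that unfolding C1_carrier
    proof (induction rule: complex_vec.span_induct_alt)
      case base
      have "E1 (astar C1 0) = star (E1 0)"
        by (simp only: C1.astar_zero clinear_zero[OF E1_linear] star_zero)
      then show ?case using complex_vec.span_zero by blast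
    next
      case (step r U V)
      then obtain x y where U: "U = jones x y" by blast
      have V: "V \<in> acarrier C1" using step(2) unfolding C1_carrier by blast
      have "E1 (astar C1 (r *\<^sub>C U + V)) = star (E1 (r *\<^sub>C U + V))"
        unfolding U using V conjunct2[OF step(2)]
        by (simp add: C1.astar_add C1.astar_scale C1.scale_closed jones_closed astar_jones clinear_add[OF E1_linear]
            clinear_scale[OF E1_linear] E1_jones star_add star_scaleC star_mult star_index_inv index_inv_central)
      moreover have "r *\<^sub>C U + V \<in> acarrier C1"
        unfolding U by (intro C1.add_closed C1.scale_closed jones_closed V)
      ultimately show ?case unfolding C1_carrier by blast
    qed
    then show ?thesis by blast
  qed
  show "(\<Sum>i<k. amul C1 (jones (u i) 1)
      (lmult (index * E1 (amul C1 (astar C1 (jones (u i) 1)) T)))) = T"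
    if "T \<in> acarrier C1" for T
  proof (rule C1_eqI[OF _ _ _ that])
    have "clinear (\<lambda>T. jones (u i) 1 \<circ> lmult (index * E1 (jones 1 (star (u i)) \<circ> T)))" for i
      unfolding jones_comp_left_mult
      using clinear_comp[OF E1_linear comp_linear_right[OF jones_apply_linear[of 1 "star (u i)"]]]
      by (auto simp: clinear_iff jones_elem_type_alg scaleC_fun_def distrib_left distrib_right mult_scaleC_left
          mult_scaleC_right clinear_add[OF E_linear] clinear_scale[OF E_linear])
    then show "clinear (\<lambda>T. \<Sum>i<k. amul C1 (jones (u i) 1)
      (lmult (index * E1 (amul C1 (astar C1 (jones (u i) 1)) T))))"
      by (simp add: clinear_iff amul_C1 astar_jones sum.distrib complex_vec.scale_sum_right)
    show "clinear (\<lambda>T::'c \<Rightarrow> 'c. T)" by (simp add: clinear_iff)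
    show "(\<Sum>i<k. amul C1 (jones (u i) 1)
      (lmult (index * E1 (amul C1 (astar C1 (jones (u i) 1)) (jones x y)))))
      = jones x y" for x y
      by (simp add: amul_C1 astar_jones jones_comp_jones jones_comp_left_mult E1_jones jones_expand
          index_inv flip: mult.assoc)
  qed
  show "lmult a \<in> acarrier C1" for a by (rule left_mult_closed)
  show "lmult (star a) = astar C1 (lmult a)" for a by (simp only: astar_left_mult)
qed (auto simp: E1_linear aone_C1 amul_C1 jones_closed index_inv index_inv_central
    star_index_inv left_mult_type_alg mult.assoc E_closed)


lemma sum_div_mod: "(\<Sum>m<k * k. f (m div k) (m mod k)) = (\<Sum>i<k. \<Sum>l<k. f i l)" for f :: "nat \<Rightarrow> nat \<Rightarrow> 'z::comm_monoid_add"
proof (cases "k = 0")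
  case False
  have "(\<Sum>m<k * k. f (m div k) (m mod k)) = (\<Sum>i<k. \<Sum>m = i * k..<i * k + k. f (m div k) (m mod k))"
    by (rule sum.nat_group[symmetric])
  also have "\<dots> = (\<Sum>i<k. \<Sum>l<k. f i l)"
  proof (rule sum.cong[OF refl])
    fix i
    have "(\<Sum>m = i * k..<i * k + k. f (m div k) (m mod k)) = (\<Sum>l = 0..<k. f ((l + i * k) div k) ((l + i * k) mod k))"
      using sum.shift_bounds_nat_ivl[of "\<lambda>m. f (m div k) (m mod k)" 0 "i * k" k] by (simp add: add.commute)
    also have "\<dots> = (\<Sum>l<k. f i l)"
      by (simp add: atLeast0LessThan)
    finally show "(\<Sum>m = i * k..<i * k + k. f (m div k) (m mod k)) = (\<Sum>l<k. f i l)" .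
  qed
  finally show ?thesis .
qed simp

text \<open>
  The usual quasi-basis \<open>u\<^sub>i e Ind\<^sup>1\<^sup>/\<^sup>2\<close> of the dual expectation involves a square root. The
  elements \<open>u\<^sub>i e u\<^sub>l\<close> do the same job, since \<open>\<Sum> u\<^sub>l u\<^sub>l\<^sup>* = Ind\<close>.
\<close>

lemma quasi_basis_C1:
  "quasi_basis C1 (lmult \<circ> E1) (k * k) (\<lambda>m. jones (u (m div k)) (u (m mod k)))"
proof (rule star_algebra.quasi_basisI[OF star_algebra_C1])
  let ?E = "lmult \<circ> E1"
  show "?E T \<in> acarrier C1" for T by (simp add: left_mult_closed)
  show "?E (astar C1 T) = astar C1 (?E T)" if "T \<in> acarrier C1" for T
    using second.\<eta>_astar[OF that] by (simp add: astar_left_mult)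
  show "jones (u (m div k)) (u (m mod k)) \<in> acarrier C1" for m by (rule jones_closed)
  fix T assume T: "T \<in> acarrier C1"
  let ?b = "\<lambda>i. E1 (jones 1 (star (u i)) \<circ> T)"
  have "amul C1 (jones (u i) (u l)) (?E (amul C1 (astar C1 (jones (u i) (u l))) T))
      = jones (u i) (u l * star (u l) * ?b i)" for i l
  proof -
    have "jones 1 (star (u i)) \<circ> T \<in> acarrier C1"
      using star_algebra.mul_closed[OF star_algebra_C1 jones_closed T] by (simp add: amul_C1)
    then have "E1 (lmult (star (u l)) \<circ> (jones 1 (star (u i)) \<circ> T)) = star (u l) * ?b i"
      using second.\<eta>_left[of "jones 1 (star (u i)) \<circ> T" "star (u l)"] by (simp add: amul_C1)
    then have "E1 (jones (star (u l)) (star (u i)) \<circ> T) = star (u l) * ?b i"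
      using left_mult_comp_jones[of "star (u l)" 1 "star (u i)"] by (simp add: o_assoc)
    then show ?thesis by (simp add: amul_C1 astar_jones jones_comp_left_mult mult.assoc)
  qed
  then have "(\<Sum>m<k * k. amul C1 (jones (u (m div k)) (u (m mod k)))
        (?E (amul C1 (astar C1 (jones (u (m div k)) (u (m mod k)))) T)))
      = (\<Sum>i<k. \<Sum>l<k. jones (u i) (u l * star (u l) * ?b i))"
    using sum_div_mod[of "\<lambda>i l. jones (u i) (u l * star (u l) * ?b i)"] by (simp only:)
  also have "\<dots> = (\<Sum>i<k. jones (u i) (index * ?b i))"
    by (simp add: index_def sum_distrib_right flip: jones_sum_right)
  also have "\<dots> = (\<Sum>i<k. amul C1 (jones (u i) 1)
      (lmult (index * E1 (amul C1 (astar C1 (jones (u i) 1)) T))))"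
    by (simp add: amul_C1 astar_jones jones_comp_left_mult)
  also have "\<dots> = T" by (rule second.expansion[OF T])
  finally show "(\<Sum>m<k * k. amul C1 (jones (u (m div k)) (u (m mod k)))
        (?E (amul C1 (astar C1 (jones (u (m div k)) (u (m mod k)))) T))) = T" .
qed

text \<open>
  Summing \<open>(u\<^sub>i e u\<^sub>l) (u\<^sub>i e u\<^sub>l)\<^sup>*\<close> over \<open>l\<close> gives \<open>u\<^sub>i e Ind e u\<^sub>i\<^sup>* = u\<^sub>i E(Ind) e u\<^sub>i\<^sup>*\<close>, and here
  \<open>E(Ind) = Ind\<close>.
\<close>

lemma index_W_C1:
  assumes "index \<in> A"
  shows "index_W C1 (lmult \<circ> E1) = lmult index"
proof -
  have "index_W C1 (lmult \<circ> E1) =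
      (\<Sum>m<k * k. amul C1 (jones (u (m div k)) (u (m mod k)))
        (astar C1 (jones (u (m div k)) (u (m mod k)))))"
    by (rule star_algebra.index_W_eqI[OF star_algebra_C1 quasi_basis_C1]) (simp add: left_mult_closed)
  also have "\<dots> = (\<Sum>i<k. \<Sum>l<k. jones (u i * E (u l * star (u l))) (star (u i)))"
    unfolding amul_C1 astar_jones jones_comp_jones
    by (rule sum_div_mod[of "\<lambda>i l. jones (u i * E (u l * star (u l))) (star (u i))"])
  also have "\<dots> = (\<Sum>i<k. jones (u i * E index) (star (u i)))"
    by (simp add: index_def clinear_sum[OF E_linear] sum_distrib_left flip: jones_sum_left)
  also have "\<dots> = lmult index"
  proof
    fix z
    have "(\<Sum>i<k. u i * index * E (star (u i) * z)) = index * (\<Sum>i<k. u i * E (star (u i) * z))"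
      by (simp add: index_central mult.assoc sum_distrib_left)
    then show "(\<Sum>i<k. jones (u i * E index) (star (u i))) z = lmult index z"
      by (simp add: fun_sum_apply jones_elem_type_alg left_mult_type_alg E_id[OF assms] expansion_left)
  qed
  finally show ?thesis .
qed

lemma alg_inv_index_C1: "alg_inv C1 (lmult index) = lmult index_inv"
proof -
  have "lmult x \<circ> lmult y = lmult (x * y)" for x y :: 'c
    by (auto simp: left_mult_type_alg mult.assoc)
  then show ?thesis
    by (intro star_algebra.alg_inv_eqI[OF star_algebra_C1]) (simp_all add: left_mult_closed amul_C1 aone_C1 index_inv)
qed

lemma coord_first: "first.coord i x = E (star (u i) * x)"
  by (simp add: first.coord_def)

lemma coord_second: "T \<in> acarrier C1 \<Longrightarrow> second.coord i T = (\<Sum>m<k. E (star (u i) * T (u m)) * star (u m))"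
proof -
  assume T: "T \<in> acarrier C1"
  have "jones 1 (star (u i)) \<circ> T \<in> acarrier C1"
    using star_algebra.mul_closed[OF star_algebra_C1 jones_closed T] by (simp add: amul_C1)
  then have "second.coord i T = index * index_inv * (\<Sum>m<k. E (star (u i) * T (u m)) * star (u m))"
    by (simp add: second.coord_def amul_C1 astar_jones E1_eq)
      (simp add: jones_elem_type_alg mult.assoc flip: sum_distrib_left)
  then show ?thesis by (simp add: index_inv)
qed

text \<open>This is why one projection serves for both levels.\<close>

lemma gram_second: "second.gram = first.gram"
proof (intro ext)
  fix i j
  show "second.gram i j = first.gram i j"
  proof (cases "i < k \<and> j < k")
    case True
    have "second.coord i (jones (u j) 1) = E (star (u i) * u j)"
      by (simp add: second.coord_def amul_C1 astar_jones jones_comp_jones E1_jones index_inv flip: mult.assoc)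
    then show ?thesis
      using True by (simp add: second.gram_def first.gram_def second.to_matrix_apply first.to_matrix_apply coord_first)
  qed (auto simp: second.gram_def first.gram_def second.to_matrix_outside first.to_matrix_outside)
qed

end

text \<open>A dense left ideal meets the ball around \<open>1\<close> that consists of invertible elements.\<close>

lemma one_in_dense_left_ideal:
  fixes J :: "'c::cstar_algebra set"
  assumes J: "\<And>c x. x \<in> J \<Longrightarrow> c * x \<in> J" and dense: "closure J = UNIV"
  shows "1 \<in> J"
proof -
  have "(1::'c) \<in> closure J" using dense by simp
  then obtain x where x: "x \<in> J" "dist x 1 < 1" using closure_approachable zero_less_one by blast
  then have "unit_elem (1 - (1 - x))" by (intro Neumann_series) (simp add: dist_norm norm_minus_commute)
  then obtain g where "g * x = 1" unfolding unit_elem_def by auto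
  then show ?thesis using J[OF x(1), of g] by simp
qed

section \<open>Inclusions and their bimodule expectation\<close>

locale inclusion_pair =
  L: finite_index A E_A k u + R: finite_index B E_B k v + eq_bimodule Y
  for A :: "'c::cstar_algebra set" and E_A k u and B :: "'d::cstar_algebra set" and E_B v
    and Y :: "('c, 'd, 'y::complex_banach) bimod" +
  fixes X :: "'y set" and E_X :: "'y \<Rightarrow> 'y"
  assumes Morita: "strongly_Morita_equivalent_inclusions A B Y X"
    and bimodule_expectation: "bimodule_expectation A B Y X E_A E_B E_X"
begin

lemma subspace_X: "csubspace X"
  and lact_X: "a \<in> A \<Longrightarrow> x \<in> X \<Longrightarrow> lact Y a x \<in> X" and ract_X: "b \<in> B \<Longrightarrow> x \<in> X \<Longrightarrow> ract Y x b \<in> X"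
  and lip_X: "x \<in> X \<Longrightarrow> x' \<in> X \<Longrightarrow> lip Y x x' \<in> A" and rip_X: "x \<in> X \<Longrightarrow> x' \<in> X \<Longrightarrow> rip Y x x' \<in> B"
  and dense_lip: "closure (cspan {lip Y y x | y x. x \<in> X}) = UNIV"
  and dense_rip: "closure (cspan {rip Y y x | y x. x \<in> X}) = UNIV"
  using Morita unfolding strongly_Morita_equivalent_inclusions_def by - (elim conjE; (assumption | blast))+

lemma EX_linear: "clinear E_X" and EX_range: "range E_X = X"
  and EX_lact_X: "x \<in> X \<Longrightarrow> E_X (lact Y c x) = lact Y (E_A c) x"
  and EX_lact: "a \<in> A \<Longrightarrow> E_X (lact Y a y) = lact Y a (E_X y)"
  and EA_lip: "x \<in> X \<Longrightarrow> E_A (lip Y y x) = lip Y (E_X y) x"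
  and EX_ract_X: "x \<in> X \<Longrightarrow> E_X (ract Y x d) = ract Y x (E_B d)"
  and EX_ract: "b \<in> B \<Longrightarrow> E_X (ract Y y b) = ract Y (E_X y) b"
  and EB_rip: "x \<in> X \<Longrightarrow> E_B (rip Y y x) = rip Y (E_X y) x"
  using bimodule_expectation unfolding bimodule_expectation_def by - (elim conjE; (assumption | blast))+

lemma EX_closed: "E_X y \<in> X" using EX_range by blast

lemma EX_id: "x \<in> X \<Longrightarrow> E_X x = x"
  using EX_lact_X[of x 1] L.E_id[of 1] by (simp add: L.A_rules lact_one)

text \<open>
  The inner products \<open>\<langle>y, x\<rangle>\<close> with \<open>x\<close> in \<open>X\<close> span a dense left ideal of \<open>C\<close>, hence all of it. Writing \<open>1\<close>
  as the adjoint of such a sum and using \<open>\<langle>x, y\<rangle> z = x \<langle>y, z\<rangle>\<close> gives \<open>z\<close> as a finite sum.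
\<close>

lemma span_X_D: "z \<in> cspan {ract Y x d | x d. x \<in> X}"
proof -
  let ?J = "cspan {lip Y y x | y x. x \<in> X}" and ?S = "cspan {ract Y x d | x d. x \<in> X}"
  have "1 \<in> ?J"
  proof (rule one_in_dense_left_ideal[OF _ dense_lip])
    fix c b assume b: "b \<in> ?J"
    have "?J \<subseteq> {b. c * b \<in> ?J}"
    proof (rule complex_vec.span_minimal)
      show "{lip Y y x | y x. x \<in> X} \<subseteq> {b. c * b \<in> ?J}"
      proof clarify
        fix y x assume "x \<in> X"
        moreover have "c * lip Y y x = lip Y (lact Y c y) x" by (simp add: lip_lact)
        ultimately show "c * lip Y y x \<in> ?J" by (auto intro!: complex_vec.span_base)
      qed
    qed (intro complex_vec.subspaceI; simp add: distrib_left mult_scaleC_right complex_vec.span_zero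
        complex_vec.span_add complex_vec.span_scale)
    then show "c * b \<in> ?J" using b by blast
  qed
  moreover have "?J \<subseteq> {b. lact Y (star b) z \<in> ?S}"
  proof (rule complex_vec.span_minimal)
    show "{lip Y y x | y x. x \<in> X} \<subseteq> {b. lact Y (star b) z \<in> ?S}"
    proof (clarify)
      fix y x assume x: "x \<in> X"
      have "lact Y (star (lip Y y x)) z = ract Y x (rip Y y z)"
        using imprimitivity[of x y z] lip_sym[of x y] by simp
      then show "lact Y (star (lip Y y x)) z \<in> ?S" using x by (auto intro!: complex_vec.span_base)
    qed
  qed (intro complex_vec.subspaceI; simp add: Defs.star_add star_scaleC act_simps complex_vec.span_zero
        complex_vec.span_add complex_vec.span_scale)
  ultimately show ?thesis using lact_one by auto
qed

lemma span_C_X: "z \<in> cspan {lact Y c x | c x. x \<in> X}"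
proof -
  let ?J = "cspan {rip Y y x | y x. x \<in> X}" and ?S = "cspan {lact Y c x | c x. x \<in> X}"
  have "1 \<in> ?J"
  proof (rule one_in_dense_left_ideal[OF _ dense_rip])
    fix c b assume b: "b \<in> ?J"
    have "?J \<subseteq> {b. c * b \<in> ?J}"
    proof (rule complex_vec.span_minimal)
      show "{rip Y y x | y x. x \<in> X} \<subseteq> {b. c * b \<in> ?J}"
      proof clarify
        fix y x assume "x \<in> X"
        moreover have "c * rip Y y x = rip Y (ract Y y (star c)) x" by (simp add: rip_ract_left star_star)
        ultimately show "c * rip Y y x \<in> ?J" by (auto intro!: complex_vec.span_base)
      qed
    qed (intro complex_vec.subspaceI; simp add: distrib_left mult_scaleC_right complex_vec.span_zero
        complex_vec.span_add complex_vec.span_scale)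
    then show "c * b \<in> ?J" using b by blast
  qed
  moreover have "?J \<subseteq> {b. ract Y z b \<in> ?S}"
  proof (rule complex_vec.span_minimal)
    show "{rip Y y x | y x. x \<in> X} \<subseteq> {b. ract Y z b \<in> ?S}"
    proof clarify
      fix y x assume "x \<in> X"
      moreover have "ract Y z (rip Y y x) = lact Y (lip Y z y) x" by (simp add: imprimitivity)
      ultimately show "ract Y z (rip Y y x) \<in> ?S" by (auto intro!: complex_vec.span_base)
    qed
  qed (intro complex_vec.subspaceI; simp add: act_simps complex_vec.span_zero
        complex_vec.span_add complex_vec.span_scale)
  ultimately show ?thesis using ract_one by auto
qed

text \<open>
  \<open>E\<^sup>X\<close> has the quasi-bases of \<open>E\<^sup>A\<close> and \<open>E\<^sup>B\<close> on the two sides. By \<open>span_X_D\<close> it suffices to take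
  \<open>z = x d\<close>, where this is the expansion of \<open>d\<close>.
\<close>

lemma reconstruct_right: "(\<Sum>l<k. ract Y (E_X (ract Y z (v l))) (star (v l))) = z"
proof (rule clinear_eq_on_span[OF _ _ _ span_X_D])
  show "clinear (\<lambda>z. \<Sum>l<k. ract Y (E_X (ract Y z (v l))) (star (v l)))"
    by (simp add: clinear_iff act_simps clinear_add[OF EX_linear] clinear_scale[OF EX_linear] sum.distrib
        complex_vec.scale_sum_right)
  show "clinear (\<lambda>z::'y. z)" by (simp add: clinear_iff)
  fix y assume "y \<in> {ract Y x d | x d. x \<in> X}"
  then obtain x d where y: "y = ract Y x d" "x \<in> X" by blast
  have "(\<Sum>l<k. ract Y (E_X (ract Y y (v l))) (star (v l))) = ract Y x (\<Sum>l<k. E_B (d * v l) * star (v l))"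
    using y by (simp add: EX_ract_X act_sum flip: ract_mult)
  then show "(\<Sum>l<k. ract Y (E_X (ract Y y (v l))) (star (v l))) = y"
    by (simp add: R.expansion_right y)
qed

lemma reconstruct_left: "(\<Sum>i<k. lact Y (u i) (E_X (lact Y (star (u i)) z))) = z"
proof (rule clinear_eq_on_span[OF _ _ _ span_C_X])
  show "clinear (\<lambda>z. \<Sum>i<k. lact Y (u i) (E_X (lact Y (star (u i)) z)))"
    by (simp add: clinear_iff act_simps clinear_add[OF EX_linear] clinear_scale[OF EX_linear] sum.distrib
        complex_vec.scale_sum_right)
  show "clinear (\<lambda>z::'y. z)" by (simp add: clinear_iff)
  fix y assume "y \<in> {lact Y c x | c x. x \<in> X}"
  then obtain c x where y: "y = lact Y c x" "x \<in> X" by blast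
  have "(\<Sum>i<k. lact Y (u i) (E_X (lact Y (star (u i)) y))) = lact Y (\<Sum>i<k. u i * E_A (star (u i) * c)) x"
    using y by (simp add: EX_lact_X act_sum flip: lact_mult)
  then show "(\<Sum>i<k. lact Y (u i) (E_X (lact Y (star (u i)) y))) = y"
    by (simp add: L.expansion_left y)
qed

text \<open>
  Expanding \<open>u\<^sub>i\<^sup>* z\<close> on the right leaves \<open>\<Sum> u\<^sub>i u\<^sub>i\<^sup>* z\<close>. Expanding \<open>z v\<^sub>l\<close> on the left instead leaves
  \<open>\<Sum> z v\<^sub>l v\<^sub>l\<^sup>*\<close>, and so the two indices act alike on \<open>Y\<close>.
\<close>

lemma reconstruct:
  "(\<Sum>i<k. \<Sum>l<k. ract Y (lact Y (u i) (E_X (ract Y (lact Y (star (u i)) z) (v l)))) (star (v l))) = lact Y L.index z"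
proof -
  have "(\<Sum>l<k. ract Y (lact Y (u i) (E_X (ract Y (lact Y (star (u i)) z) (v l)))) (star (v l))) =
      lact Y (u i) (\<Sum>l<k. ract Y (E_X (ract Y (lact Y (star (u i)) z) (v l))) (star (v l)))" for i
    by (simp only: ract_lact[of "u i"] act_sum(2))
  then show ?thesis
    by (simp add: reconstruct_right L.index_def act_sum lact_mult)
qed

lemma index_act: "lact Y L.index z = ract Y z R.index"
proof -
  have "(\<Sum>i<k. ract Y (lact Y (u i) (E_X (ract Y (lact Y (star (u i)) z) (v l)))) (star (v l))) =
      ract Y (\<Sum>i<k. lact Y (u i) (E_X (lact Y (star (u i)) (ract Y z (v l))))) (star (v l))" for l
    by (simp only: ract_lact[of "star _"] act_sum(4))
  then have "lact Y L.index z = (\<Sum>l<k. ract Y (ract Y z (v l)) (star (v l)))"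
    unfolding reconstruct[symmetric] by (subst sum.swap) (simp add: reconstruct_left)
  then show ?thesis
    by (simp add: R.index_def act_sum ract_mult)
qed

lemma index_inv_act: "lact Y L.index_inv z = ract Y z R.index_inv"
proof -
  have "lact Y L.index_inv z = lact Y L.index_inv (ract Y (ract Y z R.index_inv) R.index)"
    by (simp add: R.index_inv ract_one flip: ract_mult)
  also have "\<dots> = ract Y z R.index_inv"
    by (simp add: L.index_inv lact_one flip: index_act lact_mult)
  finally show ?thesis .
qed

sublocale one: bimodule_frame type_alg A id E_A 1 1 k u type_alg B id E_B 1 1 v Y X E_X id Y E_X
proof (intro bimodule_frame.intro bimodule_frame_axioms.intro L.first.frame_axioms R.first.frame_axioms eq_bimodule_axioms)
  show "clinear (id :: 'y \<Rightarrow> 'y)" by (simp add: clinear_iff)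
qed (simp_all add: subspace_X lact_X ract_X lip_X rip_X EX_linear EX_closed EX_id EX_range carrier_UNIV lact_one ract_one)


text \<open>The coordinate matrix of \<open>y\<close> as an element of \<open>Y\<^sub>1\<close>, by \<open>coordinates_embed\<close> below.\<close>

definition coeffs :: "'y \<Rightarrow> nat \<Rightarrow> nat \<Rightarrow> 'y"
  where "coeffs y = (\<lambda>i l. if i < k \<and> l < k then E_X (ract Y (lact Y (star (u i)) y) (v l)) else 0)"

abbreviation embed :: "'y \<Rightarrow> ('c, 'd, 'y) tensor"
  where "embed \<equiv> upward_embedding one.data"

abbreviation dual_exp :: "('c, 'd, 'y) tensor \<Rightarrow> 'y"
  where "dual_exp \<equiv> dual_bimodule_expectation one.data"

lemma coeffs_linear: "clinear coeffs"
  by (auto intro!: ext simp: clinear_iff coeffs_def act_simps clinear_add[OF EX_linear] clinear_scale[OF EX_linear]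
      scaleC_apply)

text \<open>
  The matrix comes out the same for every pair of quasi-bases, which is why the embedding does not
  depend on their choice.
\<close>

lemma coordinates_embedding_terms:
  assumes u': "quasi_basis type_alg E_A n u'" and v': "quasi_basis type_alg E_B m v'"
  shows "one.coordinates (\<Sum>a<n. \<Sum>b<m. tensor one.data (u' a)
    (E_X (ract Y (lact Y (star (u' a)) y) (v' b))) (v' b)) = coeffs y"
proof -
  have t: "one.coordinates (tensor one.data c (E_X z) d) = one.elem_matrix c (E_X z) d" for c d z
    using one.coordinates_tens[of c "E_X z" d] by (simp add: EX_closed)
  have "one.coordinates (\<Sum>a<n. \<Sum>b<m. tensor one.data (u' a)
      (E_X (ract Y (lact Y (star (u' a)) y) (v' b))) (v' b)) =
      (\<Sum>a<n. \<Sum>b<m. one.elem_matrix (u' a) (E_X (ract Y (lact Y (star (u' a)) y) (v' b))) (v' b))"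
    by (simp add: clinear_sum[OF one.coordinates_linear] t)
  also have "\<dots> = coeffs y"
  proof (intro ext)
    fix i l
    show "(\<Sum>a<n. \<Sum>b<m. one.elem_matrix (u' a) (E_X (ract Y (lact Y (star (u' a)) y) (v' b))) (v' b)) i l = coeffs y i l"
    proof (cases "i < k \<and> l < k")
      case True
      let ?a = "\<lambda>a. E_A (star (u i) * u' a)" and ?b = "\<lambda>b. E_B (star (v' b) * v l)"
      have "one.elem_matrix (u' a) (E_X (ract Y (lact Y (star (u' a)) y) (v' b))) (v' b) i l =
          E_X (ract Y (lact Y (?a a * star (u' a)) y) (v' b * ?b b))" for a b
      proof -
        have sb: "star (E_B (star (v l) * v' b)) = ?b b"
          by (simp add: star_mult star_star flip: R.E_star)
        have "one.elem_matrix (u' a) (E_X (ract Y (lact Y (star (u' a)) y) (v' b))) (v' b) i l =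
          lact Y (?a a) (ract Y (E_X (ract Y (lact Y (star (u' a)) y) (v' b))) (?b b))"
          using True by (simp add: one.elem_matrix_def L.coord_first R.coord_first sb)
        also have "\<dots> = E_X (lact Y (?a a) (ract Y (ract Y (lact Y (star (u' a)) y) (v' b)) (?b b)))"
          by (simp add: EX_lact EX_ract L.E_closed R.E_closed)
        also have "\<dots> = E_X (ract Y (lact Y (?a a * star (u' a)) y) (v' b * ?b b))"
          by (simp add: ract_mult lact_mult ract_lact)
        finally show ?thesis .
      qed
      then have "(\<Sum>a<n. \<Sum>b<m. one.elem_matrix (u' a) (E_X (ract Y (lact Y (star (u' a)) y) (v' b))) (v' b)) i l =
          E_X (ract Y (lact Y (\<Sum>a<n. ?a a * star (u' a)) y) (\<Sum>b<m. v' b * ?b b))"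
        by (simp only: fun_sum_apply act_double_sum[symmetric] clinear_sum[OF EX_linear])
      also have "\<dots> = coeffs y i l"
        using L.alg.quasi_basisD(3)[OF u', of "star (u i)"] R.alg.quasi_basisD(2)[OF v', of "v l"] True
        by (simp add: coeffs_def)
      finally show ?thesis .
    qed (auto simp: fun_sum_apply one.elem_matrix_def coeffs_def)
  qed
  finally show ?thesis .
qed

lemma embed_eq: "embed y = one.from_matrix (coeffs y)"
proof -
  have span: "(\<Sum>a<n. \<Sum>b<m. tensor one.data (u' a) (E_X (z a b)) (v' b)) \<in> cspan one.tensors"
    for n m :: nat and u' z v'
    unfolding one.tensors_def by (intro complex_vec.span_sum complex_vec.span_base) (auto intro: EX_closed)
  have eq: "(\<Sum>a<n. \<Sum>b<m. tensor one.data (u' a) (E_X (ract Y (lact Y (star (u' a)) y) (v' b))) (v' b)) =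
      one.from_matrix (coeffs y)"
    if "quasi_basis type_alg E_A n u'" "quasi_basis type_alg E_B m v'" for n u' m v'
    using one.from_matrix_coordinates[OF span[where n=n and m=m and u'=u' and v'=v' and z="\<lambda>a b. ract Y (lact Y (star (u' a)) y) (v' b)"]]
    unfolding coordinates_embedding_terms[OF that] by (rule sym)
  have "embed y = (THE t. \<exists>n u m v. quasi_basis type_alg E_A n u \<and> quasi_basis type_alg E_B m v \<and>
       t = (\<Sum>i<n. \<Sum>j<m. tensor one.data (u i) (E_X (ract Y (lact Y (star (u i)) y) (v j))) (v j)))"
    by (simp add: upward_embedding_def one.data_simps)
  also have "\<dots> = one.from_matrix (coeffs y)"
  proof (rule the_equality)
    show "\<exists>n u m v. quasi_basis type_alg E_A n u \<and> quasi_basis type_alg E_B m v \<and>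
       one.from_matrix (coeffs y) = (\<Sum>i<n. \<Sum>j<m. tensor one.data (u i) (E_X (ract Y (lact Y (star (u i)) y) (v j))) (v j))"
      by (intro exI conjI, rule L.quasi_basis, rule R.quasi_basis, rule eq[symmetric])
        (rule L.quasi_basis, rule R.quasi_basis)
  next
    fix t
    assume "\<exists>n u m v. quasi_basis type_alg E_A n u \<and> quasi_basis type_alg E_B m v \<and>
       t = (\<Sum>i<n. \<Sum>j<m. tensor one.data (u i) (E_X (ract Y (lact Y (star (u i)) y) (v j))) (v j))"
    then show "t = one.from_matrix (coeffs y)" using eq by (elim exE conjE) (simp only:)
  qed
  finally show ?thesis .
qed

lemma embed_closed: "embed y \<in> cspan one.tensors"
  by (simp add: embed_eq one.from_matrix_closed)

lemma coordinates_embed: "one.coordinates (embed y) = coeffs y"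
proof -
  let ?t = "\<Sum>a<k. \<Sum>b<k. tensor one.data (u a) (E_X (ract Y (lact Y (star (u a)) y) (v b))) (v b)"
  have "?t \<in> cspan one.tensors"
    unfolding one.tensors_def by (intro complex_vec.span_sum complex_vec.span_base) (auto intro: EX_closed)
  from one.from_matrix_coordinates[OF this] have "one.from_matrix (coeffs y) = ?t"
    by (simp only: coordinates_embedding_terms[OF L.quasi_basis R.quasi_basis])
  then show ?thesis
    using coordinates_embedding_terms[OF L.quasi_basis R.quasi_basis] by (simp add: embed_eq)
qed

lemma embed_linear: "clinear embed"
  using clinear_comp[OF one.from_matrix_linear coeffs_linear] by (simp add: embed_eq[abs_def])

lemma embed_inj: "inj embed"
proof (rule injI)
  fix y z assume "embed y = embed z"
  then have "coeffs y = coeffs z" using coordinates_embed by metis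
  then have "E_X (ract Y (lact Y (star (u i)) y) (v l)) = E_X (ract Y (lact Y (star (u i)) z) (v l))"
    if "i < k" "l < k" for i l
    using that by (auto simp: coeffs_def dest: fun_cong[of _ _ i] fun_cong[of _ _ l]) (metis (no_types, lifting))
  then have "lact Y L.index y = lact Y L.index z"
    unfolding reconstruct[symmetric] by simp
  then have "lact Y (L.index_inv * L.index) y = lact Y (L.index_inv * L.index) z"
    by (simp add: lact_mult)
  then show "y = z" by (simp add: L.index_inv lact_one)
qed

text \<open>The formula on the right is linear in \<open>t\<close> and has the prescribed values on elementary tensors.\<close>

lemma dual_exp_coordinates: "t \<in> cspan one.tensors \<Longrightarrow> dual_exp t =
    (\<Sum>i<k. \<Sum>l<k. lact Y L.index_inv (ract Y (lact Y (u i) (one.coordinates t i l)) (star (v l))))"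
proof -
  let ?H = "\<lambda>t. \<Sum>i<k. \<Sum>l<k. lact Y L.index_inv (ract Y (lact Y (u i) (one.coordinates t i l)) (star (v l)))"
  let ?Q = "\<lambda>L. clinear L \<and> (\<forall>c\<in>acarrier type_alg. \<forall>x\<in>id ` X. \<forall>d\<in>acarrier type_alg. L (tensor one.data c x d) =
    lact Y (alg_inv type_alg (index_W type_alg (id \<circ> E_A))) (ract Y (lact Y c x) (astar type_alg d)))"
  have H1: "clinear ?H"
    by (simp add: clinear_iff clinear_add[OF one.coordinates_linear] clinear_scale[OF one.coordinates_linear]
        scaleC_apply act_simps sum.distrib complex_vec.scale_sum_right)
  have H2: "?H (tensor one.data c x d) = lact Y L.index_inv (ract Y (lact Y c x) (star d))" if x: "x \<in> X" for c x d
  proof -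
    have "one.coordinates (tensor one.data c x d) = one.elem_matrix c x d"
      using one.coordinates_tens[of c x d] x by simp
    then have "?H (tensor one.data c x d) = (\<Sum>i<k. \<Sum>l<k. lact Y L.index_inv
        (ract Y (lact Y (u i * E_A (star (u i) * c)) x) (E_B (star d * v l) * star (v l))))"
      by (simp add: one.elem_matrix_def L.coord_first R.coord_first ract_mult lact_mult ract_lact
          star_mult star_star flip: R.E_star cong: sum.cong_simp)
    also have "\<dots> = lact Y L.index_inv (ract Y (lact Y (\<Sum>i<k. u i * E_A (star (u i) * c)) x)
        (\<Sum>l<k. E_B (star d * v l) * star (v l)))"
      by (simp only: act_double_sum[symmetric] act_sum(2))
    finally show ?thesis by (simp add: L.expansion_left R.expansion_right)
  qed
  have Q': "?Q ?H" using H1 H2 by (simp add: L.index_W L.alg_inv_index)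
  have G: "dual_exp = (SOME L. ?Q L)"
    unfolding dual_bimodule_expectation_def Let_def one.data_simps one.range_g by (rule refl)
  have Q: "?Q dual_exp" unfolding G by (rule someI[of ?Q, OF Q'])
  show "dual_exp t = ?H t" if t: "t \<in> cspan one.tensors"
  proof (rule clinear_eq_on_span[OF _ H1 _ t])
    show "clinear dual_exp" using Q by blast
    fix s assume "s \<in> one.tensors"
    then obtain c x d where s: "s = tensor one.data c x d" "x \<in> X" by (auto simp: one.tensors_def)
    then show "dual_exp s = ?H s" using Q H2 by (simp add: L.index_W L.alg_inv_index)
  qed
qed

lemma dual_exp_embed: "dual_exp (embed y) = y"
proof -
  have "dual_exp (embed y) = lact Y L.index_inv (lact Y L.index y)"
    unfolding dual_exp_coordinates[OF embed_closed] coordinates_embed reconstruct[symmetric]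
    by (simp add: act_sum coeffs_def cong: sum.cong_simp)
  then show ?thesis by (simp add: L.index_inv lact_one flip: lact_mult)
qed

lemma lact_EX_sum:
  assumes T: "T \<in> acarrier L.C1" and i: "i < k"
  shows "(\<Sum>m<k. lact Y (L.first.to_matrix T i m) (E_X (lact Y (star (u m)) z))) = E_X (lact Y (L.second.coord i T) z)"
proof -
  have "(\<Sum>m<k. lact Y (L.first.to_matrix T i m) (E_X (lact Y (star (u m)) z))) =
      (\<Sum>m<k. E_X (lact Y (E_A (star (u i) * T (u m)) * star (u m)) z))"
    using i by (intro sum.cong refl)
      (simp add: L.first.to_matrix_apply L.coord_first lact_mult EX_lact L.E_closed)
  then show ?thesis by (simp add: L.coord_second[OF T] act_sum clinear_sum[OF EX_linear])
qed

lemma ract_EX_sum: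
  assumes T: "T \<in> acarrier R.C1" and l: "l < k"
  shows "(\<Sum>m<k. ract Y (E_X (ract Y z (v m))) (R.first.to_matrix (astar R.C1 T) m l)) =
    E_X (ract Y z (star (R.second.coord l T)))"
proof -
  have "R.first.to_matrix (astar R.C1 T) = astar R.first.matK (R.first.to_matrix T)"
    using R.first.to_matrix_adjoint[OF _ R.first.adjoint_of_astar[of T]] T by (simp add: R.C1_iff)
  then have "(\<Sum>m<k. ract Y (E_X (ract Y z (v m))) (R.first.to_matrix (astar R.C1 T) m l)) =
      (\<Sum>m<k. E_X (ract Y z (v m * star (E_B (star (v l) * T (v m))))))"
    using l by (intro sum.cong refl)
      (simp add: R.first.matK_simps R.first.to_matrix_apply R.coord_first ract_mult EX_ract R.A_rules R.E_closed)
  then show ?thesis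
    by (simp add: R.coord_second[OF T] act_sum clinear_sum[OF EX_linear] star_sum star_mult star_star)
qed

text \<open>
  The product of matrices assembles the coordinates of \<open>T\<close> and \<open>T'\<close> inside \<open>E\<^sup>X\<close>, because
  \<open>T\<^sub>i = \<Sum> E\<^sup>A(u\<^sub>i\<^sup>* T(u\<^sub>m)) u\<^sub>m\<^sup>*\<close>.
\<close>

lemma coeffs_two_sided:
  assumes T: "T \<in> acarrier L.C1" and T': "T' \<in> acarrier R.C1"
  shows "ract one.matZ (lact one.matZ (L.first.to_matrix T) (coeffs y)) (R.first.to_matrix (astar R.C1 T')) =
    (\<lambda>i l. if i < k \<and> l < k then E_X (ract Y (lact Y (L.second.coord i T) y) (star (R.second.coord l T'))) else 0)"
proof (intro ext)
  fix i l
  show "ract one.matZ (lact one.matZ (L.first.to_matrix T) (coeffs y)) (R.first.to_matrix (astar R.C1 T')) i l =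
    (if i < k \<and> l < k then E_X (ract Y (lact Y (L.second.coord i T) y) (star (R.second.coord l T'))) else 0)"
  proof (cases "i < k \<and> l < k")
    case True
    have "lact one.matZ (L.first.to_matrix T) (coeffs y) i m = E_X (ract Y (lact Y (L.second.coord i T) y) (v m))"
      if "m < k" for m
      using True that lact_EX_sum[OF T, of i "ract Y y (v m)"]
      by (simp add: one.matZ_simps coeffs_def ract_lact cong: sum.cong_simp)
    then show ?thesis
      using True ract_EX_sum[OF T', of l "lact Y (L.second.coord i T) y"]
      by (simp add: one.matZ_simps(3) cong: sum.cong_simp)
  qed (auto simp: one.matZ_simps L.first.to_matrix_outside R.first.to_matrix_outside act_simps)
qed

lemma coord_left_mult: "L.second.coord i (left_mult type_alg a) = star (u i) * a"
  "R.second.coord l (left_mult type_alg b) = star (v l) * b"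
  using L.expansion_right[of "star (u i) * a"] R.expansion_right[of "star (v l) * b"]
  by (simp_all add: L.coord_second[OF L.left_mult_closed] R.coord_second[OF R.left_mult_closed])
    (simp_all add: left_mult_type_alg mult.assoc)

lemma lact_embed: "lact one.Y1 (left_mult type_alg a) (embed y) = embed (lact Y a y)"
proof -
  have T: "left_mult type_alg a \<in> acarrier L.first.basic" using L.left_mult_closed by simp
  have "lact one.matZ (L.first.to_matrix (left_mult type_alg a)) (coeffs y) = coeffs (lact Y a y)"
  proof (intro ext)
    fix i l
    show "lact one.matZ (L.first.to_matrix (left_mult type_alg a)) (coeffs y) i l = coeffs (lact Y a y) i l"
      using lact_EX_sum[OF L.left_mult_closed, of i a "ract Y y (v l)"]
      by (auto simp: one.matZ_simps(2) coeffs_def coord_left_mult ract_lact lact_mult act_simps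
          L.first.to_matrix_outside cong: sum.cong_simp)
  qed
  then show ?thesis
    by (intro one.coordinates_inj one.lact_upward_closed T embed_closed)
      (simp only: one.coordinates_lact[OF T embed_closed] coordinates_embed)
qed

lemma ract_embed: "ract one.Y1 (embed y) (left_mult type_alg b) = embed (ract Y y b)"
proof -
  have T: "left_mult type_alg b \<in> acarrier R.first.basic" using R.left_mult_closed by simp
  have "ract one.matZ (coeffs y) (R.first.to_matrix (left_mult type_alg b)) = coeffs (ract Y y b)"
  proof (intro ext)
    fix i l
    show "ract one.matZ (coeffs y) (R.first.to_matrix (left_mult type_alg b)) i l = coeffs (ract Y y b) i l"
      using ract_EX_sum[OF R.left_mult_closed, of l "lact Y (star (u i)) y" "star b"]
      by (auto simp: one.matZ_simps(3) coeffs_def coord_left_mult ract_lact ract_mult act_simps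
          R.first.to_matrix_outside R.astar_left_mult star_mult star_star cong: sum.cong_simp)
  qed
  then show ?thesis
    by (intro one.coordinates_inj one.ract_upward_closed T embed_closed)
      (simp only: one.coordinates_ract[OF T embed_closed] coordinates_embed)
qed

lemma lip_embed: "lip one.Y1 (embed y) (embed z) = left_mult type_alg (lip Y y z)"
proof -
  have "lip one.matZ (coeffs y) (coeffs z) = L.first.to_matrix (left_mult type_alg (lip Y y z))"
  proof (intro ext)
    fix i j
    show "lip one.matZ (coeffs y) (coeffs z) i j = L.first.to_matrix (left_mult type_alg (lip Y y z)) i j"
    proof (cases "i < k \<and> j < k")
      case True
      have "lip one.matZ (coeffs y) (coeffs z) i j = (\<Sum>m<k. E_A (lip Y (lact Y (star (u i)) y)
          (ract Y (E_X (ract Y (lact Y (star (u j)) z) (v m))) (star (v m)))))"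
        using True by (simp add: one.matZ_simps coeffs_def EA_lip[symmetric] EX_closed lip_ract cong: sum.cong_simp)
      also have "\<dots> = E_A (lip Y (lact Y (star (u i)) y) (lact Y (star (u j)) z))"
        using reconstruct_right[of "lact Y (star (u j)) z"]
        by (simp add: clinear_sum[OF L.E_linear, symmetric] ip_sum(3)[symmetric])
      finally show ?thesis
        using True
        by (simp add: L.first.to_matrix_apply L.coord_first left_mult_type_alg lip_lact lip_lact_right star_star mult.assoc)
    next
      case False
      then show ?thesis
        by (auto simp: one.matZ_simps coeffs_def L.first.to_matrix_outside ip_simps lip_zero_right)
    qed
  qed
  then have "lip one.Y1 (embed y) (embed z) =
      L.first.of_matrix (L.first.to_matrix (left_mult type_alg (lip Y y z)))"
    by (simp only: one.coordinates_lip(2)[OF embed_closed embed_closed] coordinates_embed)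
  then show ?thesis
    using L.first.of_matrix_to_matrix[of "left_mult type_alg (lip Y y z)"] L.left_mult_closed by (simp add: L.C1_iff)
qed

lemma rip_embed: "rip one.Y1 (embed y) (embed z) = left_mult type_alg (rip Y y z)"
proof -
  have "rip one.matZ (coeffs y) (coeffs z) = R.first.to_matrix (left_mult type_alg (rip Y y z))"
  proof (intro ext)
    fix i j
    show "rip one.matZ (coeffs y) (coeffs z) i j = R.first.to_matrix (left_mult type_alg (rip Y y z)) i j"
    proof (cases "i < k \<and> j < k")
      case True
      have "rip one.matZ (coeffs y) (coeffs z) i j = (\<Sum>m<k. E_B (rip Y (ract Y y (v i))
          (lact Y (u m) (E_X (lact Y (star (u m)) (ract Y z (v j)))))))"
        using True by (simp add: one.matZ_simps coeffs_def EB_rip[symmetric] EX_closed ract_lact rip_lact star_star cong: sum.cong_simp)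
      also have "\<dots> = E_B (rip Y (ract Y y (v i)) (ract Y z (v j)))"
        using reconstruct_left[of "ract Y z (v j)"]
        by (simp add: clinear_sum[OF R.E_linear, symmetric] ip_sum(2)[symmetric])
      finally show ?thesis
        using True
        by (simp add: R.first.to_matrix_apply R.coord_first left_mult_type_alg rip_ract rip_ract_left mult.assoc)
    next
      case False
      then show ?thesis
        by (auto simp: one.matZ_simps coeffs_def R.first.to_matrix_outside ip_simps rip_zero_left)
    qed
  qed
  then have "rip one.Y1 (embed y) (embed z) =
      R.first.of_matrix (R.first.to_matrix (left_mult type_alg (rip Y y z)))"
    by (simp only: one.coordinates_rip(2)[OF embed_closed embed_closed] coordinates_embed)
  then show ?thesis
    using R.first.of_matrix_to_matrix[of "left_mult type_alg (rip Y y z)"] R.left_mult_closed by (simp add: R.C1_iff)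
qed

sublocale two: bimodule_frame L.C1 UNIV "left_mult type_alg" L.E1 L.index_inv L.index k
  "\<lambda>i. jones_elem type_alg E_A (u i) 1"
  R.C1 UNIV "left_mult type_alg" R.E1 R.index_inv R.index "\<lambda>l. jones_elem type_alg E_B (v l) 1"
  Y UNIV id embed "one.Y1" "embed \<circ> dual_exp"
proof (intro bimodule_frame.intro bimodule_frame_axioms.intro L.second.frame_axioms R.second.frame_axioms eq_bimodule_axioms)
  show "clinear (id :: 'y \<Rightarrow> 'y)" by (simp add: clinear_iff)
  show "clinear embed" by (rule embed_linear)
  show "inj_on embed UNIV" by (rule embed_inj)
  show "(embed \<circ> dual_exp) ` bcarrier one.Y1 = embed ` UNIV"
  proof
    show "embed ` UNIV \<subseteq> (embed \<circ> dual_exp) ` bcarrier one.Y1"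
    proof clarify
      fix y
      have "embed y = (embed \<circ> dual_exp) (embed y)" by (simp add: dual_exp_embed)
      then show "embed y \<in> (embed \<circ> dual_exp) ` bcarrier one.Y1"
        using embed_closed unfolding one.bcarrier_upward by blast
    qed
  qed auto
qed (simp_all add: complex_vec.subspace_UNIV lact_embed ract_embed lip_embed rip_embed index_inv_act)

lemma upward_data:
  "upward \<lparr>lalg = type_alg, lexp = E_A, ralg = type_alg, rexp = E_B, bim = Y, bexp = E_X\<rparr> = two.data"
proof -
  have "one.data = \<lparr>lalg = type_alg, lexp = E_A, ralg = type_alg, rexp = E_B, bim = Y, bexp = E_X\<rparr>"
    by (simp add: one.data_def)
  then show ?thesis by (metis (no_types, lifting) two.data_def upward_def one.data_simps id_comp)
qed

text \<open>
  On \<open>T \<otimes> y \<otimes> T'~\<close> both sides have the entries \<open>E\<^sup>X(Ind\<^sup>-\<^sup>1 T\<^sub>i y T'\<^sub>l\<^sup>*)\<close>. The same computation shows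
  that a linear map with the values prescribed for \<open>E\<^sup>Y\<^sup>1\<close> exists, namely the pull-back of the
  entrywise \<open>E\<^sup>X\<close> along the coordinates.
\<close>

lemma expectation_coordinates:
  assumes index: "L.index \<in> A" and t: "t \<in> cspan two.tensors"
  shows "mat_map E_X (two.coordinates t) = one.coordinates (dual_bimodule_expectation two.data t)"
proof -
  let ?W = "one.Y1"
  let ?R = "\<lambda>T x T'. lact ?W (alg_inv L.C1 (index_W L.C1 (left_mult type_alg \<circ> L.E1))) (ract ?W (lact ?W T x) (astar R.C1 T'))"
  let ?H = "\<lambda>t. one.from_matrix (mat_map E_X (two.coordinates t))"
  let ?Q = "\<lambda>L. clinear L \<and> (\<forall>T\<in>acarrier L.C1. \<forall>x\<in>embed ` UNIV. \<forall>T'\<in>acarrier R.C1. L (tensor two.data T x T') = ?R T x T')"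
  have map_linear: "clinear (mat_map E_X :: (nat \<Rightarrow> nat \<Rightarrow> 'y) \<Rightarrow> _)"
    by (auto intro!: ext simp: clinear_iff mat_map_def clinear_add[OF EX_linear] clinear_scale[OF EX_linear] scaleC_apply)
  have H1: "clinear ?H"
    by (rule clinear_comp[OF one.from_matrix_linear clinear_comp[OF map_linear two.coordinates_linear]])
  have R: "?R T (embed y) T' \<in> cspan one.tensors \<and> one.coordinates (?R T (embed y) T') =
      mat_map E_X (two.coordinates (tensor two.data T (embed y) T'))"
    if T: "T \<in> acarrier L.C1" and T': "T' \<in> acarrier R.C1" for T y T'
  proof -
    have hC: "left_mult type_alg L.index_inv \<in> acarrier L.first.basic" using L.left_mult_closed by simp
    have TC: "T \<in> acarrier L.first.basic" using T by simp
    have TC': "astar R.C1 T' \<in> acarrier R.first.basic"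
      using star_algebra.astar_closed[OF R.star_algebra_C1 T'] by simp
    have inv: "alg_inv L.C1 (index_W L.C1 (left_mult type_alg \<circ> L.E1)) = left_mult type_alg L.index_inv"
      by (simp only: L.index_W_C1[OF index] L.alg_inv_index_C1)
    let ?s = "ract ?W (lact ?W T (embed y)) (astar R.C1 T')"
    have s1: "lact ?W T (embed y) \<in> cspan one.tensors" by (rule one.lact_upward_closed[OF TC embed_closed])
    have s: "?s \<in> cspan one.tensors" by (rule one.ract_upward_closed[OF TC' s1])
    have cs: "one.coordinates ?s = (\<lambda>i l. if i < k \<and> l < k
        then E_X (ract Y (lact Y (L.second.coord i T) y) (star (R.second.coord l T'))) else 0)"
      by (simp only: one.coordinates_ract[OF TC' s1] one.coordinates_lact[OF TC embed_closed] coordinates_embed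
          coeffs_two_sided[OF T T'])
    have "one.coordinates (lact ?W (left_mult type_alg L.index_inv) ?s) =
        lact one.matZ (L.first.to_matrix (left_mult type_alg L.index_inv)) (one.coordinates ?s)"
      by (rule one.coordinates_lact[OF hC s])
    also have "\<dots> = mat_map E_X (two.coordinates (tensor two.data T (embed y) T'))"
    proof (intro ext)
      fix i l
      show "lact one.matZ (L.first.to_matrix (left_mult type_alg L.index_inv)) (one.coordinates ?s) i l =
          mat_map E_X (two.coordinates (tensor two.data T (embed y) T')) i l"
      proof (cases "i < k \<and> l < k")
        case True
        let ?z = "ract Y y (star (R.second.coord l T'))"
        have h: "L.first.to_matrix (left_mult type_alg L.index_inv) i m = L.index_inv * L.first.gram i m"
          and g: "L.first.gram i m \<in> A" if "m < k" for m
        proof -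
          have "E_A (star (u i) * (L.index_inv * u m)) = L.index_inv * E_A (star (u i) * u m)"
            using L.E_left[OF L.index_inv_closed[OF index]] L.index_inv_central[of "star (u i)"] by (metis mult.assoc)
          then show "L.first.to_matrix (left_mult type_alg L.index_inv) i m = L.index_inv * L.first.gram i m"
            using True that by (simp add: L.first.gram_def L.first.to_matrix_apply L.coord_first left_mult_type_alg)
          show "L.first.gram i m \<in> A"
            using True that by (simp add: L.first.gram_def L.first.to_matrix_apply L.coord_first L.E_closed)
        qed
        have "lact one.matZ (L.first.to_matrix (left_mult type_alg L.index_inv)) (one.coordinates ?s) i l =
            (\<Sum>m<k. lact Y (L.index_inv * L.first.gram i m) (E_X (lact Y (L.second.coord m T) ?z)))"
          unfolding one.matZ_simps(2) cs using True by (intro sum.cong refl) (simp add: h ract_lact)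
        also have "\<dots> = (\<Sum>m<k. E_X (lact Y L.index_inv (lact Y (L.first.gram i m * L.second.coord m T) ?z)))"
          using L.index_inv_closed[OF index] g by (intro sum.cong refl) (simp add: EX_lact lact_mult)
        also have "\<dots> = E_X (lact Y L.index_inv (lact Y (\<Sum>m<k. L.second.gram i m * L.second.coord m T) ?z))"
          by (simp add: act_sum clinear_sum[OF EX_linear] L.gram_second)
        also have "\<dots> = E_X (lact Y (L.index_inv * L.second.coord i T) ?z)"
          using True by (simp add: L.second.coord_gram[OF T] lact_mult)
        finally show ?thesis
          using True by (simp add: mat_map_def two.coordinates_tens T T' two.elem_matrix_def)
      next
        case False
        then show ?thesis
          by (auto simp: mat_map_def two.coordinates_tens T T' two.elem_matrix_def one.matZ_simps(2) cs act_simps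
              clinear_zero[OF EX_linear] L.first.to_matrix_outside)
      qed
    qed
    finally show ?thesis unfolding inv using one.lact_upward_closed[OF hC s] by blast
  qed
  have H2: "?H (tensor two.data T (embed y) T') = ?R T (embed y) T'"
    if "T \<in> acarrier L.C1" "T' \<in> acarrier R.C1" for T y T'
    using R[OF that] one.from_matrix_coordinates by metis
  have Q': "?Q ?H" using H1 H2 by blast
  have G: "dual_bimodule_expectation two.data = (SOME L. ?Q L)"
    by (rule two.dual_expectation_eq)
  have Q: "?Q (dual_bimodule_expectation two.data)" unfolding G by (rule someI[of ?Q, OF Q'])
  show ?thesis
  proof (rule clinear_eq_on_span[OF _ _ _ t])
    show "clinear (\<lambda>t. mat_map E_X (two.coordinates t))"
      by (rule clinear_comp[OF map_linear two.coordinates_linear])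
    show "clinear (\<lambda>t. one.coordinates (dual_bimodule_expectation two.data t))"
      using Q by (intro clinear_comp[OF one.coordinates_linear]) blast
    fix s assume "s \<in> two.tensors"
    then obtain T y T' where s: "s = tensor two.data T (embed y) T'" "T \<in> acarrier L.C1" "T' \<in> acarrier R.C1"
      by (auto simp: two.tensors_def)
    then have "dual_bimodule_expectation two.data s = ?R T (embed y) T'" using Q by blast
    then show "mat_map E_X (two.coordinates s) = one.coordinates (dual_bimodule_expectation two.data s)"
      using R[OF s(2,3)] s(1) by simp
  qed
qed

end


section \<open>The theorem\<close>

theorem theorem7p4:
  fixes A :: "'c::cstar_algebra set" and B :: "'d::cstar_algebra set"
    and Y :: "('c, 'd, 'y::complex_banach) bimod" and X :: "'y set"
    and E_A :: "'c \<Rightarrow> 'c" and E_B :: "'d \<Rightarrow> 'd" and E_X :: "'y \<Rightarrow> 'y"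
  assumes "unital_cstar_subalgebra A" and "unital_cstar_subalgebra B"
    and "strongly_Morita_equivalent_inclusions A B Y X"
    and "conditional_expectation A E_A" and "index_finite type_alg E_A"
    and "conditional_expectation B E_B" and "index_finite type_alg E_B"
    and "index_W type_alg E_A \<in> A"
    and "bimodule_expectation A B Y X E_A E_B E_X"
  shows "let S = \<lparr>lalg = type_alg, lexp = E_A, ralg = type_alg, rexp = E_B, bim = Y, bexp = E_X\<rparr>;
             S1 = upward S; S2 = upward S1;
             C1 = lalg S1; D1 = ralg S1; Y1 = bim S1;
             C2 = lalg S2; D2 = ralg S2; Y2 = bim S2;
             E_Y1 = dual_bimodule_expectation S1
         in \<exists>k p q \<theta> \<psi> \<theta>1 \<psi>1 \<Phi> \<Phi>1.
           let MA = mat_alg k (type_alg\<lparr>acarrier := A\<rparr>); MB = mat_alg k (type_alg\<lparr>acarrier := B\<rparr>);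
               MC = mat_alg k type_alg; MD = mat_alg k type_alg;
               MX = mat_bimod k (Y\<lparr>bcarrier := X\<rparr>); MY = mat_bimod k Y
           in k > 0 \<and> full_projection MA p \<and> full_projection MB q \<and>
              star_alg_iso \<theta> C1 (corner MA p) \<and> star_alg_iso \<psi> D1 (corner MB q) \<and>
              star_alg_iso \<theta>1 C2 (corner MC p) \<and> star_alg_iso \<psi>1 D2 (corner MD q) \<and>
              equivalence_bimodule_iso C1 D1 \<theta> \<psi> \<Phi> Y1 (corner_bimod MX p q) \<and>
              equivalence_bimodule_iso C2 D2 \<theta>1 \<psi>1 \<Phi>1 Y2 (corner_bimod MY p q) \<and>
              (\<forall>t\<in>bcarrier Y2. mat_map E_X (\<Phi>1 t) = \<Phi> (E_Y1 t))"
proof -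
  obtain n u m v where uv: "quasi_basis type_alg E_A n u" "quasi_basis type_alg E_B m v"
    using assms(5,7) unfolding index_finite_def by blast
  \<comment> \<open>A common length of the frames, positive also when both quasi-bases are empty.\<close>
  define k where "k = Suc (n + m)"
  define u' where "u' = (\<lambda>i. if i < n then u i else 0)"
  define v' where "v' = (\<lambda>i. if i < m then v i else 0)"
  have qb: "quasi_basis type_alg E_A k u'" "quasi_basis type_alg E_B k v'"
    unfolding u'_def v'_def using uv by (auto intro!: quasi_basis_pad simp: k_def)
  have eb: "equivalence_bimodule Y"
    using assms(3) by (simp add: strongly_Morita_equivalent_inclusions_def)
  interpret inclusion_pair A E_A k u' B E_B v' Y X E_X
    by (intro inclusion_pair.intro inclusion_pair_axioms.intro finite_index.intro eq_bimodule.intro assms qb eb)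
  have index: "L.index \<in> A" using assms(8) by (simp only: L.index_W)
  let ?S = "\<lparr>lalg = type_alg, lexp = E_A, ralg = type_alg, rexp = E_B, bim = Y, bexp = E_X\<rparr>"
  have S1: "upward ?S = two.data" by (rule upward_data)
  have S2: "lalg (upward two.data) = L.second.basic" "ralg (upward two.data) = R.second.basic"
    "bim (upward two.data) = two.Y1"
    by (simp_all add: upward_def two.data_simps)
  have full: "mat_alg k (type_alg\<lparr>acarrier := UNIV\<rparr>) = mat_alg k (type_alg :: 'c star_alg)"
    "mat_alg k (type_alg\<lparr>acarrier := UNIV\<rparr>) = mat_alg k (type_alg :: 'd star_alg)"
    "Y\<lparr>bcarrier := UNIV\<rparr> = Y"
    using carrier_UNIV by (simp_all add: type_alg_def)
  show ?thesis
    unfolding Let_def S1 S2 two.data_simps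
  proof (intro exI conjI)
    show "k > 0" by (simp add: k_def)
    show "full_projection (mat_alg k (type_alg\<lparr>acarrier := A\<rparr>)) L.first.gram"
      by (rule L.first.full_projection_gram)
    show "full_projection (mat_alg k (type_alg\<lparr>acarrier := B\<rparr>)) R.first.gram"
      by (rule R.first.full_projection_gram)
    show "star_alg_iso L.first.to_matrix L.C1 (corner (mat_alg k (type_alg\<lparr>acarrier := A\<rparr>)) L.first.gram)"
      using L.first.star_alg_iso_to_matrix by simp
    show "star_alg_iso R.first.to_matrix R.C1 (corner (mat_alg k (type_alg\<lparr>acarrier := B\<rparr>)) R.first.gram)"
      using R.first.star_alg_iso_to_matrix by simp
    show "star_alg_iso L.second.to_matrix L.second.basic (corner (mat_alg k type_alg) L.first.gram)"
      using L.second.star_alg_iso_to_matrix by (simp only: full L.gram_second)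
    show "star_alg_iso R.second.to_matrix R.second.basic (corner (mat_alg k type_alg) R.first.gram)"
      using R.second.star_alg_iso_to_matrix by (simp only: full R.gram_second)
    show "equivalence_bimodule_iso L.C1 R.C1 L.first.to_matrix R.first.to_matrix one.coordinates
        one.Y1 (corner_bimod (mat_bimod k (Y\<lparr>bcarrier := X\<rparr>)) L.first.gram R.first.gram)"
      using one.equivalence_bimodule_iso_coordinates by simp
    show "equivalence_bimodule_iso L.second.basic R.second.basic L.second.to_matrix R.second.to_matrix two.coordinates
        two.Y1 (corner_bimod (mat_bimod k Y) L.first.gram R.first.gram)"
      using two.equivalence_bimodule_iso_coordinates by (simp only: full L.gram_second R.gram_second)
    show "\<forall>t\<in>bcarrier two.Y1.
        mat_map E_X (two.coordinates t) = one.coordinates (dual_bimodule_expectation two.data t)"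
      using expectation_coordinates[OF index] unfolding two.bcarrier_upward by blast
  qed
qed

end
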